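(* Let $X$ be a spectrally negative L\'evy process with $X_0=0$, let $\xi>0$, and let $\iota$ be the positive self-similar Markov process with $\iota_0=1$ obtained from $X$ by the Lamperti transformation $$\iota_t=e^{-X_{\tau(t)}},\qquad \tau(t)=\inf\left\{s\ge0:\int_0^s e^{-\xi X_w}\,dw\ge t\right\}.$$ Let $b<0<c$, $\sigma_b^+=\inf\{t>0:\iota_t>e^{-b}\}$, $\sigma_c^-=\inf\{t>0:\iota_t<e^{-c}\}$, and let $\varrho_0\ge0$. Put $\omega(x)=\varrho\,e^{-\xi x}$ with $\varrho=\varrho_0e^{-\xi b}$, and let $\mathcal{W}^{(\omega)},\mathcal{Z}^{(\omega)}$ be the associated $\omega$-scale functions. Then $$\mathbb{E}\left[e^{-\varrho_0\sigma_c^-};\ \sigma_c^-<\sigma_b^+\right]=\frac{\mathcal{W}^{(\omega)}(-b)}{\mathcal{W}^{(\omega)}(c-b)},$$ $$\mathbb{E}\left[e^{-\varrho_0\sigma_b^+};\ \sigma_b^+<\sigma_c^-\right]=\mathcal{Z}^{(\omega)}(-b)-\frac{\mathcal{W}^{(\omega)}(-b)}{\mathcal{W}^{(\omega)}(c-b)}\,\mathcal{Z}^{(\omega)}(c-b).$$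
   Context: $X=\{X_t,t\ge 0\}$ is a spectrally negative L\'evy process (a c\`adl\`ag process with stationary independent increments and no positive jumps) that is not the negative of a subordinator. Its Laplace exponent $\psi$, defined by $\mathbb{E}[e^{\theta X_t}]=e^{t\psi(\theta)}$ for $\theta\ge 0$ (with $X_0=0$), is continuous and strictly convex on $[0,\infty)$ and tends to $\infty$ at $\infty$. $\mathbb{E}[\,\cdot\,;A]$ means $\mathbb{E}[\,\cdot\,\mathbf 1_A]$; $\inf\emptyset=\infty$. The process $\iota$ is considered for $t<\int_0^\infty e^{-\xi X_w}\,dw$ (its lifetime); it has no negative jumps. $\Phi(\theta)=\inf\{s>0:\psi(s)>\theta\}$, $\theta\ge0$. For $q\ge 0$ the scale function $W^{(q)}:\mathbb{R}\to[0,\infty)$ vanishes on $(-\infty,0)$, is continuous and increasing on $[0,\infty)$, and satisfies $\int_0^\infty e^{-\theta y}W^{(q)}(y)\,dy=1/(\psi(\theta)-q)$ for $\theta>\Phi(q)$. $W:=W^{(0)}$. The $\omega$-scale functions are the unique locally bounded functions on $\mathbb{R}$ satisfying $\mathcal{W}^{(\omega)}(x)=W(x)+\int_0^x W(x-y)\omega(y)\mathcal{W}^{(\omega)}(y)\,dy$ and $\mathcal{Z}^{(\omega)}(x)=1+\int_0^x W(x-y)\omega(y)\mathcal{Z}^{(\omega)}(y)\,dy$; for $x<0$ the integrals vanish, so $\mathcal{W}^{(\omega)}(x)=0$ and $\mathcal{Z}^{(\omega)}(x)=1$. *)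

theory Defs
  imports "HOL-Probability.Probability"
begin

definition cadlag_path :: "(real \<Rightarrow> real) \<Rightarrow> bool" where
  "cadlag_path f \<longleftrightarrow>
     (\<forall>t\<ge>0. (f \<longlongrightarrow> f t) (at_right t)) \<and>
     (\<forall>t>0. \<exists>l. (f \<longlongrightarrow> l) (at_left t))"

text \<open>The time index is the type of reals; only times \<open>t \<ge> 0\<close> are ever used.\<close>

locale levy_process = prob_space M for M :: "'a measure" +
  fixes X :: "real \<Rightarrow> 'a \<Rightarrow> real"
  assumes measurable_X: "\<And>t. 0 \<le> t \<Longrightarrow> X t \<in> borel_measurable M"
    and start: "AE z in M. X 0 z = 0"
    and cadlag: "\<And>z. z \<in> space M \<Longrightarrow> cadlag_path (\<lambda>t. X t z)"
    and independent_increments: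
      "\<And>(n::nat) s. 0 \<le> s 0 \<Longrightarrow> (\<And>i. i < n \<Longrightarrow> s i \<le> s (Suc i)) \<Longrightarrow>
         indep_vars (\<lambda>_. borel) (\<lambda>i z. X (s (Suc i)) z - X (s i) z) {..<n}"
    and stationary_increments:
      "\<And>s t. 0 \<le> s \<Longrightarrow> 0 \<le> t \<Longrightarrow>
         distr M borel (\<lambda>z. X (s + t) z - X s z) = distr M borel (\<lambda>z. X t z - X 0 z)"

text \<open>The last assumption says that \<open>X\<close> is not the negative of a subordinator, a subordinator
  being a Levy process whose paths are almost surely nondecreasing.\<close>

locale spectrally_negative_levy = levy_process +
  assumes no_positive_jumps:
      "AE z in M. \<forall>t>0. \<forall>l. ((\<lambda>s. X s z) \<longlongrightarrow> l) (at_left t) \<longrightarrow> X t z \<le> l"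
    and not_neg_subordinator:
      "\<not> (AE z in M. \<forall>s t. 0 \<le> s \<longrightarrow> s \<le> t \<longrightarrow> X t z \<le> X s z)"

text \<open>The right-hand side is positive, so the equation forces integrability (the Bochner integral
  of a non-integrable function is 0).\<close>

definition laplace_exponent ::
    "'a measure \<Rightarrow> (real \<Rightarrow> 'a \<Rightarrow> real) \<Rightarrow> (real \<Rightarrow> real) \<Rightarrow> bool" where
  "laplace_exponent M X \<psi> \<longleftrightarrow>
     (\<forall>\<theta>\<ge>0. \<forall>t\<ge>0. (LINT z|M. exp (\<theta> * X t z)) = exp (t * \<psi> \<theta>))"

text \<open>The real infimum is the intended one, since the Laplace exponent tends to infinity.\<close>

definition right_inverse :: "(real \<Rightarrow> real) \<Rightarrow> real \<Rightarrow> real" where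
  "right_inverse \<psi> \<theta> = Inf {s. 0 < s \<and> \<psi> s > \<theta>}"

definition scale_function :: "(real \<Rightarrow> real) \<Rightarrow> real \<Rightarrow> (real \<Rightarrow> real) \<Rightarrow> bool" where
  "scale_function \<psi> q W \<longleftrightarrow>
     (\<forall>x. 0 \<le> W x) \<and> (\<forall>x<0. W x = 0) \<and>
     continuous_on {0..} W \<and> mono_on {0..} W \<and>
     (\<forall>\<theta>>right_inverse \<psi> q.
        set_integrable lborel {0..} (\<lambda>y. exp (- \<theta> * y) * W y) \<and>
        (LINT y:{0..}|lborel. exp (- \<theta> * y) * W y) = 1 / (\<psi> \<theta> - q))"

definition locally_bounded :: "(real \<Rightarrow> real) \<Rightarrow> bool" where
  "locally_bounded f \<longleftrightarrow> (\<forall>a b. bounded (f ` {a..b}))"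

text \<open>Borel measurability, implicit in writing the integrals, has to be explicit because the
  Bochner integral is total. For \<open>x < 0\<close> the interval \<open>{0..x}\<close> is empty.\<close>

definition omega_scale_W ::
    "(real \<Rightarrow> real) \<Rightarrow> (real \<Rightarrow> real) \<Rightarrow> (real \<Rightarrow> real) \<Rightarrow> bool" where
  "omega_scale_W W \<omega> f \<longleftrightarrow>
     f \<in> borel_measurable borel \<and> locally_bounded f \<and>
     (\<forall>x. f x = W x + (LINT y:{0..x}|lborel. W (x - y) * \<omega> y * f y))"

definition omega_scale_Z ::
    "(real \<Rightarrow> real) \<Rightarrow> (real \<Rightarrow> real) \<Rightarrow> (real \<Rightarrow> real) \<Rightarrow> bool" where
  "omega_scale_Z W \<omega> f \<longleftrightarrow>
     f \<in> borel_measurable borel \<and> locally_bounded f \<and>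
     (\<forall>x. f x = 1 + (LINT y:{0..x}|lborel. W (x - y) * \<omega> y * f y))"

definition lamperti_lifetime :: "real \<Rightarrow> (real \<Rightarrow> 'a \<Rightarrow> real) \<Rightarrow> 'a \<Rightarrow> ennreal" where
  "lamperti_lifetime \<xi> X z = (\<integral>\<^sup>+ w\<in>{0..}. ennreal (exp (- \<xi> * X w z)) \<partial>lborel)"

text \<open>For \<open>t\<close> below the lifetime the set is nonempty, so the real infimum is the intended one.\<close>

definition lamperti_time :: "real \<Rightarrow> (real \<Rightarrow> 'a \<Rightarrow> real) \<Rightarrow> real \<Rightarrow> 'a \<Rightarrow> real" where
  "lamperti_time \<xi> X t z =
     Inf {s. 0 \<le> s \<and> (LINT w:{0..s}|lborel. exp (- \<xi> * X w z)) \<ge> t}"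

definition lamperti_pssmp :: "real \<Rightarrow> (real \<Rightarrow> 'a \<Rightarrow> real) \<Rightarrow> real \<Rightarrow> 'a \<Rightarrow> real" where
  "lamperti_pssmp \<xi> X t z = exp (- X (lamperti_time \<xi> X t z) z)"

text \<open>First passage above and below a level, for \<open>0 < t <\<close> lifetime; in the extended nonnegative
  reals the infimum of the empty set is \<open>\<infinity>\<close>.\<close>

definition passage_above :: "real \<Rightarrow> (real \<Rightarrow> 'a \<Rightarrow> real) \<Rightarrow> real \<Rightarrow> 'a \<Rightarrow> ennreal" where
  "passage_above \<xi> X y z =
     Inf {ennreal t | t. 0 < t \<and> ennreal t < lamperti_lifetime \<xi> X z \<and> lamperti_pssmp \<xi> X t z > y}"

definition passage_below :: "real \<Rightarrow> (real \<Rightarrow> 'a \<Rightarrow> real) \<Rightarrow> real \<Rightarrow> 'a \<Rightarrow> ennreal" where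
  "passage_below \<xi> X y z =
     Inf {ennreal t | t. 0 < t \<and> ennreal t < lamperti_lifetime \<xi> X z \<and> lamperti_pssmp \<xi> X t z < y}"

end

(*
The idea is that convolutions with W are harmonic away from their density.  If U = W * g with g
bounded and compactly supported, the bilateral Laplace transform of x |-> E U(x + X_t) is
exp(t psi) times that of U, and since the transform of W is 1/psi, uniqueness gives
E U(x + X_t) = U(x) + int_0^t E g(x + X_s) ds for almost every x, hence a generator estimate on
all of R.  No excursion theory is needed: an approximate delta placed just below 0 as a part of g
produces W itself, and the process does not see that part before it leaves [0, c].
Optional stopping, done along grids where only independence of increments is used, then gives
E[D_T H(Y_T)] = H(x) for H one of the two omega-scale functions, Y = x + X stopped at the exit time
T of [0, c], and D_T = exp(-int_0^T omega(Y)).  At T the process is at c or in (-oo, 0], where the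
two functions are 0 (respectively 1), except that the first one may be W(0) > 0 at 0.  That the
process does not creep to 0 in this case follows by comparing with the exit from [-delta, c]: there
the approximate delta only helps, so W(x) <= W(c) P(Y leaves [-delta, c] through c).
*)
theory Submission
  imports Defs "HOL-Complex_Analysis.Complex_Analysis" "HOL-Real_Asymp.Real_Asymp"
begin

section \<open>Uniqueness of bilateral Laplace transforms\<close>

text \<open>What is known about \<open>W\<close> dictates the shape: a Laplace transform for large
  arguments, monotonicity, continuity on the nonnegative half-line, but no derivatives and possibly
  a jump at 0. Calculus for smooth functions is therefore out of reach, and the generator appears
  only through differences over a time \<open>h\<close>. An error \<open>h * e\<close>, uniform on
  the interval, is just what a grid of \<open>t / h\<close> steps can absorb, since the accumulated
  error is of order \<open>e * t\<close>. Uniformity is the reason why densities have to be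
  uniformly continuous near the interval, and why identities for almost every starting point are
  first extended to all points by continuity. Limits are exchanged with expectations in two ways. On
  a grid a single step may overshoot \<open>c\<close>, and above \<open>c\<close> the test functions
  grow exponentially; there second moments give uniform integrability. In continuous time the
  absence of positive jumps keeps the stopped position at most \<open>c\<close>, where the functions
  are bounded, and domination suffices.\<close>

lemma exp_abs_power_le:
  fixes d y :: real
  assumes "0 \<le> d"
  shows "(\<Sum>n<N. \<bar>d * y\<bar> ^ n / fact n) \<le> exp (d * y) + exp (- (d * y))"
proof -
  have s: "(\<lambda>n. \<bar>d * y\<bar> ^ n / fact n) sums exp \<bar>d * y\<bar>"
    using exp_converges[of "\<bar>d * y\<bar>"] by (simp add: divide_inverse mult.commute)
  have "(\<Sum>n<N. \<bar>d * y\<bar> ^ n / fact n) \<le> exp \<bar>d * y\<bar>"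
    unfolding sums_unique[OF s] by (rule sum_le_suminf) (use s in \<open>auto simp: sums_iff\<close>)
  also have "\<dots> \<le> exp (d * y) + exp (- (d * y))"
    by (cases "0 \<le> d * y") auto
  finally show ?thesis .
qed

text \<open>Around a centre \<open>z0\<close> the exponential is expanded in powers of z -
  \<open>z0\<close> and the series is integrated term by term. This works on the largest disc around
  \<open>z0\<close> that fits into the strip, so every point of the strip is covered.\<close>

lemma holomorphic_moment_generating:
  fixes \<mu> :: "real measure"
  assumes sets: "sets \<mu> = sets borel"
    and int: "\<And>r. \<bar>r\<bar> < \<rho> \<Longrightarrow> integrable \<mu> (\<lambda>y. exp (r * y))"
  shows "(\<lambda>z. \<integral>y. exp (z * complex_of_real y) \<partial>\<mu>) holomorphic_on {z. \<bar>Re z\<bar> < \<rho>}"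
proof -
  let ?L = "\<lambda>z. \<integral>y. exp (z * complex_of_real y) \<partial>\<mu>"
  have [measurable_cong]: "sets \<mu> = sets borel" by (rule sets)
  have hol: "?L holomorphic_on ball z0 (\<rho> - \<bar>Re z0\<bar>)" if z0: "\<bar>Re z0\<bar> < \<rho>" for z0
  proof (rule power_series_holomorphic[where
        a = "\<lambda>n. \<integral>y. complex_of_real y ^ n / fact n * exp (z0 * complex_of_real y) \<partial>\<mu>"])
    fix w assume w: "w \<in> ball z0 (\<rho> - \<bar>Re z0\<bar>)"
    define d where "d = cmod (w - z0)"
    have d: "0 \<le> d" "d < \<rho> - \<bar>Re z0\<bar>"
      using w by (auto simp: d_def dist_norm norm_minus_commute)
    let ?f = "\<lambda>n y. complex_of_real y ^ n / fact n * exp (z0 * complex_of_real y) * (w - z0) ^ n"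
    \<comment> \<open>Majorant of all partial sums, from \<open>exp_abs_power_le\<close>. Its two
      exponents stay strictly between -\<rho> and \<rho> because \<open>d\<close> is less than the
      distance of \<open>z0\<close> to the boundary of the strip, so it is integrable.\<close>
    let ?b = "\<lambda>y. exp ((Re z0 + d) * y) + exp ((Re z0 - d) * y)"
    have b: "integrable \<mu> ?b"
      using d by (intro Bochner_Integration.integrable_add int) auto
    have nf: "norm (?f n y) = \<bar>d * y\<bar> ^ n / fact n * exp (Re z0 * y)" for n y
      using d by (simp add: norm_mult norm_power norm_divide power_mult_distrib abs_mult d_def)
    have bound: "(\<Sum>n<N. norm (?f n y)) \<le> ?b y" for N y
    proof -
      have "(\<Sum>n<N. norm (?f n y)) = (\<Sum>n<N. \<bar>d * y\<bar> ^ n / fact n) * exp (Re z0 * y)"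
        by (simp only: nf sum_distrib_right)
      also have "\<dots> \<le> (exp (d * y) + exp (- (d * y))) * exp (Re z0 * y)"
        by (intro mult_right_mono exp_abs_power_le d) auto
      also have "\<dots> = ?b y" by (simp add: algebra_simps exp_add exp_diff exp_minus divide_inverse)
      finally show ?thesis .
    qed
    have one: "norm (?f n y) \<le> ?b y" for n y
      using bound[where N="Suc n" and y=y] sum_nonneg[of "{..<n}" "\<lambda>n. norm (?f n y)"] by simp
    have fi: "integrable \<mu> (?f n)" for n
      by (rule Bochner_Integration.integrable_bound[OF b])
         (use one in \<open>auto intro!: AE_I2 simp: abs_of_nonneg\<close>)
    have sumf: "summable (\<lambda>n. norm (?f n y))" for y
      by (rule summableI_nonneg_bounded[where x="?b y"]) (use bound in auto)
    have sumi: "summable (\<lambda>n. \<integral>y. norm (?f n y) \<partial>\<mu>)"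
    proof (rule summableI_nonneg_bounded[where x="\<integral>y. ?b y \<partial>\<mu>"])
      fix N
      have "(\<Sum>n<N. \<integral>y. norm (?f n y) \<partial>\<mu>) = (\<integral>y. (\<Sum>n<N. norm (?f n y)) \<partial>\<mu>)"
        using fi by (intro Bochner_Integration.integral_sum[symmetric]) auto
      also have "\<dots> \<le> (\<integral>y. ?b y \<partial>\<mu>)"
        using fi b bound by (intro integral_mono Bochner_Integration.integrable_sum) auto
      finally show "(\<Sum>n<N. \<integral>y. norm (?f n y) \<partial>\<mu>) \<le> (\<integral>y. ?b y \<partial>\<mu>)" .
    qed auto
    have lim: "(\<Sum>n. ?f n y) = exp (w * complex_of_real y)" for y
    proof -
      have "(\<lambda>n. exp (z0 * complex_of_real y) * (((w - z0) * complex_of_real y) ^ n /\<^sub>R fact n)) sums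
              (exp (z0 * complex_of_real y) * exp ((w - z0) * complex_of_real y))"
        by (intro sums_mult exp_converges)
      moreover have "(\<lambda>n. exp (z0 * complex_of_real y) * (((w - z0) * complex_of_real y) ^ n /\<^sub>R fact n)) = (\<lambda>n. ?f n y)"
        by (auto simp: fun_eq_iff power_mult_distrib scaleR_conv_of_real divide_inverse)
      moreover have "exp (z0 * complex_of_real y) * exp ((w - z0) * complex_of_real y) = exp (w * complex_of_real y)"
        by (simp add: exp_add[symmetric] algebra_simps)
      ultimately show ?thesis by (simp add: sums_iff)
    qed
    have "(\<lambda>n. \<integral>y. ?f n y \<partial>\<mu>) sums (\<integral>y. (\<Sum>n. ?f n y) \<partial>\<mu>)"
      by (rule sums_integral) (use fi sumf sumi in auto)
    then show "(\<lambda>n. (\<integral>y. complex_of_real y ^ n / fact n * exp (z0 * complex_of_real y) \<partial>\<mu>) * (w - z0) ^ n)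
        sums ?L w"
      unfolding lim by simp
  qed
  show ?thesis
    unfolding holomorphic_on_def
  proof (intro ballI)
    fix z assume "z \<in> {z. \<bar>Re z\<bar> < \<rho>}"
    then have "?L field_differentiable at z"
      using hol[of z] by (auto intro!: holomorphic_on_imp_differentiable_at[of _ "ball z (\<rho> - \<bar>Re z\<bar>)"])
    then show "?L field_differentiable at z within {z. \<bar>Re z\<bar> < \<rho>}"
      by (rule field_differentiable_at_within)
  qed
qed

text \<open>The two transforms are holomorphic on the strip and agree on a real segment, hence on
  the whole strip; on the imaginary axis they are the characteristic functions.\<close>

lemma real_distribution_eqI_moment_generating:
  fixes \<mu> \<nu> :: "real measure"
  assumes "real_distribution \<mu>" "real_distribution \<nu>" "0 < \<rho>"
    and i1: "\<And>r. \<bar>r\<bar> < \<rho> \<Longrightarrow> integrable \<mu> (\<lambda>y. exp (r * y))"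
    and i2: "\<And>r. \<bar>r\<bar> < \<rho> \<Longrightarrow> integrable \<nu> (\<lambda>y. exp (r * y))"
    and eq: "\<And>r. \<bar>r\<bar> < \<rho> \<Longrightarrow> (\<integral>y. exp (r * y) \<partial>\<mu>) = (\<integral>y. exp (r * y) \<partial>\<nu>)"
  shows "\<mu> = \<nu>"
proof (rule Levy_uniqueness)
  interpret m: real_distribution \<mu> by fact
  interpret n: real_distribution \<nu> by fact
  let ?S = "{z. \<bar>Re z\<bar> < \<rho>}"
  let ?L = "\<lambda>\<mu> z. \<integral>y. exp (z * complex_of_real y) \<partial>\<mu>"
  have S: "?S = {z. Re z < \<rho>} \<inter> {z. - \<rho> < Re z}" by auto
  have eqL: "?L \<mu> z - ?L \<nu> z = 0" if z: "z \<in> ?S" for z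
  proof (rule analytic_continuation[where S="?S" and U="complex_of_real ` {-\<rho><..<\<rho>}" and \<xi>=0
        and f="\<lambda>z. ?L \<mu> z - ?L \<nu> z"])
    show "(\<lambda>z. ?L \<mu> z - ?L \<nu> z) holomorphic_on ?S"
      by (intro holomorphic_on_diff holomorphic_moment_generating i1 i2) auto
    show "open ?S" unfolding S by (intro open_Int open_halfspace_Re_lt open_halfspace_Re_gt)
    show "connected ?S" unfolding S
      by (intro convex_connected convex_Int convex_halfspace_Re_lt convex_halfspace_Re_gt)
    show "complex_of_real ` {-\<rho><..<\<rho>} \<subseteq> ?S" by auto
    show "(0::complex) \<in> ?S" using \<open>0 < \<rho>\<close> by simp
    show "(0::complex) islimpt complex_of_real ` {-\<rho><..<\<rho>}"
      unfolding islimpt_approachable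
    proof (intro allI impI)
      fix e :: real assume "0 < e"
      let ?x = "min (e / 2) (\<rho> / 2)"
      have "?x \<in> {-\<rho><..<\<rho>}" "?x \<noteq> 0" "\<bar>?x\<bar> < e"
        using \<open>0 < e\<close> \<open>0 < \<rho>\<close> by (auto simp: min_def)
      moreover from this have "dist (complex_of_real ?x) 0 < e"
        by (simp only: dist_norm diff_zero norm_of_real)
      ultimately show "\<exists>x'\<in>complex_of_real ` {-\<rho><..<\<rho>}. x' \<noteq> 0 \<and> dist x' 0 < e"
        by (metis imageI of_real_eq_0_iff)
    qed
    fix z assume "z \<in> complex_of_real ` {-\<rho><..<\<rho>}"
    then obtain r where r: "z = complex_of_real r" "\<bar>r\<bar> < \<rho>" by auto
    have "?L \<mu> z = complex_of_real (\<integral>y. exp (r * y) \<partial>\<mu>)" "?L \<nu> z = complex_of_real (\<integral>y. exp (r * y) \<partial>\<nu>)"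
      unfolding r(1) by (simp_all add: exp_of_real of_real_mult[symmetric] del: of_real_mult)
    then show "?L \<mu> z - ?L \<nu> z = 0" using eq[OF r(2)] by simp
  qed (fact z)
  show "char \<mu> = char \<nu>"
  proof
    fix t
    show "char \<mu> t = char \<nu> t"
      using eqL[of "\<i> * complex_of_real t"] \<open>0 < \<rho>\<close>
      by (simp add: char_def mult.assoc)
  qed
qed fact+

text \<open>The measures may be infinite, so the result for distributions is applied after
  exponential tilting: the density exp(-\<theta>1 y) / m produces total mass 1, and the tilted
  measure has exponential moments for |r| < 1 because \<theta>1 - r > \<theta>0. The density is
  strictly positive, so the tilting can be undone.\<close>

lemma measure_eqI_Laplace:
  fixes N1 N2 :: "real measure" and \<theta>0 :: real
  assumes sets1: "sets N1 = sets borel" and sets2: "sets N2 = sets borel"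
    and eq: "\<And>\<theta>. \<theta> > \<theta>0 \<Longrightarrow> (\<integral>\<^sup>+y. ennreal (exp (- \<theta> * y)) \<partial>N1) = (\<integral>\<^sup>+y. ennreal (exp (- \<theta> * y)) \<partial>N2)"
    and fin: "\<And>\<theta>. \<theta> > \<theta>0 \<Longrightarrow> (\<integral>\<^sup>+y. ennreal (exp (- \<theta> * y)) \<partial>N1) < \<infinity>"
  shows "N1 = N2"
proof -
  have [measurable_cong]: "sets N1 = sets borel" "sets N2 = sets borel" by fact+
  define \<theta>1 where "\<theta>1 = \<theta>0 + 1"
  define m where "m = enn2real (\<integral>\<^sup>+y. ennreal (exp (- \<theta>1 * y)) \<partial>N1)"
  have m1: "(\<integral>\<^sup>+y. ennreal (exp (- \<theta>1 * y)) \<partial>N1) = ennreal m"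
    and m2: "(\<integral>\<^sup>+y. ennreal (exp (- \<theta>1 * y)) \<partial>N2) = ennreal m"
    using eq[of \<theta>1] fin[of \<theta>1] by (auto simp: m_def \<theta>1_def)
  have m0: "0 \<le> m" by (simp add: m_def)
  show ?thesis
  proof (cases "m = 0")
    \<comment> \<open>Normalisation is impossible here, but a strictly positive function with
      integral 0 forces both measures to be null.\<close>
    case True
    have null: "emeasure N (space N) = 0"
      if N: "sets N = sets borel" "(\<integral>\<^sup>+y. ennreal (exp (- \<theta>1 * y)) \<partial>N) = 0" for N :: "real measure"
    proof -
      have [measurable_cong]: "sets N = sets borel" by fact
      have "AE y in N. ennreal (exp (- \<theta>1 * y)) = 0"
        using N(2) by (subst (asm) nn_integral_0_iff_AE) auto
      then have "AE y in N. False" by eventually_elim auto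
      then show ?thesis by (simp add: eventually_ae_filter null_sets_def emeasure_eq_0) (metis emeasure_eq_0 sets.top)
    qed
    have "emeasure N1 (space N1) = 0" "emeasure N2 (space N2) = 0"
      using null[OF sets1] null[OF sets2] m1 m2 True by auto
    then have "emeasure N1 A = emeasure N2 A" if "A \<in> sets N1" for A
      using that sets1 sets2 by (metis emeasure_eq_0 sets.sets_into_space sets.top)
    then show ?thesis using sets1 sets2 by (intro measure_eqI) auto
  next
    case False
    then have m: "0 < m" using m0 by simp
    let ?w = "\<lambda>y. ennreal (exp (- \<theta>1 * y) / m)"
    have core: "real_distribution (density N ?w)"
        "\<And>r. \<bar>r\<bar> < 1 \<Longrightarrow> integrable (density N ?w) (\<lambda>y. exp (r * y))"
        "\<And>r. \<bar>r\<bar> < 1 \<Longrightarrow> (\<integral>y. exp (r * y) \<partial>density N ?w) =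
            enn2real (\<integral>\<^sup>+y. ennreal (exp (- (\<theta>1 - r) * y)) \<partial>N) / m"
        "N = density (density N ?w) (\<lambda>y. ennreal (exp (\<theta>1 * y) * m))"
      if N: "sets N = sets borel"
        and fN: "\<forall>\<theta>>\<theta>0. (\<integral>\<^sup>+y. ennreal (exp (- \<theta> * y)) \<partial>N) < \<infinity>"
        and mN: "(\<integral>\<^sup>+y. ennreal (exp (- \<theta>1 * y)) \<partial>N) = ennreal m" for N :: "real measure"
    proof -
      have [measurable_cong]: "sets N = sets borel" by fact
      have nn: "(\<integral>\<^sup>+y. ennreal (exp (r * y)) \<partial>density N ?w)
          = (\<integral>\<^sup>+y. ennreal (exp (- (\<theta>1 - r) * y)) \<partial>N) / ennreal m" for r
      proof -
        have "(\<integral>\<^sup>+y. ennreal (exp (r * y)) \<partial>density N ?w)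
            = (\<integral>\<^sup>+y. ennreal (1 / m) * ennreal (exp (- (\<theta>1 - r) * y)) \<partial>N)"
          using m by (subst nn_integral_density)
             (auto intro!: nn_integral_cong simp: ennreal_mult[symmetric] exp_add[symmetric] field_simps)
        also have "\<dots> = ennreal (1 / m) * (\<integral>\<^sup>+y. ennreal (exp (- (\<theta>1 - r) * y)) \<partial>N)"
          by (subst nn_integral_cmult) auto
        also have "\<dots> = (\<integral>\<^sup>+y. ennreal (exp (- (\<theta>1 - r) * y)) \<partial>N) / ennreal m"
          using m by (simp add: divide_ennreal_def inverse_ennreal mult.commute inverse_eq_divide)
        finally show ?thesis .
      qed
      show "real_distribution (density N ?w)"
      proof (intro real_distribution.intro prob_spaceI real_distribution_axioms.intro)
        show "emeasure (density N ?w) (space (density N ?w)) = 1"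
          using nn[of 0] mN m sets_eq_imp_space_eq[OF N]
          by (simp add: nn_integral_const ennreal_divide_self)
      qed (use sets_eq_imp_space_eq[OF N] N in auto)
      show i: "integrable (density N ?w) (\<lambda>y. exp (r * y))" if r: "\<bar>r\<bar> < 1" for r
      proof (rule integrableI_nonneg)
        have "(\<integral>\<^sup>+y. ennreal (exp (- (\<theta>1 - r) * y)) \<partial>N) < \<infinity>"
          using r fN[rule_format, of "\<theta>1 - r"] by (simp add: \<theta>1_def)
        then show "(\<integral>\<^sup>+ y. ennreal (exp (r * y)) \<partial>density N ?w) < \<infinity>"
          unfolding nn using m by (simp add: divide_ennreal_def inverse_ennreal ennreal_mult_less_top)
      qed auto
      show "(\<integral>y. exp (r * y) \<partial>density N ?w) =
            enn2real (\<integral>\<^sup>+y. ennreal (exp (- (\<theta>1 - r) * y)) \<partial>N) / m" for r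
      proof -
        have "(\<integral>y. exp (r * y) \<partial>density N ?w) = enn2real (\<integral>\<^sup>+y. ennreal (exp (r * y)) \<partial>density N ?w)"
          by (rule integral_eq_nn_integral) auto
        then show ?thesis unfolding nn using m
          by (simp add: divide_ennreal_def enn2real_mult inverse_ennreal divide_inverse)
      qed
      have "density (density N ?w) (\<lambda>y. ennreal (exp (\<theta>1 * y) * m)) = density N (\<lambda>y. 1)"
        using m by (subst density_density_eq)
          (auto intro!: density_cong simp: ennreal_mult[symmetric] exp_add[symmetric] field_simps)
      then show "N = density (density N ?w) (\<lambda>y. ennreal (exp (\<theta>1 * y) * m))"
        by (simp add: density_1)
    qed
    have fin1: "\<forall>\<theta>>\<theta>0. (\<integral>\<^sup>+y. ennreal (exp (- \<theta> * y)) \<partial>N1) < \<infinity>"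
      using fin by simp
    note c1 = core[OF sets1 fin1 m1]
    have fin2: "\<forall>\<theta>>\<theta>0. (\<integral>\<^sup>+y. ennreal (exp (- \<theta> * y)) \<partial>N2) < \<infinity>"
      using fin eq by simp
    note c2 = core[OF sets2 fin2 m2]
    have "density N1 ?w = density N2 ?w"
    proof (rule real_distribution_eqI_moment_generating[where \<rho>=1])
      fix r :: real assume r: "\<bar>r\<bar> < 1"
      then have "\<theta>1 - r > \<theta>0" by (auto simp: \<theta>1_def)
      then show "(\<integral>y. exp (r * y) \<partial>density N1 ?w) = (\<integral>y. exp (r * y) \<partial>density N2 ?w)"
        by (simp only: c1(3)[OF r] c2(3)[OF r] eq)
    qed (use c1 c2 in auto)
    then show ?thesis using c1(4) c2(4) by metis
  qed
qed

section \<open>Cadlag paths and their discretisation\<close>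

text \<open>Time is rounded up to a grid, so that each approximation involves only countably many
  sections of the process.\<close>

lemma borel_measurable_right_continuous_process:
  fixes X :: "real \<Rightarrow> 'a \<Rightarrow> real"
  assumes meas: "\<And>t. 0 \<le> t \<Longrightarrow> X t \<in> borel_measurable M"
    and rc: "\<And>z t. z \<in> space M \<Longrightarrow> 0 \<le> t \<Longrightarrow> ((\<lambda>s. X s z) \<longlongrightarrow> X t z) (at_right t)"
  shows "(\<lambda>(s, z). X (max 0 s) z) \<in> borel_measurable (borel \<Otimes>\<^sub>M M)"
proof -
  \<comment> \<open>The added 1 puts the grid point strictly to the right of the time, since
    \<open>at_right\<close> ignores the time itself. The maxima extend the process to negative times
    by its value at 0, so that time ranges over all reals.\<close>
  define r :: "nat \<Rightarrow> real \<Rightarrow> real" where "r n s = max 0 (of_int (\<lfloor>real (Suc n) * max 0 s\<rfloor> + 1) / real (Suc n))" for n s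
  have floor_grid: "x < of_int (\<lfloor>a * x\<rfloor> + 1) / a \<and> of_int (\<lfloor>a * x\<rfloor> + 1) / a \<le> x + 1 / a" if "0 < a" for a x :: real
  proof -
    have "a * x < of_int (\<lfloor>a * x\<rfloor> + 1)" "of_int (\<lfloor>a * x\<rfloor> + 1) \<le> a * x + 1" by linarith+
    then show ?thesis using that by (simp add: field_simps del: of_int_add)
  qed
  have r_gt: "max 0 s < r n s" and r_le: "r n s \<le> max 0 s + 1 / real (Suc n)" for n s
    using floor_grid[of "real (Suc n)" "max 0 s"] unfolding r_def by linarith+
  have "(\<lambda>p. X (r n (fst p)) (snd p)) \<in> borel_measurable (borel \<Otimes>\<^sub>M M)" for n
  proof -
    have 1: "(\<lambda>p. X (max 0 (of_int (i + 1) / real (Suc n))) (snd p)) \<in> borel_measurable (borel \<Otimes>\<^sub>M M)" for i :: int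
      by (rule measurable_compose[OF measurable_snd meas]) auto
    have 2: "(\<lambda>p. \<lfloor>real (Suc n) * max 0 (fst p)\<rfloor>) \<in> measurable (borel \<Otimes>\<^sub>M M) (count_space (UNIV::int set))"
      by measurable
    show ?thesis
      unfolding r_def by (rule measurable_compose_countable[OF 1 2])
  qed
  moreover have "(\<lambda>n. X (r n (fst p)) (snd p)) \<longlonglongrightarrow> (case p of (s, z) \<Rightarrow> X (max 0 s) z)"
    if "p \<in> space (borel \<Otimes>\<^sub>M M)" for p
  proof -
    obtain s z where p: "p = (s, z)" by force
    then have z: "z \<in> space M" using that by (auto simp: space_pair_measure)
    have lim: "(\<lambda>n. r n s) \<longlonglongrightarrow> max 0 s"
    proof (rule tendsto_sandwich[OF _ _ tendsto_const])
      show "(\<lambda>n. max 0 s + 1 / real (Suc n)) \<longlonglongrightarrow> max 0 s"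
        using tendsto_add[OF tendsto_const LIMSEQ_Suc[OF lim_1_over_n]] by simp
    qed (intro always_eventually allI less_imp_le[OF r_gt] r_le)+
    have "filterlim (\<lambda>n. r n s) (at_right (max 0 s)) sequentially"
    proof -
      have "r n s \<in> {max 0 s<..} \<and> r n s \<noteq> max 0 s" for n
        using r_gt[of s n] by (metis greaterThan_iff less_irrefl)
      then have "\<forall>\<^sub>F n in sequentially. r n s \<in> {max 0 s<..} \<and> r n s \<noteq> max 0 s"
        by (intro always_eventually allI)
      then show ?thesis unfolding filterlim_at using lim by blast
    qed
    then have "(\<lambda>n. X (r n s) z) \<longlonglongrightarrow> X (max 0 s) z"
      by (rule filterlim_compose[OF rc[OF z], rotated]) simp
    then show ?thesis by (simp add: p)
  qed
  ultimately show ?thesis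
    by (rule borel_measurable_LIMSEQ_real[rotated])
qed

lemma cadlag_path_right: "cadlag_path f \<Longrightarrow> 0 \<le> t \<Longrightarrow> (f \<longlongrightarrow> f t) (at_right t)"
  by (simp add: cadlag_path_def)

lemma cadlag_path_borel_measurable:
  assumes "cadlag_path f"
  shows "(\<lambda>s. f (max 0 s)) \<in> borel_measurable borel"
proof -
  \<comment> \<open>A single path is a process over a one-point sample space.\<close>
  have "(\<lambda>(s, z). f (max 0 s)) \<in> borel_measurable (borel \<Otimes>\<^sub>M count_space (UNIV::unit set))"
    using cadlag_path_right[OF assms]
    by (intro borel_measurable_right_continuous_process[where X="\<lambda>s _. f s"]) auto
  from measurable_Pair1[OF this, of "()"] show ?thesis by simp
qed

text \<open>One-sided limits bound the path near each time, and finitely many such neighbourhoods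
  cover the compact interval.\<close>

lemma cadlag_path_bounded:
  assumes f: "cadlag_path f"
  shows "\<exists>B. \<forall>s\<in>{0..t}. \<bar>f s\<bar> \<le> B"
proof -
  have "\<exists>d b. 0 < d \<and> (\<forall>u\<in>ball s d \<inter> {0..}. \<bar>f u\<bar> \<le> b)" if s: "0 \<le> s" for s
  proof -
    have "\<forall>\<^sub>F u in at_right s. dist (f u) (f s) < 1"
      using tendstoD[OF cadlag_path_right[OF f s], of 1] by simp
    then obtain b1 where b1: "s < b1" "\<And>u. s < u \<Longrightarrow> u < b1 \<Longrightarrow> dist (f u) (f s) < 1"
      by (auto simp: eventually_at_right_field)
    obtain b2 l where b2: "b2 < s" "\<And>u. b2 < u \<Longrightarrow> u < s \<Longrightarrow> 0 \<le> u \<Longrightarrow> dist (f u) l < 1"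
    proof (cases "s = 0")
      \<comment> \<open>At 0 there is no left limit, but also no admissible time to the left; any
        negative \<open>b2\<close> serves.\<close>
      case True then show ?thesis by (intro that[of "-1"]) auto
    next
      case False
      then have "0 < s" using s by simp
      then have "\<exists>l. (f \<longlongrightarrow> l) (at_left s)" using f unfolding cadlag_path_def by blast
      then obtain l where "(f \<longlongrightarrow> l) (at_left s)" by blast
      from tendstoD[OF this, of 1] have "\<forall>\<^sub>F u in at_left s. dist (f u) l < 1" by simp
      then obtain b2 where "b2 < s" "\<And>u. b2 < u \<Longrightarrow> u < s \<Longrightarrow> dist (f u) l < 1"
        by (auto simp: eventually_at_left_field)
      then show ?thesis by (intro that) auto
    qed
    have "\<bar>f u\<bar> \<le> \<bar>f s\<bar> + \<bar>l\<bar> + 1" if "u \<in> ball s (min (b1 - s) (s - b2)) \<inter> {0..}" for u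
    proof -
      have "b2 < u" "u < b1" "0 \<le> u" using that by (auto simp: dist_real_def)
      then consider "u = s" | "dist (f u) (f s) < 1" | "dist (f u) l < 1"
        using b1(2)[of u] b2(2)[of u] by (meson linorder_less_linear)
      then show ?thesis by cases (auto simp: dist_real_def)
    qed
    then show ?thesis using b1(1) b2(1)
      by (intro exI[of _ "min (b1 - s) (s - b2)"] exI[of _ "\<bar>f s\<bar> + \<bar>l\<bar> + 1"]) auto
  qed
  then obtain d b where db: "\<And>s. 0 \<le> s \<Longrightarrow> 0 < d s" "\<And>s u. 0 \<le> s \<Longrightarrow> u \<in> ball s (d s) \<inter> {0..} \<Longrightarrow> \<bar>f u\<bar> \<le> b s"
    by metis
  obtain C where C: "C \<subseteq> {0..t}" "finite C" "{0..t} \<subseteq> (\<Union>s\<in>C. ball s (d s))"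
    by (rule compactE_image[OF compact_Icc[of 0 t], where C="{0..t}" and f="\<lambda>s. ball s (d s)"])
       (use db(1) in auto)
  show ?thesis
  proof (intro exI ballI)
    fix s assume s: "s \<in> {0..t}"
    then obtain c where c: "c \<in> C" "s \<in> ball c (d c)" using C(3) by blast
    then have "\<bar>f s\<bar> \<le> b c" using db(2)[of c s] C(1) s by auto
    also have "\<dots> \<le> (\<Sum>c\<in>C. \<bar>b c\<bar>)"
      using member_le_sum[of c C "\<lambda>c. \<bar>b c\<bar>"] c C(2) by auto
    finally show "\<bar>f s\<bar> \<le> (\<Sum>c\<in>C. \<bar>b c\<bar>)" .
  qed
qed

lemma cadlag_path_set_integrable:
  assumes f: "cadlag_path f" and k: "continuous_on UNIV (k :: real \<Rightarrow> real)" and "0 \<le> a"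
  shows "set_integrable lborel {a..t} (\<lambda>s. k (f s))"
proof -
  obtain B where B: "\<And>s. s \<in> {0..t} \<Longrightarrow> \<bar>f s\<bar> \<le> B" using cadlag_path_bounded[OF f] by metis
  have "bounded (k ` {-B..B})"
    by (intro compact_imp_bounded compact_continuous_image continuous_on_subset[OF k]) auto
  then obtain K where "\<forall>x\<in>k ` {-B..B}. norm x \<le> K" unfolding bounded_iff by blast
  then have K: "\<And>y. y \<in> {-B..B} \<Longrightarrow> \<bar>k y\<bar> \<le> K" by auto
  have [measurable]: "(\<lambda>s. f (max 0 s)) \<in> borel_measurable borel"
    by (rule cadlag_path_borel_measurable[OF f])
  have [measurable]: "k \<in> borel_measurable borel" by (rule borel_measurable_continuous_onI[OF k])
  have "set_integrable lborel {a..t} (\<lambda>s. k (f (max 0 s)))"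
    unfolding set_integrable_def
  proof (rule Bochner_Integration.integrable_bound[where f="\<lambda>s. K * indicator {a..t} s"])
    show "AE x in lborel. norm (indicator {a..t} x *\<^sub>R k (f (max 0 x))) \<le> norm (K * indicator {a..t} x)"
    proof (intro AE_I2)
      fix x show "norm (indicator {a..t} x *\<^sub>R k (f (max 0 x))) \<le> norm (K * indicator {a..t} x)"
        using K[of "f x"] B[of x] \<open>0 \<le> a\<close> by (auto simp: indicator_def abs_le_iff max_def)
    qed
  qed (auto intro!: integrable_mult_right integrable_real_indicator simp: emeasure_lborel_Icc_eq)
  then show ?thesis
    by (rule set_integrable_cong[THEN iffD1, rotated -1]) (use \<open>0 \<le> a\<close> in auto)
qed

text \<open>The sum is the integral of a step function that takes on each cell the value at the
  right end point. That point is strictly later than \<open>s\<close> and tends to \<open>s\<close>,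
  so right continuity of \<open>g\<close> is enough for pointwise convergence. The number
  \<open>N n\<close> of cells varies because the sums are to be cut at a stopping time.\<close>

lemma right_Riemann_sum_tendsto:
  fixes g :: "real \<Rightarrow> real" and N :: "nat \<Rightarrow> nat"
  assumes rc: "\<And>s. 0 \<le> s \<Longrightarrow> (g \<longlongrightarrow> g s) (at_right s)"
    and B: "\<And>s. s \<in> {0..t} \<Longrightarrow> \<bar>g s\<bar> \<le> B" and "0 < t"
    and N: "\<And>n. N n \<le> n" and u: "(\<lambda>n. real (N n) * (t / real n)) \<longlonglongrightarrow> u"
    and meas: "(\<lambda>s. g (max 0 s)) \<in> borel_measurable borel"
  shows "(\<lambda>n. t / real n * (\<Sum>i<N n. g (real (Suc i) * (t / real n)))) \<longlonglongrightarrow> (LINT s:{0..u}|lborel. g s)"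
proof -
  note [measurable] = meas
  have B0: "0 \<le> B" using B[of 0] \<open>0 < t\<close> by fastforce
  define h where "h n = t / real n" for n
  have h: "0 < h n" "real n * h n = t" if "n > 0" for n using that \<open>0 < t\<close> by (auto simp: h_def)
  define F where "F n s = (\<Sum>i<N n. g (real (Suc i) * h n) * indicator {real i * h n..<real (Suc i) * h n} s)" for n s
  have F_meas: "F n \<in> borel_measurable borel" for n unfolding F_def by measurable
  have u0: "0 \<le> u" by (rule LIMSEQ_le_const[OF u]) (use \<open>0 < t\<close> in auto)
  have F_int: "(LINT s|lborel. F n s) = h n * (\<Sum>i<N n. g (real (Suc i) * h n))" if "n > 0" for n
  proof -
    have "(LINT s|lborel. F n s) = (\<Sum>i<N n. LINT s|lborel. g (real (Suc i) * h n) * indicator {real i * h n..<real (Suc i) * h n} s)"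
      unfolding F_def using h(1)[OF that]
      by (intro Bochner_Integration.integral_sum integrable_mult_right integrable_real_indicator)
         (auto simp: emeasure_lborel_Ico mult_right_mono)
    also have "\<dots> = (\<Sum>i<N n. g (real (Suc i) * h n) * h n)"
      using h(1)[OF that] by (intro sum.cong) (auto simp: algebra_simps)
    finally show ?thesis by (simp add: sum_distrib_left mult.commute)
  qed
  have F_eval: "F n s = (if 0 \<le> s \<and> nat \<lfloor>s / h n\<rfloor> < N n then g (real (Suc (nat \<lfloor>s / h n\<rfloor>)) * h n) else 0)"
    if n: "n > 0" for n s
  proof -
    have *: "s \<in> {real i * h n..<real (Suc i) * h n} \<longleftrightarrow> 0 \<le> s \<and> i = nat \<lfloor>s / h n\<rfloor>" for i
    proof -
      have "s \<in> {real i * h n..<real (Suc i) * h n} \<longleftrightarrow> real i \<le> s / h n \<and> s / h n < real i + 1"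
        using h(1)[OF n] by (simp add: field_simps)
      also have "\<dots> \<longleftrightarrow> \<lfloor>s / h n\<rfloor> = int i" by (auto simp: floor_eq_iff)
      also have "\<dots> \<longleftrightarrow> 0 \<le> s \<and> i = nat \<lfloor>s / h n\<rfloor>"
      proof -
        have "0 \<le> s \<longleftrightarrow> 0 \<le> \<lfloor>s / h n\<rfloor>" using h(1)[OF n] by (simp add: zero_le_divide_iff)
        moreover have "\<lfloor>s / h n\<rfloor> = int i \<longleftrightarrow> 0 \<le> \<lfloor>s / h n\<rfloor> \<and> i = nat \<lfloor>s / h n\<rfloor>" by linarith
        ultimately show ?thesis by blast
      qed
      finally show ?thesis .
    qed
    have "F n s = (\<Sum>i<N n. if i = nat \<lfloor>s / h n\<rfloor> then (if 0 \<le> s then g (real (Suc i) * h n) else 0) else 0)"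
      unfolding F_def indicator_def by (intro sum.cong refl) (simp only: *, auto)
    then show ?thesis by (simp add: sum.delta)
  qed
  have grid: "nat \<lfloor>s / h n\<rfloor> < N n \<longleftrightarrow> s < real (N n) * h n"
       "s < real (Suc (nat \<lfloor>s / h n\<rfloor>)) * h n" "real (Suc (nat \<lfloor>s / h n\<rfloor>)) * h n \<le> s + h n"
    if "n > 0" "0 \<le> s" for n s
  proof -
    have sp: "0 \<le> s / h n" using h(1)[OF that(1)] that by simp
    then have e: "real (nat \<lfloor>s / h n\<rfloor>) = of_int \<lfloor>s / h n\<rfloor>" by simp
    have "nat \<lfloor>s / h n\<rfloor> < N n \<longleftrightarrow> \<lfloor>s / h n\<rfloor> < int (N n)" using sp by linarith
    also have "\<dots> \<longleftrightarrow> s / h n < real (N n)" by (simp add: floor_less_iff)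
    finally show "nat \<lfloor>s / h n\<rfloor> < N n \<longleftrightarrow> s < real (N n) * h n" using h(1)[OF that(1)] by (simp add: field_simps)
    have "s / h n < real (Suc (nat \<lfloor>s / h n\<rfloor>))" "real (Suc (nat \<lfloor>s / h n\<rfloor>)) \<le> s / h n + 1" using e by (simp_all, linarith)
    then show "s < real (Suc (nat \<lfloor>s / h n\<rfloor>)) * h n" "real (Suc (nat \<lfloor>s / h n\<rfloor>)) * h n \<le> s + h n"
      using h(1)[OF that(1)] by (simp_all add: field_simps)
  qed
  have bnd: "norm (F n s) \<le> B * indicator {0..t} s" if n: "n > 0" for n s
  proof (cases "0 \<le> s \<and> nat \<lfloor>s / h n\<rfloor> < N n")
    case True
    let ?i = "Suc (nat \<lfloor>s / h n\<rfloor>)"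
    have "real ?i * h n \<le> real n * h n" using True N[of n] h(1)[OF n] by (intro mult_right_mono) auto
    then have "real ?i * h n \<le> t" using h[OF n] by simp
    moreover have "s < real ?i * h n" using grid(2)[OF n] True by simp
    ultimately show ?thesis using B[of "real ?i * h n"] True F_eval[OF n] by auto
  next
    case False then show ?thesis using F_eval[OF n] B0 by auto
  qed
  have hlim: "h \<longlonglongrightarrow> 0" unfolding h_def by (rule lim_const_over_n)
  \<comment> \<open>At \<open>s = u\<close> it is undetermined whether the cell of \<open>s\<close>
    is still counted; a single point is negligible for the integral.\<close>
  have ptw: "(\<lambda>n. F n s) \<longlonglongrightarrow> indicator {0..u} s * g s" if "s \<noteq> u" for s
  proof -
    have "s < 0 \<or> u < s \<or> 0 \<le> s \<and> s < u" using that by linarith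
    then consider "s < 0" | "u < s" | "0 \<le> s" "s < u" by blast
    then show ?thesis
    proof cases
      case 1
      have "\<forall>\<^sub>F n in sequentially. F n s = 0"
        using eventually_gt_at_top[of 0] by eventually_elim (use 1 F_eval in auto)
      then show ?thesis using 1 by (simp add: tendsto_eventually)
    next
      case 2
      have "\<forall>\<^sub>F n in sequentially. F n s = 0"
        using eventually_gt_at_top[of 0] order_tendstoD(2)[OF u 2]
        by eventually_elim (use 2 u0 F_eval grid(1) in \<open>auto simp: h_def\<close>)
      then show ?thesis using 2 by (simp add: tendsto_eventually)
    next
      case 3
      define v where "v n = real (Suc (nat \<lfloor>s / h n\<rfloor>)) * h n" for n
      have ev: "\<forall>\<^sub>F n in sequentially. g (v n) = F n s"
        using eventually_gt_at_top[of 0] order_tendstoD(1)[OF u 3(2)]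
        by eventually_elim (use 3 F_eval grid(1) in \<open>auto simp: h_def v_def\<close>)
      have vs: "v \<longlonglongrightarrow> s"
      proof (rule tendsto_sandwich)
        show "\<forall>\<^sub>F n in sequentially. s \<le> v n"
          using eventually_gt_at_top[of 0] by eventually_elim (use grid 3 in \<open>auto simp: v_def less_imp_le\<close>)
        show "\<forall>\<^sub>F n in sequentially. v n \<le> s + h n"
          using eventually_gt_at_top[of 0] by eventually_elim (use grid 3 in \<open>auto simp: v_def\<close>)
        show "(\<lambda>n. s + h n) \<longlonglongrightarrow> s" using tendsto_add[OF tendsto_const hlim] by simp
      qed auto
      have "\<forall>\<^sub>F n in sequentially. s < v n"
        using eventually_gt_at_top[of 0] by eventually_elim (use grid 3 in \<open>auto simp: v_def\<close>)
      then have "filterlim v (at_right s) sequentially"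
        using vs unfolding filterlim_at by (auto elim: eventually_mono)
      from filterlim_compose[OF rc[OF 3(1)] this] have "(\<lambda>n. g (v n)) \<longlonglongrightarrow> g s" .
      then have "(\<lambda>n. F n s) \<longlonglongrightarrow> g s" using ev by (rule Lim_transform_eventually)
      then show ?thesis using 3 by simp
    qed
  qed
  have ut: "u \<le> t"
  proof (rule LIMSEQ_le_const2[OF u], intro exI[of _ 1] allI impI)
    fix n :: nat assume "1 \<le> n"
    then show "real (N n) * (t / real n) \<le> t"
      using mult_right_mono[of "real (N n)" "real n" "t / real n"] N[of n] \<open>0 < t\<close> by auto
  qed
  have "(\<lambda>n. LINT s|lborel. F (Suc n) s) \<longlonglongrightarrow> (LINT s|lborel. indicator {0..u} s * g (max 0 s))"
  proof (rule integral_dominated_convergence[where w="\<lambda>s. B * indicator {0..t} s"])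
    show "AE s in lborel. (\<lambda>n. F (Suc n) s) \<longlonglongrightarrow> indicator {0..u} s * g (max 0 s)"
      using AE_lborel_singleton[of u]
    proof eventually_elim
      case (elim s)
      from LIMSEQ_Suc[OF ptw[OF elim]] show ?case
        by (cases "0 \<le> s") (auto simp: max_def)
    qed
    show "AE s in lborel. norm (F (Suc n) s) \<le> B * indicator {0..t} s" for n
      using bnd[of "Suc n"] by auto
  qed (use F_meas in \<open>auto intro!: integrable_mult_right integrable_real_indicator simp: emeasure_lborel_Icc_eq\<close>)
  then have "(\<lambda>n. LINT s|lborel. F n s) \<longlonglongrightarrow> (LINT s|lborel. indicator {0..u} s * g (max 0 s))"
    by (rule LIMSEQ_imp_Suc)
  moreover have "(LINT s|lborel. indicator {0..u} s * g (max 0 s)) = (LINT s:{0..u}|lborel. g s)"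
    unfolding set_lebesgue_integral_def by (intro Bochner_Integration.integral_cong) (auto simp: indicator_def)
  moreover have "\<forall>\<^sub>F n in sequentially. (LINT s|lborel. F n s) = t / real n * (\<Sum>i<N n. g (real (Suc i) * (t / real n)))"
    using eventually_gt_at_top[of 0] by eventually_elim (use F_int in \<open>auto simp: h_def\<close>)
  ultimately show ?thesis using Lim_transform_eventually by fastforce
qed

section \<open>Exit times and the walk stopped along a grid\<close>

definition exit_time :: "real \<Rightarrow> real \<Rightarrow> (real \<Rightarrow> real) \<Rightarrow> real \<Rightarrow> real" where
  "exit_time l c f t = Inf (insert t {s. 0 \<le> s \<and> s \<le> t \<and> f s \<notin> {l..c}})"

lemma exit_time_le: "0 \<le> t \<Longrightarrow> exit_time l c f t \<le> t"
  unfolding exit_time_def by (intro cInf_lower bdd_belowI[of _ 0]) auto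

lemma exit_time_nonneg: "0 \<le> t \<Longrightarrow> 0 \<le> exit_time l c f t"
  unfolding exit_time_def by (intro cInf_greatest) auto

lemma exit_time_lower: "0 \<le> s \<Longrightarrow> s \<le> t \<Longrightarrow> f s \<notin> {l..c} \<Longrightarrow> exit_time l c f t \<le> s"
  unfolding exit_time_def by (intro cInf_lower bdd_belowI[of _ 0]) auto

lemma before_exit_time: "0 \<le> s \<Longrightarrow> s < exit_time l c f t \<Longrightarrow> 0 \<le> t \<Longrightarrow> f s \<in> {l..c}"
  using exit_time_lower[of s t f l c] exit_time_le[of t l c f] by (cases "f s \<in> {l..c}") auto

text \<open>The state is a pair of accumulated discount and position, and \<open>e\<close> lists the
  increments. The rate is read at the position before the move, so that the discount factor depends
  on the past only and leaves the expectation over the next increment.\<close>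

fun stopped_walk :: "real \<Rightarrow> real \<Rightarrow> real \<Rightarrow> (real \<Rightarrow> real) \<Rightarrow> real \<Rightarrow> nat \<Rightarrow> (nat \<Rightarrow> real) \<Rightarrow> real \<times> real" where
  "stopped_walk l c h k x 0 e = (1, x)"
| "stopped_walk l c h k x (Suc j) e =
     (case stopped_walk l c h k x j e of (D, y) \<Rightarrow> if y \<in> {l..c} then (D * exp (- h * k y), y + e j) else (D, y))"

definition exit_index :: "real \<Rightarrow> real \<Rightarrow> (nat \<Rightarrow> real) \<Rightarrow> nat \<Rightarrow> nat" where
  "exit_index l c y n = (if \<exists>i<n. y i \<notin> {l..c} then LEAST i. y i \<notin> {l..c} else n)"

lemma exit_index_le: "exit_index l c y n \<le> n"
proof (cases "\<exists>i<n. y i \<notin> {l..c}")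
  case True
  then obtain i where i: "i < n" "y i \<notin> {l..c}" by blast
  then have "(LEAST i. y i \<notin> {l..c}) \<le> i" by (intro Least_le)
  then show ?thesis using i True unfolding exit_index_def by simp
next
  case False
  then have "exit_index l c y n = n" unfolding exit_index_def by (rule if_not_P)
  then show ?thesis by simp
qed

lemma exit_index_least: "y i \<notin> {l..c} \<Longrightarrow> i < n \<Longrightarrow> exit_index l c y n \<le> i"
proof -
  assume i: "y i \<notin> {l..c}" "i < n"
  then have "exit_index l c y n = (LEAST i. y i \<notin> {l..c})" unfolding exit_index_def by (intro if_P) blast
  moreover have "(LEAST i. y i \<notin> {l..c}) \<le> i" by (rule Least_le) (rule i(1))
  ultimately show ?thesis by simp
qed

lemma exit_index_outside: "exit_index l c y n < n \<Longrightarrow> y (exit_index l c y n) \<notin> {l..c}"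
proof -
  assume lt: "exit_index l c y n < n"
  then have ex: "\<exists>i<n. y i \<notin> {l..c}" unfolding exit_index_def by (rule contrapos_pp) (simp only: if_not_P less_irrefl not_False_eq_True)
  then have e: "exit_index l c y n = (LEAST i. y i \<notin> {l..c})" unfolding exit_index_def by (rule if_P)
  from ex obtain i where "y i \<notin> {l..c}" by blast
  then show ?thesis unfolding e by (rule LeastI)
qed

lemma stopped_walk_eq:
  "stopped_walk l c h k (y 0) n (\<lambda>i. y (Suc i) - y i) =
     (exp (- h * (\<Sum>i<exit_index l c y n. k (y i))), y (exit_index l c y n))"
proof (induction n)
  case 0
  then show ?case by (simp add: exit_index_def)
next
  case (Suc n)
  consider "\<exists>i<n. y i \<notin> {l..c}" | "\<forall>i<n. y i \<in> {l..c}" "y n \<notin> {l..c}" | "\<forall>i<n. y i \<in> {l..c}" "y n \<in> {l..c}"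
    by blast
  then show ?case
  proof cases
    case 1
    then have "exit_index l c y n = (LEAST i. y i \<notin> {l..c})" "exit_index l c y (Suc n) = (LEAST i. y i \<notin> {l..c})"
      unfolding exit_index_def using less_SucI by auto
    moreover have "y (LEAST i. y i \<notin> {l..c}) \<notin> {l..c}" using 1 by (metis (mono_tags, lifting) LeastI)
    ultimately have e: "exit_index l c y (Suc n) = exit_index l c y n" "y (exit_index l c y n) \<notin> {l..c}" by auto
    then show ?thesis using Suc by auto
  next
    case 2
    \<comment> \<open>The same index arises in two ways: as the default value at horizon
      \<open>n\<close>, and as a genuine first exit at horizon \<open>Suc n\<close>.\<close>
    then have "exit_index l c y n = n" "exit_index l c y (Suc n) = n"
      unfolding exit_index_def by (auto simp del: atLeastAtMost_iff intro!: Least_equality) (meson not_less)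
    then show ?thesis using Suc 2 by auto
  next
    case 3
    then have "exit_index l c y n = n" "exit_index l c y (Suc n) = Suc n"
      unfolding exit_index_def by (auto simp del: atLeastAtMost_iff simp: less_Suc_eq)
    then show ?thesis using Suc 3 by (auto simp: exp_add[symmetric] algebra_simps)
  qed
qed

text \<open>The grid cannot notice an exit before the path makes one. Conversely the complement of
  the interval is open, so by right continuity an exit shortly after the exit time lasts for some
  duration \<open>d\<close>, and a mesh below \<open>d\<close> cannot miss it.\<close>

lemma grid_exit_tendsto:
  fixes l c t :: real
  assumes f: "cadlag_path f" and "0 < t"
  defines "u \<equiv> \<lambda>n. real (exit_index l c (\<lambda>i. f (real i * (t / real n))) n) * (t / real n)"
  shows "\<And>n. 0 < n \<Longrightarrow> exit_time l c f t \<le> u n" and "u \<longlonglongrightarrow> exit_time l c f t"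
proof -
  let ?T = "exit_time l c f t"
  have ut: "u n \<le> t" if "0 < n" for n
  proof -
    have "u n \<le> real n * (t / real n)" unfolding u_def
      using \<open>0 < t\<close> by (intro mult_right_mono) (auto simp: exit_index_le)
    then show ?thesis using that by simp
  qed
  show low: "?T \<le> u n" if n: "0 < n" for n
  proof (cases "exit_index l c (\<lambda>i. f (real i * (t / real n))) n < n")
    case True
    from exit_index_outside[OF this] show ?thesis
      using ut[OF n] \<open>0 < t\<close> unfolding u_def by (intro exit_time_lower) auto
  next
    case False
    then have "exit_index l c (\<lambda>i. f (real i * (t / real n))) n = n" using exit_index_le le_neq_implies_less by blast
    then show ?thesis using exit_time_le[of t l c f] \<open>0 < t\<close> n by (simp add: u_def)
  qed
  show "u \<longlonglongrightarrow> ?T"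
  proof (rule LIMSEQ_I)
    fix e :: real assume "0 < e"
    have "\<exists>N. \<forall>n\<ge>N. 0 < n \<longrightarrow> u n < ?T + e"
    proof (cases "t < ?T + e")
      case True then show ?thesis using ut le_less_trans by blast
    next
      case False
      then have "?T < t" using \<open>0 < e\<close> by simp
      then have "Inf (insert t {s. 0 \<le> s \<and> s \<le> t \<and> f s \<notin> {l..c}}) < min (?T + e) t"
        using \<open>0 < e\<close> unfolding exit_time_def by simp
      from cInf_lessD[OF _ this] obtain s
        where s: "s \<in> insert t {s. 0 \<le> s \<and> s \<le> t \<and> f s \<notin> {l..c}}" "s < min (?T + e) t" by blast
      then have s': "0 \<le> s" "f s \<in> - {l..c}" by auto
      have "\<forall>\<^sub>F v in at_right s. f v \<in> - {l..c}"
        using topological_tendstoD[OF cadlag_path_right[OF f s'(1)] _ s'(2)] by auto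
      then obtain b where b: "s < b" "\<And>v. s < v \<Longrightarrow> v < b \<Longrightarrow> f v \<in> - {l..c}"
        by (auto simp: eventually_at_right_field)
      define d where "d = min b (min (?T + e) t) - s"
      have d: "0 < d" using b(1) s(2) by (simp add: d_def)
      have out: "f v \<notin> {l..c}" if "s \<le> v" "v < s + d" for v
        using that b(2)[of v] s'(2) by (cases "v = s") (auto simp: d_def)
      obtain N where N: "t / d < real N" using reals_Archimedean2 by blast
      have "u n < ?T + e" if n: "N \<le> n" "0 < n" for n
      proof -
        define h where "h = t / real n"
        have "t / d < real n" using N n by linarith
        then have h: "0 < h" "h < d" "real n * h = t" using n \<open>0 < t\<close> d by (auto simp: h_def field_simps)
        \<comment> \<open>The first grid point at or after \<open>s\<close>; being within one mesh
          of \<open>s\<close>, it still lies in the stretch spent outside.\<close>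
        define i where "i = nat \<lceil>s / h\<rceil>"
        have "0 \<le> s / h" using s'(1) h by simp
        then have "s / h \<le> real i" "real i < s / h + 1" unfolding i_def by linarith+
        then have i: "s \<le> real i * h" "real i * h < s + h" using h(1) by (simp_all add: field_simps)
        have "real i * h < real n * h" using i(2) h s(2) by (simp add: d_def) 
        then have "i < n" using h(1) by simp
        then have "exit_index l c (\<lambda>i. f (real i * (t / real n))) n \<le> i"
          using out[of "real i * h"] i h(2) by (intro exit_index_least) (auto simp: h_def)
        then have "u n \<le> real i * h" unfolding u_def h_def using \<open>0 < t\<close> by (intro mult_right_mono) auto
        also have "\<dots> < ?T + e" using i(2) h(2) by (simp add: d_def)
        finally show ?thesis .
      qed
      then show ?thesis by blast
    qed
    then obtain N where N: "\<And>n. n \<ge> N \<Longrightarrow> 0 < n \<Longrightarrow> u n < ?T + e" by blast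
    have "norm (u n - ?T) < e" if "n \<ge> Suc N" for n
      using N[of n] low[of n] that by auto
    then show "\<exists>no. \<forall>n\<ge>no. norm (u n - ?T) < e" by blast
  qed
qed

(* Left and right Riemann sums differ by a telescoping term, so right continuity suffices and left
   limits never enter. *)
lemma stopped_walk_tendsto:
  fixes k :: "real \<Rightarrow> real" and l c t :: real
  assumes f: "cadlag_path f" and k: "continuous_on UNIV k" and "0 < t"
  defines "w \<equiv> \<lambda>n. stopped_walk l c (t / real n) k (f 0) n
      (\<lambda>i. f (real (Suc i) * (t / real n)) - f (real i * (t / real n)))"
  shows "(\<lambda>n. snd (w n)) \<longlonglongrightarrow> f (exit_time l c f t)"
    and "(\<lambda>n. fst (w n)) \<longlonglongrightarrow> exp (- (LINT s:{0..exit_time l c f t}|lborel. k (f s)))"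
proof -
  let ?T = "exit_time l c f t"
  define N where "N n = exit_index l c (\<lambda>i. f (real i * (t / real n))) n" for n
  have w: "w n = (exp (- (t / real n) * (\<Sum>i<N n. k (f (real i * (t / real n))))), f (real (N n) * (t / real n)))" for n
    using stopped_walk_eq[of l c "t / real n" k "\<lambda>i. f (real i * (t / real n))" n] by (simp add: w_def N_def)
  have T0: "0 \<le> ?T" using \<open>0 < t\<close> by (simp add: exit_time_nonneg)
  note uT = grid_exit_tendsto[OF f \<open>0 < t\<close>, where l=l and c=c, folded N_def]
  have ut: "real (N n) * (t / real n) \<in> {0..t}" if "0 < n" for n
  proof -
    have "real (N n) * (t / real n) \<le> real n * (t / real n)"
      using \<open>0 < t\<close> by (intro mult_right_mono) (auto simp: exit_index_le N_def)
    then show ?thesis using that \<open>0 < t\<close> by simp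
  qed
  have "continuous (at ?T within {?T..}) f"
    unfolding continuous_within by (simp add: at_within_Ici_at_right cadlag_path_right[OF f T0])
  moreover have "\<forall>n. real (N (Suc n)) * (t / real (Suc n)) \<in> {?T..}" using uT(1)[of "Suc _"] by simp
  ultimately have "(\<lambda>n. f (real (N (Suc n)) * (t / real (Suc n)))) \<longlonglongrightarrow> f ?T"
    using LIMSEQ_Suc[OF uT(2)] unfolding continuous_within_sequentially comp_def
    by (elim allE[of _ "\<lambda>n. real (N (Suc n)) * (t / real (Suc n))"]) simp
  then have "(\<lambda>n. f (real (N n) * (t / real n))) \<longlonglongrightarrow> f ?T" by (rule LIMSEQ_imp_Suc)
  then show "(\<lambda>n. snd (w n)) \<longlonglongrightarrow> f ?T" by (simp add: w)
  obtain B0 where B0: "\<And>s. s \<in> {0..t} \<Longrightarrow> \<bar>f s\<bar> \<le> B0" using cadlag_path_bounded[OF f] by metis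
  have "bounded (k ` {-B0..B0})"
    by (intro compact_imp_bounded compact_continuous_image continuous_on_subset[OF k]) auto
  then obtain B where "\<forall>x\<in>k ` {-B0..B0}. norm x \<le> B" unfolding bounded_iff by blast
  then have B: "\<bar>k (f s)\<bar> \<le> B" if "s \<in> {0..t}" for s using B0[OF that] by (auto simp: abs_le_iff)
  have "(\<lambda>n. t / real n * (\<Sum>i<N n. k (f (real (Suc i) * (t / real n))))) \<longlonglongrightarrow> (LINT s:{0..?T}|lborel. k (f s))"
  proof (rule right_Riemann_sum_tendsto[where g="\<lambda>s. k (f s)" and t=t and B=B])
    show "((\<lambda>s. k (f s)) \<longlongrightarrow> k (f s)) (at_right s)" if "0 \<le> s" for s
      using k by (intro continuous_on_tendsto_compose[OF k cadlag_path_right[OF f that]]) auto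
    show "(\<lambda>s. k (f (max 0 s))) \<in> borel_measurable borel"
      using cadlag_path_borel_measurable[OF f] borel_measurable_continuous_onI[OF k] by measurable
  qed (use uT(2) B \<open>0 < t\<close> in \<open>auto simp: N_def exit_index_le\<close>)
  moreover have "(\<lambda>n. t / real n * (k (f 0) - k (f (real (N n) * (t / real n))))) \<longlonglongrightarrow> 0"
  proof (rule Lim_null_comparison)
    show "(\<lambda>n. t / real n * (2 * B)) \<longlonglongrightarrow> 0"
      using tendsto_mult_left_zero[OF lim_const_over_n[of t]] by simp
    show "\<forall>\<^sub>F n in sequentially. norm (t / real n * (k (f 0) - k (f (real (N n) * (t / real n))))) \<le> t / real n * (2 * B)"
      using eventually_gt_at_top[of 0]
    proof eventually_elim
      case (elim n)
      have "\<bar>k (f 0) - k (f (real (N n) * (t / real n)))\<bar> \<le> 2 * B"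
        using B[of 0] B[OF ut[OF elim]] \<open>0 < t\<close> by auto
      then show ?case using \<open>0 < t\<close> by (auto simp: abs_mult intro!: mult_left_mono divide_right_mono)
    qed
  qed
  ultimately have "(\<lambda>n. t / real n * (\<Sum>i<N n. k (f (real (Suc i) * (t / real n)))) + t / real n * (k (f 0) - k (f (real (N n) * (t / real n)))))
      \<longlonglongrightarrow> (LINT s:{0..?T}|lborel. k (f s)) + 0"
    by (rule tendsto_add)
  moreover have "t / real n * (\<Sum>i<N n. k (f (real (Suc i) * (t / real n)))) + t / real n * (k (f 0) - k (f (real (N n) * (t / real n))))
     = t / real n * (\<Sum>i<N n. k (f (real i * (t / real n))))" for n
    using sum_lessThan_telescope[of "\<lambda>i. k (f (real i * (t / real n)))" "N n"]
    by (simp only: sum_subtractf distrib_left[symmetric]) (simp add: algebra_simps)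
  ultimately have "(\<lambda>n. t / real n * (\<Sum>i<N n. k (f (real i * (t / real n))))) \<longlonglongrightarrow> (LINT s:{0..?T}|lborel. k (f s))"
    by simp
  from tendsto_exp[OF tendsto_minus[OF this]] show "(\<lambda>n. fst (w n)) \<longlonglongrightarrow> exp (- (LINT s:{0..?T}|lborel. k (f s)))"
    by (simp add: w)
qed

section \<open>Optional stopping on grids\<close>

text \<open>Bounded second moments give uniform integrability: truncation at level \<open>R\<close>
  changes an expectation by at most \<open>K / R\<close>, and the truncated variables converge by
  domination. The second moment of the limit is controlled by Fatou's lemma.\<close>

lemma (in prob_space) expectation_tendsto_L2_bounded:
  fixes Z :: "'a \<Rightarrow> real" and Zn :: "nat \<Rightarrow> 'a \<Rightarrow> real"
  assumes meas[measurable]: "\<And>n. Zn n \<in> borel_measurable M"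
    and lim: "\<And>z. z \<in> space M \<Longrightarrow> (\<lambda>n. Zn n z) \<longlonglongrightarrow> Z z"
    and K: "\<And>n. (\<integral>\<^sup>+z. ennreal ((Zn n z)\<^sup>2) \<partial>M) \<le> ennreal K" and "0 \<le> K"
  shows "integrable M Z" and "(\<lambda>n. expectation (Zn n)) \<longlonglongrightarrow> expectation Z"
proof -
  have Zm[measurable]: "Z \<in> borel_measurable M"
    by (rule borel_measurable_LIMSEQ_real[OF lim meas])
  have "(\<integral>\<^sup>+z. ennreal ((Z z)\<^sup>2) \<partial>M) = (\<integral>\<^sup>+z. liminf (\<lambda>n. ennreal ((Zn n z)\<^sup>2)) \<partial>M)"
    by (intro nn_integral_cong lim_imp_Liminf[symmetric] tendsto_ennrealI tendsto_power lim) auto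
  also have "\<dots> \<le> liminf (\<lambda>n. \<integral>\<^sup>+z. ennreal ((Zn n z)\<^sup>2) \<partial>M)"
    by (rule nn_integral_liminf) measurable
  also have "\<dots> \<le> ennreal K"
    using K by (intro Liminf_le) (auto intro: always_eventually)
  finally have KZ: "(\<integral>\<^sup>+z. ennreal ((Z z)\<^sup>2) \<partial>M) \<le> ennreal K" .
  have sq: "integrable M (\<lambda>z. (Y z)\<^sup>2)" "expectation (\<lambda>z. (Y z)\<^sup>2) \<le> K" "integrable M Y"
    if [measurable]: "Y \<in> borel_measurable M" and le: "(\<integral>\<^sup>+z. ennreal ((Y z)\<^sup>2) \<partial>M) \<le> ennreal K" for Y :: "'a \<Rightarrow> real"
  proof -
    show i: "integrable M (\<lambda>z. (Y z)\<^sup>2)"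
      using le by (intro integrableI_bounded) (auto simp: less_top[symmetric] top_unique)
    then have "ennreal (expectation (\<lambda>z. (Y z)\<^sup>2)) \<le> ennreal K"
      using le by (subst nn_integral_eq_integral[symmetric]) auto
    then show "expectation (\<lambda>z. (Y z)\<^sup>2) \<le> K" using \<open>0 \<le> K\<close> by (simp add: ennreal_le_iff)
    show "integrable M Y"
      by (rule square_integrable_imp_integrable[OF that(1) i])
  qed
  show "integrable M Z" by (rule sq(3)[OF Zm KZ])
  define T where "T R y = max (- R) (min R y)" for R y :: real
  have Tm[measurable]: "T R \<in> borel_measurable borel" for R unfolding T_def by measurable
  have Tb: "\<bar>T R y\<bar> \<le> R" if "0 < R" for R y using that by (auto simp: T_def)
  have Terr: "\<bar>y - T R y\<bar> \<le> y\<^sup>2 / R" if "0 < R" for R y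
  proof (cases "\<bar>y\<bar> \<le> R")
    case True then show ?thesis using that by (auto simp: T_def max_def min_def)
  next
    case False
    have "\<bar>y - T R y\<bar> \<le> \<bar>y\<bar>" using False that by (auto simp: T_def max_def min_def abs_if)
    also have "\<bar>y\<bar> * R \<le> \<bar>y\<bar> * \<bar>y\<bar>" using False by (intro mult_left_mono) auto
    then have "\<bar>y\<bar> \<le> \<bar>y\<bar> * \<bar>y\<bar> / R" using that by (simp only: pos_le_divide_eq)
    finally show ?thesis by (simp add: power2_eq_square)
  qed
  have ET: "\<bar>expectation Y - expectation (\<lambda>z. T R (Y z))\<bar> \<le> K / R"
    if R: "0 < R" and [measurable]: "Y \<in> borel_measurable M" and le: "(\<integral>\<^sup>+z. ennreal ((Y z)\<^sup>2) \<partial>M) \<le> ennreal K"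
    for Y :: "'a \<Rightarrow> real" and R
  proof -
    have iT: "integrable M (\<lambda>z. T R (Y z))"
      by (rule integrable_const_bound[of _ R]) (use Tb[OF R] in auto)
    have "\<bar>expectation Y - expectation (\<lambda>z. T R (Y z))\<bar> = \<bar>expectation (\<lambda>z. Y z - T R (Y z))\<bar>"
      using sq(3)[OF that(2) le] iT by simp
    also have "\<dots> \<le> expectation (\<lambda>z. \<bar>Y z - T R (Y z)\<bar>)"
      by (rule integral_abs_bound)
    also have "\<dots> \<le> expectation (\<lambda>z. (Y z)\<^sup>2 / R)"
      using sq[OF that(2) le] iT Terr[OF R] by (intro integral_mono) auto
    also have "\<dots> \<le> K / R" using sq(2)[OF that(2) le] R by (simp add: divide_right_mono)
    finally show ?thesis .
  qed
  show "(\<lambda>n. expectation (Zn n)) \<longlonglongrightarrow> expectation Z"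
  proof (rule LIMSEQ_I)
    fix e :: real assume e: "0 < e"
    \<comment> \<open>The two truncation errors and the difference of the truncated expectations
      take at most a quarter of \<open>e\<close> each; \<open>K + 1\<close> keeps \<open>R\<close>
      positive when \<open>K\<close> is 0.\<close>
    define R where "R = 4 * (K + 1) / e"
    have R: "0 < R" "K / R \<le> e / 4"
      using e \<open>0 \<le> K\<close> by (auto simp: R_def field_simps)
    have "(\<lambda>n. expectation (\<lambda>z. T R (Zn n z))) \<longlonglongrightarrow> expectation (\<lambda>z. T R (Z z))"
    proof (rule integral_dominated_convergence[where w="\<lambda>_. R"])
      show "AE z in M. (\<lambda>n. T R (Zn n z)) \<longlonglongrightarrow> T R (Z z)"
        unfolding T_def by (intro AE_I2 tendsto_intros lim) auto
    qed (use Tb[OF R(1)] in auto)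
    from LIMSEQ_D[OF this, of "e / 4"] e obtain N where
      N: "\<And>n. n \<ge> N \<Longrightarrow> \<bar>expectation (\<lambda>z. T R (Zn n z)) - expectation (\<lambda>z. T R (Z z))\<bar> < e / 4" by auto
    have "norm (expectation (Zn n) - expectation Z) < e" if "n \<ge> N" for n
      using N[OF that] ET[OF R(1) meas K, of n] ET[OF R(1) Zm KZ] R(2) e unfolding real_norm_def abs_less_iff abs_le_iff by linarith
    then show "\<exists>no. \<forall>n\<ge>no. norm (expectation (Zn n) - expectation Z) < e" by blast
  qed
qed

text \<open>Fubini for the product law. The integral over a second sample point plays the part of
  the conditional expectation given \<open>A\<close>, so that no sigma-algebra of the past has to be
  introduced.\<close>

lemma (in prob_space) indep_var_nn_integral:
  fixes F :: "'b \<Rightarrow> 'b \<Rightarrow> ennreal"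
  assumes ind: "indep_var N A L B" and F[measurable]: "(\<lambda>(a, b). F a b) \<in> borel_measurable (N \<Otimes>\<^sub>M L)"
  shows "(\<integral>\<^sup>+z. F (A z) (B z) \<partial>M) = (\<integral>\<^sup>+z. (\<integral>\<^sup>+z'. F (A z) (B z') \<partial>M) \<partial>M)"
proof -
  have rv[measurable]: "A \<in> measurable M N" "B \<in> measurable M L"
    and eq: "distr M N A \<Otimes>\<^sub>M distr M L B = distr M (N \<Otimes>\<^sub>M L) (\<lambda>z. (A z, B z))"
    using ind unfolding indep_var_distribution_eq by auto
  interpret B: prob_space "distr M L B" by (rule prob_space_distr) measurable
  have "(\<integral>\<^sup>+z. F (A z) (B z) \<partial>M) = (\<integral>\<^sup>+p. (case p of (a, b) \<Rightarrow> F a b) \<partial>distr M (N \<Otimes>\<^sub>M L) (\<lambda>z. (A z, B z)))"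
    by (subst nn_integral_distr) auto
  also have "\<dots> = (\<integral>\<^sup>+a. (\<integral>\<^sup>+b. F a b \<partial>distr M L B) \<partial>distr M N A)"
    unfolding eq[symmetric] by (subst B.nn_integral_fst[symmetric]) auto
  also have "\<dots> = (\<integral>\<^sup>+z. (\<integral>\<^sup>+z'. F (A z) (B z') \<partial>M) \<partial>M)"
    using measurable_space[OF rv(1)] by (simp add: nn_integral_distr cong: nn_integral_cong)
  finally show ?thesis .
qed

lemma (in prob_space) indep_var_expectation:
  fixes F :: "'b \<Rightarrow> 'b \<Rightarrow> real"
  assumes ind: "indep_var N A L B" and F[measurable]: "(\<lambda>(a, b). F a b) \<in> borel_measurable (N \<Otimes>\<^sub>M L)"
    and int: "integrable M (\<lambda>z. F (A z) (B z))"
  shows "expectation (\<lambda>z. F (A z) (B z)) = expectation (\<lambda>z. expectation (\<lambda>z'. F (A z) (B z')))"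
    and "integrable M (\<lambda>z. expectation (\<lambda>z'. F (A z) (B z')))"
proof -
  have rv[measurable]: "A \<in> measurable M N" "B \<in> measurable M L"
    and eq: "distr M N A \<Otimes>\<^sub>M distr M L B = distr M (N \<Otimes>\<^sub>M L) (\<lambda>z. (A z, B z))"
    using ind unfolding indep_var_distribution_eq by auto
  interpret A: prob_space "distr M N A" by (rule prob_space_distr) measurable
  interpret B: prob_space "distr M L B" by (rule prob_space_distr) measurable
  interpret AB: pair_prob_space "distr M N A" "distr M L B" ..
  have i: "integrable (distr M N A \<Otimes>\<^sub>M distr M L B) (\<lambda>(a, b). F a b)"
    unfolding eq using int by (subst integrable_distr_eq) auto
  have inner: "(\<integral>b. F a b \<partial>distr M L B) = expectation (\<lambda>z'. F a (B z'))" if "a \<in> space N" for a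
    using that by (intro integral_distr) auto
  have sp: "A z \<in> space N" if "z \<in> space M" for z using that by (rule measurable_space[OF rv(1)])
  have Im: "(\<lambda>a. \<integral>b. F a b \<partial>distr M L B) \<in> borel_measurable N"
    by (rule B.borel_measurable_lebesgue_integral) simp
  have "expectation (\<lambda>z. F (A z) (B z)) = (\<integral>p. (case p of (a, b) \<Rightarrow> F a b) \<partial>distr M (N \<Otimes>\<^sub>M L) (\<lambda>z. (A z, B z)))"
    by (subst integral_distr) auto
  also have "\<dots> = (\<integral>a. (\<integral>b. F a b \<partial>distr M L B) \<partial>distr M N A)"
    unfolding eq[symmetric] using AB.integral_fst'[OF i] by simp
  also have "\<dots> = expectation (\<lambda>z. \<integral>b. F (A z) b \<partial>distr M L B)"
    by (rule integral_distr[OF rv(1) Im])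
  also have "\<dots> = expectation (\<lambda>z. expectation (\<lambda>z'. F (A z) (B z')))"
    by (intro Bochner_Integration.integral_cong refl inner sp)
  finally show "expectation (\<lambda>z. F (A z) (B z)) = expectation (\<lambda>z. expectation (\<lambda>z'. F (A z) (B z')))" .
  have "integrable (distr M N A) (\<lambda>a. \<integral>b. F a b \<partial>distr M L B)" using AB.integrable_fst'[OF i] by simp
  then have "integrable M (\<lambda>z. \<integral>b. F (A z) b \<partial>distr M L B)"
    using Im by (subst (asm) integrable_distr_eq) auto
  then show "integrable M (\<lambda>z. expectation (\<lambda>z'. F (A z) (B z')))"
    by (rule Bochner_Integration.integrable_cong[THEN iffD1, rotated -1]) (use inner sp in auto)
qed

text \<open>This adaptedness is what makes the state independent of the next increment; it also lets
  a tuple restricted to the first \<open>j\<close> indices replace the whole sequence.\<close>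

lemma stopped_walk_cong:
  "(\<And>i. i < j \<Longrightarrow> e i = e' i) \<Longrightarrow> stopped_walk l c h k x j e = stopped_walk l c h k x j e'"
  by (induction j) (auto split: prod.splits)

lemma stopped_walk_measurable:
  assumes [measurable]: "k \<in> borel_measurable borel" and "j \<le> n"
  shows "stopped_walk l c h k x j \<in> measurable (PiM {..<n} (\<lambda>_. borel)) (borel \<Otimes>\<^sub>M borel)"
  using \<open>j \<le> n\<close>
proof (induction j)
  case 0
  have "stopped_walk l c h k x 0 = (\<lambda>e. (1, x))" by (simp add: fun_eq_iff)
  then show ?case by simp
next
  case (Suc j)
  then have [measurable]: "stopped_walk l c h k x j \<in> measurable (PiM {..<n} (\<lambda>_. borel)) (borel \<Otimes>\<^sub>M borel)"
    by simp
  have [measurable]: "(\<lambda>e. e j) \<in> borel_measurable (PiM {..<n} (\<lambda>_. borel :: real measure))"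
    using Suc.prems by (intro measurable_component_singleton) auto
  have "stopped_walk l c h k x (Suc j) = (\<lambda>e. if snd (stopped_walk l c h k x j e) \<in> {l..c}
      then (fst (stopped_walk l c h k x j e) * exp (- h * k (snd (stopped_walk l c h k x j e))), snd (stopped_walk l c h k x j e) + e j)
      else stopped_walk l c h k x j e)"
    by (auto simp: fun_eq_iff split: prod.split)
  then show ?case by simp
qed

text \<open>Grid times are kept in the form \<open>real (Suc j) * h\<close>, which the independence
  statements and the recursion share.\<close>

declare of_nat_Suc [simp del]

lemma stopped_walk_weight:
  assumes k: "\<And>y. - \<kappa> \<le> k y" and "0 \<le> h" "0 \<le> \<kappa>"
  shows "0 \<le> fst (stopped_walk l c h k x j e) \<and> fst (stopped_walk l c h k x j e) \<le> exp (\<kappa> * (real j * h))"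
proof (induction j)
  case (Suc j)
  obtain D y where Dy: "stopped_walk l c h k x j e = (D, y)" by force
  have kk: "- h * k y \<le> \<kappa> * h" using mult_left_mono[OF k[of y] \<open>0 \<le> h\<close>] by (simp add: mult.commute)
  have D: "0 \<le> D" "D \<le> exp (\<kappa> * (real j * h))" using Suc Dy by auto
  have "D * exp (- h * k y) \<le> exp (\<kappa> * (real j * h)) * exp (\<kappa> * h)"
    using D kk by (intro mult_mono) auto
  also have "\<dots> = exp (\<kappa> * (real (Suc j) * h))" by (simp add: exp_add[symmetric] algebra_simps of_nat_Suc)
  finally have 1: "D * exp (- h * k y) \<le> exp (\<kappa> * (real (Suc j) * h))" .
  have "exp (\<kappa> * (real j * h)) \<le> exp (\<kappa> * (real (Suc j) * h))"
    using assms(2,3) by (auto intro!: mult_left_mono mult_right_mono simp: of_nat_Suc)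
  then have 2: "D \<le> exp (\<kappa> * (real (Suc j) * h))" by (rule order_trans[OF D(2)])
  show ?case using 1 2 D by (simp add: Dy)
qed simp

lemma laplace_exponent_nn_integral:
  assumes "laplace_exponent M X \<psi>" "0 \<le> \<theta>" "0 \<le> t"
  shows "(\<integral>\<^sup>+z. ennreal (exp (\<theta> * X t z)) \<partial>M) = ennreal (exp (t * \<psi> \<theta>))"
    and "integrable M (\<lambda>z. exp (\<theta> * X t z))"
proof -
  have e: "(LINT z|M. exp (\<theta> * X t z)) = exp (t * \<psi> \<theta>)" using assms by (auto simp: laplace_exponent_def)
  show i: "integrable M (\<lambda>z. exp (\<theta> * X t z))"
    by (rule ccontr) (use e not_integrable_integral_eq in fastforce)
  show "(\<integral>\<^sup>+z. ennreal (exp (\<theta> * X t z)) \<partial>M) = ennreal (exp (t * \<psi> \<theta>))"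
    using nn_integral_eq_integral[OF i] e by simp
qed

section \<open>One-step estimates along the grid\<close>

context levy_process
begin

text \<open>The transition operator of the process over a time \<open>h\<close>. It is written with
  the increment because \<open>X 0\<close> vanishes only almost surely, and increments are what
  stationarity speaks of.\<close>

definition transition :: "real \<Rightarrow> (real \<Rightarrow> real) \<Rightarrow> real \<Rightarrow> real" where
  "transition h U y = (LINT z|M. U (y + (X h z - X 0 z)))"

definition grid_state :: "real \<Rightarrow> real \<Rightarrow> real \<Rightarrow> (real \<Rightarrow> real) \<Rightarrow> real \<Rightarrow> nat \<Rightarrow> 'a \<Rightarrow> real \<times> real" where
  "grid_state l c h k x j z = stopped_walk l c h k x j (\<lambda>i. X (real (Suc i) * h) z - X (real i * h) z)"

lemma X_measurable[measurable]: "0 \<le> t \<Longrightarrow> X t \<in> borel_measurable M"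
  by (rule measurable_X)

lemma increment_distr:
  assumes "0 \<le> s" "0 \<le> h"
  shows "distr M borel (\<lambda>z. X (s + h) z - X s z) = distr M borel (\<lambda>z. X h z - X 0 z)"
  using assms by (rule stationary_increments)

lemma increment_nn_integral:
  assumes "0 \<le> s" "0 \<le> h" and [measurable]: "f \<in> borel_measurable borel"
  shows "(\<integral>\<^sup>+z. f (X (s + h) z - X s z) \<partial>M) = (\<integral>\<^sup>+z. f (X h z - X 0 z) \<partial>M)"
proof -
  have "(\<integral>\<^sup>+z. f (X (s + h) z - X s z) \<partial>M) = (\<integral>\<^sup>+r. f r \<partial>distr M borel (\<lambda>z. X (s + h) z - X s z))"
    using assms by (subst nn_integral_distr) auto
  also have "\<dots> = (\<integral>\<^sup>+z. f (X h z - X 0 z) \<partial>M)"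
    unfolding increment_distr[OF assms(1,2)] using assms by (subst nn_integral_distr) auto
  finally show ?thesis .
qed

lemma increment_expectation:
  fixes f :: "real \<Rightarrow> real"
  assumes "0 \<le> s" "0 \<le> h" and [measurable]: "f \<in> borel_measurable borel"
  shows "expectation (\<lambda>z. f (X (s + h) z - X s z)) = expectation (\<lambda>z. f (X h z - X 0 z))"
proof -
  have "expectation (\<lambda>z. f (X (s + h) z - X s z)) = (\<integral>r. f r \<partial>distr M borel (\<lambda>z. X (s + h) z - X s z))"
    using assms by (subst integral_distr) auto
  also have "\<dots> = expectation (\<lambda>z. f (X h z - X 0 z))"
    unfolding increment_distr[OF assms(1,2)] using assms by (subst integral_distr) auto
  finally show ?thesis .
qed

lemma AE_X0: "AE z in M. X 0 z = 0"
  by (rule start)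

lemma increment_exp_moment:
  assumes lap: "laplace_exponent M X \<psi>" and "0 \<le> \<theta>" "0 \<le> h"
  shows "(\<integral>\<^sup>+z. ennreal (exp (\<theta> * (X h z - X 0 z))) \<partial>M) = ennreal (exp (h * \<psi> \<theta>))"
proof -
  have "(\<integral>\<^sup>+z. ennreal (exp (\<theta> * (X h z - X 0 z))) \<partial>M) = (\<integral>\<^sup>+z. ennreal (exp (\<theta> * X h z)) \<partial>M)"
    using AE_X0 by (intro nn_integral_cong_AE) (auto elim: eventually_mono)
  then show ?thesis using laplace_exponent_nn_integral[OF assms] by simp
qed

lemma grid_state_measurable:
  assumes [measurable]: "k \<in> borel_measurable borel" and "0 \<le> h"
  shows "grid_state l c h k x j \<in> measurable M (borel \<Otimes>\<^sub>M borel)"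
proof -
  have [measurable]: "X (real i * h) \<in> borel_measurable M" for i using \<open>0 \<le> h\<close> by simp
  have "(\<lambda>z. restrict (\<lambda>i. X (real (Suc i) * h) z - X (real i * h) z) {..<j}) \<in> measurable M (PiM {..<j} (\<lambda>_. borel))"
    by (rule measurable_restrict) measurable
  from measurable_compose[OF this stopped_walk_measurable[OF assms(1) order_refl]]
  have "(\<lambda>z. stopped_walk l c h k x j (restrict (\<lambda>i. X (real (Suc i) * h) z - X (real i * h) z) {..<j})) \<in> measurable M (borel \<Otimes>\<^sub>M borel)" .
  moreover have "stopped_walk l c h k x j (restrict (\<lambda>i. X (real (Suc i) * h) z - X (real i * h) z) {..<j}) = grid_state l c h k x j z" for z
    unfolding grid_state_def by (rule stopped_walk_cong) simp
  ultimately show ?thesis by simp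
qed

lemma grid_increments_indep:
  assumes "0 \<le> h"
  shows "indep_var (PiM {..<j} (\<lambda>_. borel)) (\<lambda>z. restrict (\<lambda>i. X (real (Suc i) * h) z - X (real i * h) z) {..<j})
    (PiM {j} (\<lambda>_. borel)) (\<lambda>z. restrict (\<lambda>i. X (real (Suc i) * h) z - X (real i * h) z) {j})"
proof -
  have "indep_vars (\<lambda>_. borel) (\<lambda>i z. X (real (Suc i) * h) z - X (real i * h) z) {..<Suc j}"
    using \<open>0 \<le> h\<close> by (intro independent_increments[where s="\<lambda>i. real i * h"]) (auto intro!: mult_right_mono)
  then show ?thesis by (rule indep_var_restrict) auto
qed

lemma stopped_walk_restrict:
  "stopped_walk l c h k x j (restrict (\<lambda>i. X (real (Suc i) * h) z - X (real i * h) z) {..<j}) = grid_state l c h k x j z"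
  unfolding grid_state_def by (rule stopped_walk_cong) simp

lemma grid_step_nn_integral:
  assumes k[measurable]: "k \<in> borel_measurable borel" and "0 \<le> h"
    and F[measurable]: "(\<lambda>(s, r). F s r) \<in> borel_measurable ((borel \<Otimes>\<^sub>M borel) \<Otimes>\<^sub>M borel)"
  shows "(\<integral>\<^sup>+z. F (grid_state l c h k x j z) (X (real (Suc j) * h) z - X (real j * h) z) \<partial>M) =
    (\<integral>\<^sup>+z. (\<integral>\<^sup>+z'. F (grid_state l c h k x j z) (X (real (Suc j) * h) z' - X (real j * h) z') \<partial>M) \<partial>M)"
proof -
  have [measurable]: "stopped_walk l c h k x j \<in> measurable (PiM {..<j} (\<lambda>_. borel)) (borel \<Otimes>\<^sub>M borel)"
    by (rule stopped_walk_measurable[OF k order_refl])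
  have [measurable]: "(\<lambda>b. b j) \<in> borel_measurable (PiM {j} (\<lambda>_. borel :: real measure))"
    by (rule measurable_component_singleton) simp
  have "(\<lambda>(a, b). F (stopped_walk l c h k x j a) (b j)) \<in> borel_measurable (PiM {..<j} (\<lambda>_. borel) \<Otimes>\<^sub>M PiM {j} (\<lambda>_. borel))"
    by measurable
  from indep_var_nn_integral[OF grid_increments_indep[OF \<open>0 \<le> h\<close>] this]
  show ?thesis by (simp add: stopped_walk_restrict)
qed

lemma grid_step_expectation:
  fixes F :: "real \<times> real \<Rightarrow> real \<Rightarrow> real"
  assumes k[measurable]: "k \<in> borel_measurable borel" and "0 \<le> h"
    and F[measurable]: "(\<lambda>(s, r). F s r) \<in> borel_measurable ((borel \<Otimes>\<^sub>M borel) \<Otimes>\<^sub>M borel)"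
    and int: "integrable M (\<lambda>z. F (grid_state l c h k x j z) (X (real (Suc j) * h) z - X (real j * h) z))"
  shows "expectation (\<lambda>z. F (grid_state l c h k x j z) (X (real (Suc j) * h) z - X (real j * h) z)) =
    expectation (\<lambda>z. expectation (\<lambda>z'. F (grid_state l c h k x j z) (X (real (Suc j) * h) z' - X (real j * h) z')))"
    and "integrable M (\<lambda>z. expectation (\<lambda>z'. F (grid_state l c h k x j z) (X (real (Suc j) * h) z' - X (real j * h) z')))"
proof -
  have [measurable]: "stopped_walk l c h k x j \<in> measurable (PiM {..<j} (\<lambda>_. borel)) (borel \<Otimes>\<^sub>M borel)"
    by (rule stopped_walk_measurable[OF k order_refl])
  have [measurable]: "(\<lambda>b. b j) \<in> borel_measurable (PiM {j} (\<lambda>_. borel :: real measure))"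
    by (rule measurable_component_singleton) simp
  have "(\<lambda>(a, b). F (stopped_walk l c h k x j a) (b j)) \<in> borel_measurable (PiM {..<j} (\<lambda>_. borel) \<Otimes>\<^sub>M PiM {j} (\<lambda>_. borel))"
    by measurable
  note * = indep_var_expectation[OF grid_increments_indep[OF \<open>0 \<le> h\<close>] this]
  show "expectation (\<lambda>z. F (grid_state l c h k x j z) (X (real (Suc j) * h) z - X (real j * h) z)) =
    expectation (\<lambda>z. expectation (\<lambda>z'. F (grid_state l c h k x j z) (X (real (Suc j) * h) z' - X (real j * h) z')))"
    "integrable M (\<lambda>z. expectation (\<lambda>z'. F (grid_state l c h k x j z) (X (real (Suc j) * h) z' - X (real j * h) z')))"
    using * int by (simp_all add: stopped_walk_restrict)
qed

lemma grid_state_Suc: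
  "grid_state l c h k x (Suc j) z = (let s = grid_state l c h k x j z in
     if snd s \<in> {l..c} then (fst s * exp (- h * k (snd s)), snd s + (X (real (Suc j) * h) z - X (real j * h) z)) else s)"
  by (simp add: grid_state_def Let_def split: prod.split)

text \<open>A running step multiplies the moment by \<open>exp (h * \<psi> \<theta>)\<close> and a
  frozen one by 1; the absolute value of \<open>\<psi> \<theta>\<close> covers both, whatever its
  sign.\<close>

lemma grid_state_exp_moment:
  assumes lap: "laplace_exponent M X \<psi>" and "0 \<le> \<theta>" "0 \<le> h" and [measurable]: "k \<in> borel_measurable borel"
  shows "(\<integral>\<^sup>+z. ennreal (exp (\<theta> * snd (grid_state l c h k x j z))) \<partial>M) \<le> ennreal (exp (\<theta> * x + real j * h * \<bar>\<psi> \<theta>\<bar>))"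
proof (induction j)
  case 0
  show ?case by (simp add: grid_state_def emeasure_space_1)
next
  case (Suc j)
  let ?S = "grid_state l c h k x j" and ?e = "\<lambda>z. X (real (Suc j) * h) z - X (real j * h) z"
  define F where "F s r = ennreal (exp (\<theta> * (if snd s \<in> {l..c} then snd s + r else snd s)))" for s :: "real \<times> real" and r
  have [measurable]: "?S \<in> measurable M (borel \<Otimes>\<^sub>M borel)" by (rule grid_state_measurable) fact+
  have inner: "(\<integral>\<^sup>+z'. F s (?e z') \<partial>M) \<le> ennreal (exp (\<theta> * snd s)) * ennreal (exp (h * \<bar>\<psi> \<theta>\<bar>))" for s
  proof (cases "snd s \<in> {l..c}")
    case True
    have "(\<integral>\<^sup>+z'. F s (?e z') \<partial>M) = (\<integral>\<^sup>+z'. ennreal (exp (\<theta> * (snd s + (X (real j * h + h) z' - X (real j * h) z')))) \<partial>M)"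
      using True by (simp add: F_def algebra_simps of_nat_Suc)
    also have "\<dots> = (\<integral>\<^sup>+z'. ennreal (exp (\<theta> * (snd s + (X h z' - X 0 z')))) \<partial>M)"
      using \<open>0 \<le> h\<close> by (intro increment_nn_integral[where f="\<lambda>r. ennreal (exp (\<theta> * (snd s + r)))"]) auto
    also have "\<dots> = (\<integral>\<^sup>+z'. ennreal (exp (\<theta> * snd s)) * ennreal (exp (\<theta> * (X h z' - X 0 z'))) \<partial>M)"
      by (intro nn_integral_cong) (simp add: ennreal_mult[symmetric] exp_add[symmetric] distrib_left)
    also have "\<dots> = ennreal (exp (\<theta> * snd s)) * ennreal (exp (h * \<psi> \<theta>))"
      using \<open>0 \<le> h\<close> by (subst nn_integral_cmult) (simp_all add: increment_exp_moment[OF lap \<open>0 \<le> \<theta>\<close> \<open>0 \<le> h\<close>])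
    also have "\<dots> \<le> ennreal (exp (\<theta> * snd s)) * ennreal (exp (h * \<bar>\<psi> \<theta>\<bar>))"
      using \<open>0 \<le> h\<close> by (intro mult_left_mono ennreal_leI) (auto intro!: mult_left_mono)
    finally show ?thesis .
  next
    case False
    have "ennreal (exp (\<theta> * snd s)) * 1 \<le> ennreal (exp (\<theta> * snd s)) * ennreal (exp (h * \<bar>\<psi> \<theta>\<bar>))"
      using \<open>0 \<le> h\<close> by (intro mult_left_mono) auto
    moreover have "F s r = ennreal (exp (\<theta> * snd s))" for r using False unfolding F_def by (simp only: if_False)
    ultimately show ?thesis by (simp add: emeasure_space_1)
  qed
  have "(\<integral>\<^sup>+z. ennreal (exp (\<theta> * snd (grid_state l c h k x (Suc j) z))) \<partial>M) = (\<integral>\<^sup>+z. F (?S z) (?e z) \<partial>M)"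
    by (intro nn_integral_cong) (simp add: F_def grid_state_Suc Let_def)
  also have "\<dots> = (\<integral>\<^sup>+z. (\<integral>\<^sup>+z'. F (?S z) (?e z') \<partial>M) \<partial>M)"
    by (rule grid_step_nn_integral) (use \<open>0 \<le> h\<close> in \<open>simp_all add: F_def\<close>)
  also have "\<dots> \<le> (\<integral>\<^sup>+z. ennreal (exp (\<theta> * snd (?S z))) * ennreal (exp (h * \<bar>\<psi> \<theta>\<bar>)) \<partial>M)"
    by (intro nn_integral_mono inner)
  also have "\<dots> \<le> ennreal (exp (\<theta> * x + real j * h * \<bar>\<psi> \<theta>\<bar>)) * ennreal (exp (h * \<bar>\<psi> \<theta>\<bar>))"
    by (subst nn_integral_multc) (auto intro!: mult_right_mono Suc)
  also have "\<dots> = ennreal (exp (\<theta> * x + real (Suc j) * h * \<bar>\<psi> \<theta>\<bar>))"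
    by (simp add: ennreal_mult[symmetric] exp_add[symmetric] algebra_simps of_nat_Suc)
  finally show ?case .
qed

text \<open>Squaring doubles the exponent, whence \<psi> at \<open>2 * \<theta>\<close>. The bound
  depends on the horizon \<open>t\<close> but not on the mesh, so it stays fixed as the grid is
  refined.\<close>

lemma grid_state_value_L2:
  assumes lap: "laplace_exponent M X \<psi>" and "0 \<le> \<theta>" "0 < h" and [measurable]: "k \<in> borel_measurable borel" "U \<in> borel_measurable borel"
    and U: "\<And>y. \<bar>U y\<bar> \<le> C * (1 + exp (\<theta> * y))" and k: "\<And>y. - \<kappa> \<le> k y" "0 \<le> \<kappa>" and t: "real j * h \<le> t"
  shows "(\<integral>\<^sup>+z. ennreal ((fst (grid_state l c h k x j z) * U (snd (grid_state l c h k x j z)))\<^sup>2) \<partial>M)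
      \<le> ennreal ((exp (\<kappa> * t) * C)\<^sup>2 * (2 + 2 * exp (2 * \<theta> * x + t * \<bar>\<psi> (2 * \<theta>)\<bar>)))"
proof -
  let ?S = "grid_state l c h k x j" and ?K = "(exp (\<kappa> * t) * C)\<^sup>2"
  have [measurable]: "?S \<in> measurable M (borel \<Otimes>\<^sub>M borel)" by (rule grid_state_measurable) (use \<open>0 < h\<close> in simp_all)
  have le: "(fst (?S z) * U (snd (?S z)))\<^sup>2 \<le> ?K * (2 + 2 * exp (2 * \<theta> * snd (?S z)))" for z
  proof -
    have w: "0 \<le> fst (?S z)" "fst (?S z) \<le> exp (\<kappa> * (real j * h))"
      using stopped_walk_weight[of \<kappa> k h] k \<open>0 < h\<close> unfolding grid_state_def by auto
    have "exp (\<kappa> * (real j * h)) \<le> exp (\<kappa> * t)" using t k(2) by (auto intro: mult_left_mono)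
    then have w2: "fst (?S z) \<le> exp (\<kappa> * t)" by (rule order_trans[OF w(2)])
    have "\<bar>fst (?S z) * U (snd (?S z))\<bar> \<le> exp (\<kappa> * t) * (C * (1 + exp (\<theta> * snd (?S z))))"
      unfolding abs_mult using w(1) w2 U by (intro mult_mono) auto
    then have "(fst (?S z) * U (snd (?S z)))\<^sup>2 \<le> (exp (\<kappa> * t) * (C * (1 + exp (\<theta> * snd (?S z)))))\<^sup>2"
      by (metis abs_ge_zero power2_abs power_mono)
    also have "\<dots> = ?K * (1 + exp (\<theta> * snd (?S z)))\<^sup>2" by (simp add: power_mult_distrib)
    also have "(1 + exp (\<theta> * snd (?S z)))\<^sup>2 \<le> 2 + 2 * (exp (\<theta> * snd (?S z)))\<^sup>2"
      using sum_squares_bound[of 1 "exp (\<theta> * snd (?S z))"] by (simp add: power2_sum)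
    also have "(exp (\<theta> * snd (?S z)))\<^sup>2 = exp (2 * \<theta> * snd (?S z))" by (simp add: exp_double[symmetric] mult.assoc)
    finally show ?thesis by (simp add: mult_left_mono)
  qed
  have "(\<integral>\<^sup>+z. ennreal ((fst (?S z) * U (snd (?S z)))\<^sup>2) \<partial>M) \<le> (\<integral>\<^sup>+z. ennreal ?K * (2 + 2 * ennreal (exp (2 * \<theta> * snd (?S z)))) \<partial>M)"
  proof (intro nn_integral_mono)
    fix z
    have "ennreal (?K * (2 + 2 * exp (2 * \<theta> * snd (?S z)))) = ennreal ?K * (2 + 2 * ennreal (exp (2 * \<theta> * snd (?S z))))"
      by (subst ennreal_mult) (auto simp: ennreal_plus ennreal_mult)
    then show "ennreal ((fst (?S z) * U (snd (?S z)))\<^sup>2) \<le> ennreal ?K * (2 + 2 * ennreal (exp (2 * \<theta> * snd (?S z))))"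
      using ennreal_leI[OF le[of z]] by simp
  qed
  also have "\<dots> = ennreal ?K * (2 + 2 * (\<integral>\<^sup>+z. ennreal (exp (2 * \<theta> * snd (?S z))) \<partial>M))"
    by (subst nn_integral_cmult) (auto simp: nn_integral_add nn_integral_cmult emeasure_space_1)
  also have "\<dots> \<le> ennreal ?K * (2 + 2 * ennreal (exp (2 * \<theta> * x + t * \<bar>\<psi> (2 * \<theta>)\<bar>)))"
  proof (intro mult_left_mono add_left_mono)
    have "real j * h * \<bar>\<psi> (2 * \<theta>)\<bar> \<le> t * \<bar>\<psi> (2 * \<theta>)\<bar>" using t by (intro mult_right_mono) auto
    then have "ennreal (exp (2 * \<theta> * x + real j * h * \<bar>\<psi> (2 * \<theta>)\<bar>)) \<le> ennreal (exp (2 * \<theta> * x + t * \<bar>\<psi> (2 * \<theta>)\<bar>))"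
      by (intro ennreal_leI) simp
    then show "(\<integral>\<^sup>+z. ennreal (exp (2 * \<theta> * snd (?S z))) \<partial>M) \<le> ennreal (exp (2 * \<theta> * x + t * \<bar>\<psi> (2 * \<theta>)\<bar>))"
      using grid_state_exp_moment[OF lap, of "2 * \<theta>" h k l c x j] \<open>0 \<le> \<theta>\<close> \<open>0 < h\<close> by (auto intro: order_trans)
  qed auto
  also have "\<dots> = ennreal (?K * (2 + 2 * exp (2 * \<theta> * x + t * \<bar>\<psi> (2 * \<theta>)\<bar>)))"
    by (subst ennreal_mult) (auto simp: ennreal_plus ennreal_mult)
  finally show ?thesis .
qed

text \<open>Given the past, \<open>gen\<close> loses at most \<open>h * e\<close> inside the
  interval, weighted by a discount of at most \<open>exp (\<kappa> * t)\<close>; outside, the state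
  is frozen and nothing is lost.\<close>

lemma grid_state_step:
  fixes x :: real
  assumes lap: "laplace_exponent M X \<psi>" and "0 \<le> \<theta>" "0 < h" and [measurable]: "k \<in> borel_measurable borel" "U \<in> borel_measurable borel"
    and U: "\<And>y. \<bar>U y\<bar> \<le> C * (1 + exp (\<theta> * y))" and k: "\<And>y. - \<kappa> \<le> k y" "0 \<le> \<kappa>" and t: "real (Suc j) * h \<le> t"
    and "0 \<le> e" and gen: "\<And>y. y \<in> {l..c} \<Longrightarrow> U y - h * e \<le> exp (- h * k y) * transition h U y"
  defines "S \<equiv> grid_state l c h k x"
  shows "expectation (\<lambda>z. fst (S j z) * U (snd (S j z))) - h * e * exp (\<kappa> * t) \<le> expectation (\<lambda>z. fst (S (Suc j) z) * U (snd (S (Suc j) z)))"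
proof -
  let ?e = "\<lambda>z. X (real (Suc j) * h) z - X (real j * h) z"
  have Sm[measurable]: "S i \<in> measurable M (borel \<Otimes>\<^sub>M borel)" for i unfolding S_def by (rule grid_state_measurable) (use \<open>0 < h\<close> in simp_all)
  define F where "F s r = (if snd s \<in> {l..c} then fst s * exp (- h * k (snd s)) * U (snd s + r) else fst s * U (snd s))" for s :: "real \<times> real" and r
  have int: "integrable M (\<lambda>z. fst (S i z) * U (snd (S i z)))" if "i \<le> Suc j" for i
  proof (rule square_integrable_imp_integrable)
    have "real i * h \<le> t" using t that \<open>0 < h\<close> mult_right_mono[of "real i" "real (Suc j)" h] by linarith
    from grid_state_value_L2[OF lap \<open>0 \<le> \<theta>\<close> \<open>0 < h\<close> \<open>k \<in> borel_measurable borel\<close> \<open>U \<in> borel_measurable borel\<close> U k this, where l=l and c=c and x=x]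
    show "integrable M (\<lambda>z. (fst (S i z) * U (snd (S i z)))\<^sup>2)"
      unfolding S_def[symmetric] by (intro integrableI_bounded) (auto simp: less_top[symmetric] top_unique)
  qed auto
  have FS: "F (S j z) (?e z) = fst (S (Suc j) z) * U (snd (S (Suc j) z))" for z
    by (simp add: F_def S_def grid_state_Suc Let_def)
  have Fint: "integrable M (\<lambda>z. F (S j z) (?e z))" unfolding FS by (rule int) simp
  note F = grid_step_expectation[OF \<open>k \<in> borel_measurable borel\<close> less_imp_le[OF \<open>0 < h\<close>] _ Fint[unfolded S_def], folded S_def]
  have Fm: "(\<lambda>(a, b). F a b) \<in> borel_measurable ((borel \<Otimes>\<^sub>M borel) \<Otimes>\<^sub>M borel)" unfolding F_def by measurable
  have inner: "expectation (\<lambda>z'. F s (?e z')) = (if snd s \<in> {l..c} then fst s * exp (- h * k (snd s)) * transition h U (snd s) else fst s * U (snd s))" for s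
  proof (cases "snd s \<in> {l..c}")
    case True
    have "expectation (\<lambda>z'. U (snd s + (X (real j * h + h) z' - X (real j * h) z'))) = transition h U (snd s)"
      unfolding transition_def using \<open>0 < h\<close> by (intro increment_expectation[where f="\<lambda>r. U (snd s + r)"]) auto
    moreover have "real (Suc j) * h = real j * h + h" by (simp add: algebra_simps of_nat_Suc)
    ultimately show ?thesis using True by (simp add: F_def)
  next
    case False
    then have "F s r = fst s * U (snd s)" for r unfolding F_def by (simp only: if_False)
    then show ?thesis unfolding if_not_P[OF False] by (simp add: prob_space)
  qed
  have "expectation (\<lambda>z. fst (S j z) * U (snd (S j z))) - h * e * exp (\<kappa> * t) = expectation (\<lambda>z. fst (S j z) * U (snd (S j z)) - h * e * exp (\<kappa> * t))"
    using int[of j] by (simp add: prob_space)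
  also have "\<dots> \<le> expectation (\<lambda>z. expectation (\<lambda>z'. F (S j z) (?e z')))"
  proof (intro integral_mono)
    show "integrable M (\<lambda>z. expectation (\<lambda>z'. F (S j z) (?e z')))" by (rule F(2)[OF Fm])
    fix z
    have w: "0 \<le> fst (S j z)" "fst (S j z) \<le> exp (\<kappa> * (real j * h))"
      using stopped_walk_weight[of \<kappa> k h] k \<open>0 < h\<close> unfolding S_def grid_state_def by auto
    have "real j * h \<le> t" using t \<open>0 < h\<close> mult_right_mono[of "real j" "real (Suc j)" h] by linarith
    then have "exp (\<kappa> * (real j * h)) \<le> exp (\<kappa> * t)" using k(2) by (auto intro: mult_left_mono)
    then have w2: "fst (S j z) \<le> exp (\<kappa> * t)" by (rule order_trans[OF w(2)])
    have he: "fst (S j z) * (h * e) \<le> h * e * exp (\<kappa> * t)"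
      using mult_right_mono[OF w2, of "h * e"] \<open>0 \<le> e\<close> \<open>0 < h\<close> by (simp add: mult.commute)
    have he0: "0 \<le> h * e * exp (\<kappa> * t)" using \<open>0 \<le> e\<close> \<open>0 < h\<close> by simp
    show "fst (S j z) * U (snd (S j z)) - h * e * exp (\<kappa> * t) \<le> expectation (\<lambda>z'. F (S j z) (?e z'))"
    proof (cases "snd (S j z) \<in> {l..c}")
      case True
      have "fst (S j z) * (U (snd (S j z)) - h * e) \<le> fst (S j z) * (exp (- h * k (snd (S j z))) * transition h U (snd (S j z)))"
        by (rule mult_left_mono[OF gen[OF True] w(1)])
      then show ?thesis using he True unfolding inner by (simp add: algebra_simps)
    next
      case False then show ?thesis using he0 unfolding inner if_not_P[OF False] by simp
    qed
  qed (use int[of j] in simp)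
  also have "\<dots> = expectation (\<lambda>z. F (S j z) (?e z))" by (rule F(1)[OF Fm, symmetric])
  finally show ?thesis unfolding FS .
qed

section \<open>Passage from the grid to continuous time\<close>

definition stopped_time :: "real \<Rightarrow> real \<Rightarrow> real \<Rightarrow> real \<Rightarrow> 'a \<Rightarrow> real" where
  "stopped_time l c x t z = exit_time l c (\<lambda>s. x + (X s z - X 0 z)) t"

definition stopped_pos :: "real \<Rightarrow> real \<Rightarrow> real \<Rightarrow> real \<Rightarrow> 'a \<Rightarrow> real" where
  "stopped_pos l c x t z = x + (X (stopped_time l c x t z) z - X 0 z)"

definition discount :: "(real \<Rightarrow> real) \<Rightarrow> real \<Rightarrow> real \<Rightarrow> real \<Rightarrow> real \<Rightarrow> 'a \<Rightarrow> real" where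
  "discount k l c x t z = exp (- (LINT s:{0..stopped_time l c x t z}|lborel. k (x + (X s z - X 0 z))))"

lemma cadlag_shift:
  assumes "z \<in> space M"
  shows "cadlag_path (\<lambda>s. x + (X s z - X 0 z))"
  unfolding cadlag_path_def
proof (intro conjI allI impI)
  fix t :: real assume "0 \<le> t"
  then have "((\<lambda>s. X s z) \<longlongrightarrow> X t z) (at_right t)" by (rule cadlag_path_right[OF cadlag[OF assms]])
  then show "((\<lambda>s. x + (X s z - X 0 z)) \<longlongrightarrow> x + (X t z - X 0 z)) (at_right t)" by (intro tendsto_intros)
next
  fix t :: real assume "0 < t"
  then obtain L where "((\<lambda>s. X s z) \<longlongrightarrow> L) (at_left t)" using cadlag[OF assms] unfolding cadlag_path_def by blast
  then have "((\<lambda>s. x + (X s z - X 0 z)) \<longlongrightarrow> x + (L - X 0 z)) (at_left t)" by (intro tendsto_intros)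
  then show "\<exists>L. ((\<lambda>s. x + (X s z - X 0 z)) \<longlongrightarrow> L) (at_left t)" by blast
qed

lemma grid_state_tendsto:
  assumes z: "z \<in> space M" and k: "continuous_on UNIV k" and "0 < t"
  shows "(\<lambda>n. snd (grid_state l c (t / real n) k x n z)) \<longlonglongrightarrow> stopped_pos l c x t z"
    and "(\<lambda>n. fst (grid_state l c (t / real n) k x n z)) \<longlonglongrightarrow> discount k l c x t z"
proof -
  have e: "stopped_walk l c (t / real n) k (x + (X 0 z - X 0 z)) n (\<lambda>i. x + (X (real (Suc i) * (t / real n)) z - X 0 z) - (x + (X (real i * (t / real n)) z - X 0 z)))
    = grid_state l c (t / real n) k x n z" for n
    unfolding grid_state_def by simp
  show "(\<lambda>n. snd (grid_state l c (t / real n) k x n z)) \<longlonglongrightarrow> stopped_pos l c x t z"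
    "(\<lambda>n. fst (grid_state l c (t / real n) k x n z)) \<longlonglongrightarrow> discount k l c x t z"
    using stopped_walk_tendsto[OF cadlag_shift[OF z, of x] k \<open>0 < t\<close>, of l c, unfolded e]
    unfolding stopped_pos_def discount_def stopped_time_def by auto
qed

lemma stopped_measurable:
  assumes "0 < t" and k: "continuous_on UNIV k"
  shows "stopped_pos l c x t \<in> borel_measurable M" and "discount k l c x t \<in> borel_measurable M"
proof -
  have [measurable]: "k \<in> borel_measurable borel" using k by (rule borel_measurable_continuous_onI)
  have [measurable]: "grid_state l c (t / real n) k x n \<in> measurable M (borel \<Otimes>\<^sub>M borel)" for n
    using \<open>0 < t\<close> by (intro grid_state_measurable) auto
  show "stopped_pos l c x t \<in> borel_measurable M"
    by (rule borel_measurable_LIMSEQ_real[OF grid_state_tendsto(1)[OF _ k \<open>0 < t\<close>]]) auto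
  show "discount k l c x t \<in> borel_measurable M"
    by (rule borel_measurable_LIMSEQ_real[OF grid_state_tendsto(2)[OF _ k \<open>0 < t\<close>]]) auto
qed

text \<open>The steps of a grid on [0, t] lose at most \<open>e * t * exp (\<kappa> * t)\<close>
  together, and second moments carry the inequality to the limit of fine grids. The slack \<eta>
  makes room for functions that are harmonic only up to a small error.\<close>

theorem stopping_lower:
  assumes lap: "laplace_exponent M X \<psi>" and "0 \<le> \<theta>" and Ucont: "continuous_on UNIV U"
    and U: "\<And>y. \<bar>U y\<bar> \<le> C * (1 + exp (\<theta> * y))"
    and kcont: "continuous_on UNIV k" and k: "\<And>y. - \<kappa> \<le> k y" "0 \<le> \<kappa>" and "0 < t" "0 \<le> \<eta>"
    and gen: "\<And>e. \<eta> < e \<Longrightarrow> \<forall>\<^sub>F h in at_right 0. \<forall>y\<in>{l..c}. U y - h * e \<le> exp (- h * k y) * transition h U y"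
  shows "integrable M (\<lambda>z. discount k l c x t z * U (stopped_pos l c x t z))"
    and "U x - \<eta> * t * exp (\<kappa> * t) \<le> expectation (\<lambda>z. discount k l c x t z * U (stopped_pos l c x t z))"
proof -
  have km[measurable]: "k \<in> borel_measurable borel" using kcont by (rule borel_measurable_continuous_onI)
  have Um[measurable]: "U \<in> borel_measurable borel" using Ucont by (rule borel_measurable_continuous_onI)
  have Sm[measurable]: "grid_state l c (t / real n) k x j \<in> measurable M (borel \<Otimes>\<^sub>M borel)" for n j
    using \<open>0 < t\<close> by (intro grid_state_measurable) auto
  let ?V = "\<lambda>n z. fst (grid_state l c (t / real n) k x n z) * U (snd (grid_state l c (t / real n) k x n z))"
  let ?K = "(exp (\<kappa> * t) * C)\<^sup>2 * (2 + 2 * exp (2 * \<theta> * x + t * \<bar>\<psi> (2 * \<theta>)\<bar>))"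
  have lim: "(\<lambda>n. ?V (Suc n) z) \<longlonglongrightarrow> discount k l c x t z * U (stopped_pos l c x t z)" if z: "z \<in> space M" for z
    using grid_state_tendsto[OF z kcont \<open>0 < t\<close>, of l c x] continuous_on_tendsto_compose[OF Ucont grid_state_tendsto(1)[OF z kcont \<open>0 < t\<close>, of l c x]]
    by (intro LIMSEQ_Suc[where f="\<lambda>n. ?V n z"] tendsto_mult) auto
  have K0: "0 \<le> ?K" by (intro mult_nonneg_nonneg add_nonneg_nonneg) auto
  have L2: "(\<integral>\<^sup>+z. ennreal ((?V (Suc n) z)\<^sup>2) \<partial>M) \<le> ennreal ?K" for n
    using \<open>0 < t\<close> by (intro grid_state_value_L2[OF lap \<open>0 \<le> \<theta>\<close> _ km Um U k]) auto
  note E = expectation_tendsto_L2_bounded[OF _ lim L2 K0]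
  show "integrable M (\<lambda>z. discount k l c x t z * U (stopped_pos l c x t z))" by (rule E(1)) measurable
  have Elim: "(\<lambda>n. expectation (?V (Suc n))) \<longlonglongrightarrow> expectation (\<lambda>z. discount k l c x t z * U (stopped_pos l c x t z))"
    by (rule E(2)) measurable
  have low: "U x - e * t * exp (\<kappa> * t) \<le> expectation (\<lambda>z. discount k l c x t z * U (stopped_pos l c x t z))" if e: "\<eta> < e" for e
  proof (rule LIMSEQ_le_const[OF Elim])
    obtain b where b: "0 < b" "\<And>h y. 0 < h \<Longrightarrow> h < b \<Longrightarrow> y \<in> {l..c} \<Longrightarrow> U y - h * e \<le> exp (- h * k y) * transition h U y"
      using gen[OF e] by (auto simp: eventually_at_right_field)
    have e0: "0 \<le> e" using e \<open>0 \<le> \<eta>\<close> by simp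
    obtain N where N: "t / b < real N" using reals_Archimedean2 by blast
    have "U x - e * t * exp (\<kappa> * t) \<le> expectation (?V (Suc n))" if n: "N \<le> n" for n
    proof -
      define h where "h = t / real (Suc n)"
      have "t / b < real (Suc n)" using N n by (simp add: of_nat_Suc)
      then have h: "0 < h" "h < b" "real (Suc n) * h = t" using \<open>0 < t\<close> b(1) by (auto simp: h_def field_simps)
      have "U x - real j * (h * e * exp (\<kappa> * t)) \<le> expectation (\<lambda>z. fst (grid_state l c h k x j z) * U (snd (grid_state l c h k x j z)))"
        if "j \<le> Suc n" for j
        using that
      proof (induction j)
        case 0 show ?case by (simp add: grid_state_def prob_space)
      next
        case (Suc j)
        have "real (Suc j) * h \<le> t" using Suc.prems h mult_right_mono[of "real (Suc j)" "real (Suc n)" h] by simp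
        from grid_state_step[OF lap \<open>0 \<le> \<theta>\<close> h(1) km Um U k this e0 b(2)[OF h(1,2)], of l c x]
        show ?case using Suc by (simp add: algebra_simps of_nat_Suc)
      qed
      from this[of "Suc n"] have "U x - real (Suc n) * (h * e * exp (\<kappa> * t)) \<le> expectation (?V (Suc n))" by (simp add: h_def)
      moreover have "real (Suc n) * (h * e * exp (\<kappa> * t)) = e * t * exp (\<kappa> * t)" using h(3) by (metis mult.assoc mult.commute)
      ultimately show ?thesis by simp
    qed
    then show "\<exists>N. \<forall>n\<ge>N. U x - e * t * exp (\<kappa> * t) \<le> expectation (?V (Suc n))" by blast
  qed
  \<comment> \<open>The bound is available for every \<open>e\<close> above \<eta>; its value at
    \<eta> comes by continuity.\<close>
  have "((\<lambda>e. U x - e * t * exp (\<kappa> * t)) \<longlongrightarrow> U x - \<eta> * t * exp (\<kappa> * t)) (at_right \<eta>)"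
    by (intro tendsto_intros)
  then show "U x - \<eta> * t * exp (\<kappa> * t) \<le> expectation (\<lambda>z. discount k l c x t z * U (stopped_pos l c x t z))"
    by (rule tendsto_upperbound) (auto simp: eventually_at_right_field intro!: exI[of _ "\<eta> + 1"] low)
qed

end

declare of_nat_Suc [simp]

section \<open>The scale function\<close>

locale levy_scale = spectrally_negative_levy M X for M :: "'a measure" and X +
  fixes \<psi> W :: "real \<Rightarrow> real"
  assumes lap: "laplace_exponent M X \<psi>" and scale: "scale_function \<psi> 0 W"
begin

(* The maximum with 0 also covers the junk value of the infimum of an empty set. *)
definition \<theta>0 :: real where "\<theta>0 = max 0 (right_inverse \<psi> 0)"

lemma W_nonneg: "0 \<le> W x" and W_neg: "x < 0 \<Longrightarrow> W x = 0"
  and W_cont: "continuous_on {0..} W" and W_mono: "mono_on {0..} W"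
  using scale by (auto simp: scale_function_def)

lemma W_mono_UNIV: "x \<le> y \<Longrightarrow> W x \<le> W y"
  using W_nonneg[of y] W_neg[of x] W_mono by (cases "x < 0") (auto simp: mono_on_def)

lemma W_measurable[measurable]: "W \<in> borel_measurable borel"
  by (rule borel_measurable_mono) (simp add: mono_def W_mono_UNIV)

lemma W_laplace:
  assumes "\<theta>0 < \<theta>"
  shows "(\<integral>\<^sup>+y. ennreal (exp (- \<theta> * y) * W y) \<partial>lborel) = ennreal (1 / \<psi> \<theta>)" and "0 \<le> \<psi> \<theta>"
proof -
  have th: "right_inverse \<psi> 0 < \<theta>" using assms by (simp add: \<theta>0_def)
  have i: "set_integrable lborel {0..} (\<lambda>y. exp (- \<theta> * y) * W y)"
    and e: "(LINT y:{0..}|lborel. exp (- \<theta> * y) * W y) = 1 / \<psi> \<theta>"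
    using scale th unfolding scale_function_def by auto
  have eq: "indicator {0..} y *\<^sub>R (exp (- \<theta> * y) * W y) = exp (- \<theta> * y) * W y" for y
    using W_neg[of y] by (auto simp: indicator_def)
  have "ennreal (1 / \<psi> \<theta>) = (\<integral>\<^sup>+y. ennreal (exp (- \<theta> * y) * W y) \<partial>lborel)"
    using i e unfolding set_integrable_def set_lebesgue_integral_def eq
    by (subst nn_integral_eq_integral) (auto simp: W_nonneg)
  then show "(\<integral>\<^sup>+y. ennreal (exp (- \<theta> * y) * W y) \<partial>lborel) = ennreal (1 / \<psi> \<theta>)" by simp
  have "0 \<le> 1 / \<psi> \<theta>" unfolding e[symmetric] set_lebesgue_integral_def
    by (intro Bochner_Integration.integral_nonneg) (auto simp: W_nonneg)
  then show "0 \<le> \<psi> \<theta>" by (simp add: zero_le_divide_iff)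
qed

(* Otherwise W = 0, hence psi vanishes at all large arguments; then the variance of exp(theta X_t) is 0
   and X = 0, which is excluded because X is not the negative of a subordinator. *)
lemma \<psi>_pos:
  assumes "\<theta>0 < \<theta>"
  shows "0 < \<psi> \<theta>"
proof (rule ccontr)
  assume "\<not> 0 < \<psi> \<theta>"
  then have z: "\<psi> \<theta> = 0" using W_laplace(2)[OF assms] by simp
  have "(\<integral>\<^sup>+y. ennreal (exp (- \<theta> * y) * W y) \<partial>lborel) = 0" using W_laplace(1)[OF assms] z by simp
  then have "AE y in lborel. ennreal (exp (- \<theta> * y) * W y) = 0"
    by (subst (asm) nn_integral_0_iff_AE) auto
  then have W0: "AE y in lborel. W y = 0"
    by eventually_elim (use W_nonneg in \<open>auto simp: ennreal_eq_0_iff mult_le_0_iff intro: antisym\<close>)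
  have "\<psi> (2 * \<theta>) = 0"
  proof (rule ccontr)
    assume n: "\<psi> (2 * \<theta>) \<noteq> 0"
    have th2: "\<theta>0 < 2 * \<theta>" using assms by (simp add: \<theta>0_def)
    have "(\<integral>\<^sup>+y. ennreal (exp (- (2 * \<theta>) * y) * W y) \<partial>lborel) = (\<integral>\<^sup>+y. 0 \<partial>(lborel :: real measure))"
      by (rule nn_integral_cong_AE) (use W0 in \<open>eventually_elim, simp\<close>)
    then have "ennreal (1 / \<psi> (2 * \<theta>)) = 0" using W_laplace(1)[OF th2] by simp
    then show False using n W_laplace(2)[OF th2] by (simp add: ennreal_eq_0_iff divide_le_0_iff)
  qed
  have \<theta>: "0 < \<theta>" using assms by (simp add: \<theta>0_def)
  have X0: "AE z in M. X t z = 0" if t: "0 \<le> t" for t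
  proof -
    have i1: "integrable M (\<lambda>z. exp (\<theta> * X t z))" and i2: "integrable M (\<lambda>z. exp (2 * \<theta> * X t z))"
      using laplace_exponent_nn_integral(2)[OF lap _ t] \<theta> by auto
    have e1: "expectation (\<lambda>z. exp (\<theta> * X t z)) = 1" and e2: "expectation (\<lambda>z. exp (2 * \<theta> * X t z)) = 1"
      using lap t \<theta> z \<open>\<psi> (2 * \<theta>) = 0\<close> unfolding laplace_exponent_def by auto
    have sq: "(exp (\<theta> * X t z) - 1)\<^sup>2 = exp (2 * \<theta> * X t z) - 2 * exp (\<theta> * X t z) + 1" for z
      by (simp add: power2_diff exp_double[symmetric] mult.assoc)
    have "expectation (\<lambda>z. (exp (\<theta> * X t z) - 1)\<^sup>2) = 0" unfolding sq using i1 i2 e1 e2 by (simp add: prob_space)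
    moreover have "integrable M (\<lambda>z. (exp (\<theta> * X t z) - 1)\<^sup>2)" unfolding sq using i1 i2 by simp
    ultimately have "AE z in M. (exp (\<theta> * X t z) - 1)\<^sup>2 = 0"
      by (subst (asm) integral_nonneg_eq_0_iff_AE) auto
    then show ?thesis by eventually_elim (use \<theta> in auto)
  qed
  have "AE z in M. \<forall>q\<in>{q\<in>\<rat>. 0 \<le> q}. X q z = 0"
    by (subst AE_ball_countable) (auto intro: X0 countable_subset[OF _ countable_rat])
  then have "AE z in M. \<forall>s t. 0 \<le> s \<longrightarrow> s \<le> t \<longrightarrow> X t z \<le> X s z"
  proof (rule AE_mp, intro AE_I2 impI)
    fix z assume z: "z \<in> space M" and q: "\<forall>q\<in>{q\<in>\<rat>. 0 \<le> q}. X q z = 0"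
    have "X t z = 0" if t: "0 \<le> t" for t
    proof (rule ccontr)
      assume "X t z \<noteq> 0"
      then have "X t z \<in> - {0}" by simp
      from topological_tendstoD[OF cadlag_path_right[OF cadlag[OF z] t] _ this]
      have "\<forall>\<^sub>F s in at_right t. X s z \<in> - {0}" by auto
      then obtain b where b: "t < b" "\<And>s. t < s \<Longrightarrow> s < b \<Longrightarrow> X s z \<noteq> 0" by (auto simp: eventually_at_right_field)
      obtain q' where "q' \<in> \<rat>" "t < q'" "q' < b" using Rats_dense_in_real[OF b(1)] by blast
      then show False using b(2)[of q'] q t by auto
    qed
    then show "\<forall>s t. 0 \<le> s \<longrightarrow> s \<le> t \<longrightarrow> X t z \<le> X s z" by simp
  qed
  then show False using not_neg_subordinator by contradiction
qed

text \<open>By monotonicity \<open>W\<close> is at least \<open>W v\<close> on [v, v + 1], and the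
  part of the Laplace integral over this interval is at most the whole integral
  \<open>1 / \<psi> \<theta>\<close>.\<close>

lemma W_bound:
  assumes "\<theta>0 < \<theta>"
  shows "W v \<le> exp \<theta> / \<psi> \<theta> * exp (\<theta> * v)"
proof (cases "v < 0")
  case True then show ?thesis using \<psi>_pos[OF assms] by (simp add: W_neg)
next
  case False
  have \<theta>: "0 < \<theta>" using assms by (simp add: \<theta>0_def)
  have "ennreal (exp (- \<theta> * (v + 1)) * W v) = (\<integral>\<^sup>+y. ennreal (exp (- \<theta> * (v + 1)) * W v) * indicator {v..v+1} y \<partial>lborel)"
    by (subst nn_integral_cmult_indicator) auto
  also have "\<dots> \<le> (\<integral>\<^sup>+y. ennreal (exp (- \<theta> * y) * W y) \<partial>lborel)"
  proof (intro nn_integral_mono)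
    fix y show "ennreal (exp (- \<theta> * (v + 1)) * W v) * indicator {v..v+1} y \<le> ennreal (exp (- \<theta> * y) * W y)"
    proof (cases "y \<in> {v..v+1}")
      case True
      then have "exp (- \<theta> * (v + 1)) * W v \<le> exp (- \<theta> * y) * W y"
        using \<theta> W_mono_UNIV[of v y] by (intro mult_mono) (auto simp: W_nonneg)
      then show ?thesis using True by (simp add: ennreal_leI)
    qed auto
  qed
  also have "\<dots> = ennreal (1 / \<psi> \<theta>)" by (rule W_laplace[OF assms])
  finally have "exp (- \<theta> * (v + 1)) * W v \<le> 1 / \<psi> \<theta>" using \<psi>_pos[OF assms] by (simp add: ennreal_le_iff)
  then have "exp (\<theta> * (v + 1)) * (exp (- \<theta> * (v + 1)) * W v) \<le> exp (\<theta> * (v + 1)) * (1 / \<psi> \<theta>)"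
    by (intro mult_left_mono) auto
  moreover have "exp (\<theta> * (v + 1)) * (exp (- \<theta> * (v + 1)) * W v) = W v" by (simp only: mult.assoc[symmetric] exp_add[symmetric]) simp
  ultimately have "W v \<le> exp (\<theta> * (v + 1)) * (1 / \<psi> \<theta>)" by (simp only:)
  then show ?thesis by (simp add: distrib_left exp_add mult.commute)
qed

lemma W_not_zero: "\<exists>v. 0 < W v"
proof (rule ccontr)
  assume "\<nexists>v. 0 < W v"
  then have "W v = 0" for v using W_nonneg[of v] by (metis less_eq_real_def)
  then have "ennreal (1 / \<psi> (\<theta>0 + 1)) = 0" using W_laplace(1)[of "\<theta>0 + 1"] by simp
  then show False using \<psi>_pos[of "\<theta>0 + 1"] by (simp add: ennreal_eq_0_iff)
qed

section \<open>Convolutions of the scale function with compactly supported densities\<close>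

definition conv :: "(real \<Rightarrow> real) \<Rightarrow> real \<Rightarrow> real" where
  "conv g y = (LINT u|lborel. W (y - u) * g u)"

definition bounded_support :: "real \<Rightarrow> real \<Rightarrow> real \<Rightarrow> (real \<Rightarrow> real) \<Rightarrow> bool" where
  "bounded_support \<alpha> \<beta> G g \<longleftrightarrow> g \<in> borel_measurable borel \<and> (\<forall>u. \<bar>g u\<bar> \<le> G) \<and> (\<forall>u. u \<notin> {\<alpha>..\<beta>} \<longrightarrow> g u = 0) \<and> \<alpha> \<le> \<beta>"

lemma bounded_supportD:
  assumes "bounded_support \<alpha> \<beta> G g"
  shows "g \<in> borel_measurable borel" "\<bar>g u\<bar> \<le> G" "u \<notin> {\<alpha>..\<beta>} \<Longrightarrow> g u = 0" "\<alpha> \<le> \<beta>" "0 \<le> G"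
  using assms abs_ge_zero[of "g 0"] order_trans[of 0 "\<bar>g 0\<bar>" G] unfolding bounded_support_def by blast+

lemma conv_bound:
  assumes g: "bounded_support \<alpha> \<beta> G g"
  shows "norm (W (y - u) * g u) \<le> G * W (y - \<alpha>) * indicator {\<alpha>..\<beta>} u"
    and "integrable lborel (\<lambda>u. W (y - u) * g u)"
    and "\<bar>conv g y\<bar> \<le> G * W (y - \<alpha>) * (\<beta> - \<alpha>)"
proof -
  note [measurable] = bounded_supportD(1)[OF g]
  show b: "norm (W (y - u) * g u) \<le> G * W (y - \<alpha>) * indicator {\<alpha>..\<beta>} u" for u
  proof (cases "u \<in> {\<alpha>..\<beta>}")
    case True
    have "W (y - u) * \<bar>g u\<bar> \<le> W (y - \<alpha>) * G"
      using True bounded_supportD(2,5)[OF g] by (intro mult_mono W_mono_UNIV) (auto simp: W_nonneg)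
    then show ?thesis using True by (simp add: abs_mult W_nonneg mult.commute)
  qed (simp add: bounded_supportD(3)[OF g])
  have ii: "integrable lborel (\<lambda>u. G * W (y - \<alpha>) * indicator {\<alpha>..\<beta>} u)"
    by (intro integrable_mult_right integrable_real_indicator) (auto simp: emeasure_lborel_Icc_eq)
  show i: "integrable lborel (\<lambda>u. W (y - u) * g u)"
  proof (rule Bochner_Integration.integrable_bound[OF ii])
    show "AE u in lborel. norm (W (y - u) * g u) \<le> norm (G * W (y - \<alpha>) * indicator {\<alpha>..\<beta>} u)"
      using order_trans[OF b abs_ge_self] by (intro AE_I2) (simp only: real_norm_def)
  qed measurable
  have "\<bar>conv g y\<bar> \<le> (LINT u|lborel. norm (W (y - u) * g u))" unfolding conv_def
    using integral_norm_bound[of lborel "\<lambda>u. W (y - u) * g u"] by simp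
  also have "\<dots> \<le> (LINT u|lborel. G * W (y - \<alpha>) * indicator {\<alpha>..\<beta>} u)"
    using i ii b by (intro integral_mono) auto
  also have "\<dots> = G * W (y - \<alpha>) * (\<beta> - \<alpha>)" using bounded_supportD(4)[OF g] by simp
  finally show "\<bar>conv g y\<bar> \<le> G * W (y - \<alpha>) * (\<beta> - \<alpha>)" .
qed

lemma conv_zero:
  assumes g: "bounded_support \<alpha> \<beta> G g" and "y < \<alpha>"
  shows "conv g y = 0"
  using conv_bound(3)[OF g, of y] W_neg[of "y - \<alpha>"] \<open>y < \<alpha>\<close> by simp

lemma conv_exp_bound:
  assumes g: "bounded_support \<alpha> \<beta> G g" and "\<theta>0 < \<theta>"
  obtains C where "0 \<le> C" "\<And>y. \<bar>conv g y\<bar> \<le> C * exp (\<theta> * y)"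
proof
  let ?C = "G * (exp \<theta> / \<psi> \<theta> * exp (- \<theta> * \<alpha>)) * (\<beta> - \<alpha>)"
  note p = \<psi>_pos[OF \<open>\<theta>0 < \<theta>\<close>] bounded_supportD(4,5)[OF g]
  show "0 \<le> ?C" using p by (intro mult_nonneg_nonneg) auto
  fix y
  have "G * W (y - \<alpha>) * (\<beta> - \<alpha>) \<le> G * (exp \<theta> / \<psi> \<theta> * exp (\<theta> * (y - \<alpha>))) * (\<beta> - \<alpha>)"
    using p by (intro mult_right_mono mult_left_mono W_bound \<open>\<theta>0 < \<theta>\<close>) auto
  also have "\<dots> = ?C * exp (\<theta> * y)" by (simp add: right_diff_distrib exp_diff exp_minus field_simps)
  finally show "\<bar>conv g y\<bar> \<le> ?C * exp (\<theta> * y)" using conv_bound(3)[OF g, of y] by simp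
qed

lemma isCont_W: "x \<noteq> 0 \<Longrightarrow> isCont W x"
proof (cases "x < 0")
  case True
  have "\<forall>\<^sub>F y in nhds x. 0 = W y"
    using order_tendstoD(2)[OF tendsto_ident_at True] True
    by (auto simp: eventually_nhds W_neg intro!: exI[of _ "{..<0}"])
  then have "isCont W x \<longleftrightarrow> isCont (\<lambda>_. 0 :: real) x" by (intro isCont_cong) (auto elim: eventually_mono)
  then show ?thesis by simp
next
  assume "x \<noteq> 0" case False
  then have "x \<in> interior {0..}" using \<open>x \<noteq> 0\<close> by (auto simp: interior_def intro!: exI[of _ "{0<..}"])
  then show ?thesis by (rule continuous_on_interior[OF W_cont])
qed

text \<open>The only possible jump of \<open>W\<close> is at 0, and it is met only at
  \<open>u = y\<close>, a null set for the integral; so the convolution is continuous even when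
  \<open>g\<close> is not.\<close>

lemma conv_continuous:
  assumes g: "bounded_support \<alpha> \<beta> G g"
  shows "continuous_on UNIV (conv g)"
  unfolding continuous_on_eq_continuous_at[OF open_UNIV]
proof (intro ballI)
  fix y :: real
  note [measurable] = bounded_supportD(1)[OF g]
  show "isCont (conv g) y"
    unfolding continuous_at_sequentially comp_def
  proof (intro allI impI)
    fix s :: "nat \<Rightarrow> real" assume s: "s \<longlonglongrightarrow> y"
    then obtain B where B: "\<And>n. s n \<le> B" using Bseq_eq_bounded convergent_imp_Bseq[of s] 
      by (metis Bseq_def abs_le_D1 convergentI real_norm_def)
    show "(\<lambda>n. conv g (s n)) \<longlonglongrightarrow> conv g y" unfolding conv_def
    proof (rule integral_dominated_convergence[where w="\<lambda>u. G * W (B - \<alpha>) * indicator {\<alpha>..\<beta>} u"])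
      show "integrable lborel (\<lambda>u. G * W (B - \<alpha>) * indicator {\<alpha>..\<beta>} u)"
        by (intro integrable_mult_right integrable_real_indicator) (auto simp: emeasure_lborel_Icc_eq)
      show "AE u in lborel. (\<lambda>n. W (s n - u) * g u) \<longlonglongrightarrow> W (y - u) * g u"
        using AE_lborel_singleton[of y]
      proof eventually_elim
        case (elim u)
        then have "isCont W (y - u)" by (intro isCont_W) simp
        then show ?case by (intro tendsto_mult tendsto_const isCont_tendsto_compose[of "y - u" W] tendsto_diff s)
      qed
      show "AE u in lborel. norm (W (s n - u) * g u) \<le> G * W (B - \<alpha>) * indicator {\<alpha>..\<beta>} u" for n
      proof (intro AE_I2)
        fix u
        have "G * W (s n - \<alpha>) * indicator {\<alpha>..\<beta>} u \<le> G * W (B - \<alpha>) * indicator {\<alpha>..\<beta>} u"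
          using B[of n] bounded_supportD(5)[OF g] by (intro mult_right_mono mult_left_mono W_mono_UNIV) auto
        then show "norm (W (s n - u) * g u) \<le> G * W (B - \<alpha>) * indicator {\<alpha>..\<beta>} u"
          using conv_bound(1)[OF g, of "s n" u] by linarith
      qed
    qed measurable
  qed
qed

end

section \<open>The generator on convolutions with the scale function\<close>

context levy_process
begin

lemma X_joint_measurable:
  assumes [measurable]: "f \<in> borel_measurable N" "g \<in> measurable N M"
  shows "(\<lambda>p. X (max 0 (f p)) (g p)) \<in> borel_measurable N"
proof -
  have J: "(\<lambda>(s, z). X (max 0 s) z) \<in> borel_measurable (borel \<Otimes>\<^sub>M M)"
    by (rule borel_measurable_right_continuous_process) (auto intro: cadlag_path_right cadlag)
  have "(\<lambda>p. (f p, g p)) \<in> measurable N (borel \<Otimes>\<^sub>M M)" by measurable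
  from measurable_compose[OF this J] show ?thesis by simp
qed

text \<open>Translation by an increment becomes multiplication by the exponential of \<theta> times
  the increment, and the mean of this factor is the moment that defines \<psi>. With nonnegative
  integrals Fubini applies without integrability conditions.\<close>

lemma laplace_transition:
  fixes f :: "real \<Rightarrow> ennreal"
  assumes lap: "laplace_exponent M X \<psi>" and "0 \<le> \<theta>" "0 \<le> s" and [measurable]: "f \<in> borel_measurable borel"
  shows "(\<integral>\<^sup>+x. ennreal (exp (- \<theta> * x)) * (\<integral>\<^sup>+z. f (x + (X s z - X 0 z)) \<partial>M) \<partial>lborel)
    = ennreal (exp (s * \<psi> \<theta>)) * (\<integral>\<^sup>+x. ennreal (exp (- \<theta> * x)) * f x \<partial>lborel)"
proof -
  interpret pair_sigma_finite lborel M ..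
  have [measurable]: "X s \<in> borel_measurable M" "X 0 \<in> borel_measurable M" using \<open>0 \<le> s\<close> by auto
  let ?Y = "\<lambda>z. X s z - X 0 z"
  let ?I = "\<integral>\<^sup>+x. ennreal (exp (- \<theta> * x)) * f x \<partial>lborel"
  have "(\<integral>\<^sup>+x. ennreal (exp (- \<theta> * x)) * (\<integral>\<^sup>+z. f (x + ?Y z) \<partial>M) \<partial>lborel)
      = (\<integral>\<^sup>+x. (\<integral>\<^sup>+z. ennreal (exp (- \<theta> * x)) * f (x + ?Y z) \<partial>M) \<partial>lborel)"
    by (intro nn_integral_cong nn_integral_cmult[symmetric]) measurable
  also have "\<dots> = (\<integral>\<^sup>+z. (\<integral>\<^sup>+x. ennreal (exp (- \<theta> * x)) * f (x + ?Y z) \<partial>lborel) \<partial>M)"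
    by (rule Fubini'[symmetric]) measurable
  also have "\<dots> = (\<integral>\<^sup>+z. ennreal (exp (\<theta> * ?Y z)) * ?I \<partial>M)"
  proof (intro nn_integral_cong)
    fix z
    have "(\<integral>\<^sup>+x. ennreal (exp (- \<theta> * x)) * f (x + ?Y z) \<partial>lborel)
        = (\<integral>\<^sup>+x. ennreal (exp (- \<theta> * (- ?Y z + 1 * x))) * f ((- ?Y z + 1 * x) + ?Y z) \<partial>lborel)"
      by (subst nn_integral_real_affine[where c=1 and t="- ?Y z"]) auto
    also have "\<dots> = (\<integral>\<^sup>+x. ennreal (exp (\<theta> * ?Y z)) * (ennreal (exp (- \<theta> * x)) * f x) \<partial>lborel)"
    proof (intro nn_integral_cong)
      fix x
      have "ennreal (exp (- \<theta> * (- ?Y z + 1 * x))) = ennreal (exp (\<theta> * ?Y z)) * ennreal (exp (- \<theta> * x))"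
        by (simp add: ennreal_mult[symmetric] exp_add[symmetric] algebra_simps)
      then show "ennreal (exp (- \<theta> * (- ?Y z + 1 * x))) * f ((- ?Y z + 1 * x) + ?Y z) = ennreal (exp (\<theta> * ?Y z)) * (ennreal (exp (- \<theta> * x)) * f x)"
        by (simp add: mult.assoc)
    qed
    finally show "(\<integral>\<^sup>+x. ennreal (exp (- \<theta> * x)) * f (x + ?Y z) \<partial>lborel) = ennreal (exp (\<theta> * ?Y z)) * ?I"
      by (simp add: nn_integral_cmult)
  qed
  also have "\<dots> = ennreal (exp (s * \<psi> \<theta>)) * ?I"
    by (subst nn_integral_multc) (simp_all add: increment_exp_moment[OF lap \<open>0 \<le> \<theta>\<close> \<open>0 \<le> s\<close>])
  finally show ?thesis .
qed

text \<open>Stochastic continuity at time 0, inherited from the right continuity of the paths by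
  dominated convergence.\<close>

lemma increment_small:
  assumes "0 < d" "0 < e"
  shows "\<forall>\<^sub>F s in at_right 0. measure M {z \<in> space M. d \<le> \<bar>X s z - X 0 z\<bar>} \<le> e"
proof -
  have "((\<lambda>s. measure M {z \<in> space M. d \<le> \<bar>X s z - X 0 z\<bar>}) \<longlongrightarrow> 0) (at_right 0)"
    unfolding tendsto_at_iff_sequentially comp_def
  proof (intro allI impI)
    fix s :: "nat \<Rightarrow> real" assume s: "\<forall>i. s i \<in> {0<..} - {0}" "s \<longlonglongrightarrow> 0"
    have [measurable]: "X (s i) \<in> borel_measurable M" "X 0 \<in> borel_measurable M" for i using s(1) by (auto simp: less_imp_le)
    have "\<forall>i. s i \<in> {0<..} \<and> s i \<noteq> 0" using s(1) by blast
    then have fl: "filterlim s (at_right 0) sequentially"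
      unfolding filterlim_at using s(2) by (simp add: always_eventually)
    have lim: "(\<lambda>i. X (s i) z) \<longlonglongrightarrow> X 0 z" if "z \<in> space M" for z
      by (rule filterlim_compose[OF cadlag_path_right[OF cadlag[OF that] order_refl] fl])
    have "(\<lambda>i. LINT z|M. indicator {z \<in> space M. d \<le> \<bar>X (s i) z - X 0 z\<bar>} z) \<longlonglongrightarrow> (LINT z|M. (0::real))"
    proof (rule integral_dominated_convergence[where w="\<lambda>_. 1"])
      show "AE z in M. (\<lambda>i. indicator {z \<in> space M. d \<le> \<bar>X (s i) z - X 0 z\<bar>} z) \<longlonglongrightarrow> (0::real)"
      proof (intro AE_I2)
        fix z assume z: "z \<in> space M"
        have "\<forall>\<^sub>F i in sequentially. \<bar>X (s i) z - X 0 z\<bar> < d"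
          using tendstoD[OF lim[OF z] \<open>0 < d\<close>] by (simp add: dist_real_def)
        then show "(\<lambda>i. indicator {z \<in> space M. d \<le> \<bar>X (s i) z - X 0 z\<bar>} z) \<longlonglongrightarrow> (0::real)"
          by (intro tendsto_eventually) (auto elim!: eventually_mono)
      qed
    qed (auto simp: indicator_def)
    then show "(\<lambda>i. measure M {z \<in> space M. d \<le> \<bar>X (s i) z - X 0 z\<bar>}) \<longlonglongrightarrow> 0" by simp
  qed
  from order_tendstoD(2)[OF this \<open>0 < e\<close>] show ?thesis by (auto elim: eventually_mono)
qed

lemma transition_integrable:
  assumes lap: "laplace_exponent M X \<psi>" and "0 \<le> \<theta>" "0 \<le> h" and [measurable]: "U \<in> borel_measurable borel"
    and U: "\<And>y. \<bar>U y\<bar> \<le> C * (1 + exp (\<theta> * y))"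
  shows "integrable M (\<lambda>z. C * (1 + exp (\<theta> * (y + (X h z - X 0 z)))))" and "integrable M (\<lambda>z. U (y + (X h z - X 0 z)))"
proof -
  have [measurable]: "X h \<in> borel_measurable M" "X 0 \<in> borel_measurable M" using \<open>0 \<le> h\<close> by auto
  have "integrable M (\<lambda>z. exp (\<theta> * (X h z - X 0 z)))"
    using increment_exp_moment[OF lap \<open>0 \<le> \<theta>\<close> \<open>0 \<le> h\<close>] by (intro integrableI_bounded) auto
  then have "integrable M (\<lambda>z. exp (\<theta> * y) * exp (\<theta> * (X h z - X 0 z)))" by simp
  then have "integrable M (\<lambda>z. exp (\<theta> * (y + (X h z - X 0 z))))" by (simp add: exp_add[symmetric] distrib_left)
  then show i: "integrable M (\<lambda>z. C * (1 + exp (\<theta> * (y + (X h z - X 0 z)))))" by simp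
  show "integrable M (\<lambda>z. U (y + (X h z - X 0 z)))"
  proof (rule Bochner_Integration.integrable_bound[OF i])
    show "AE z in M. norm (U (y + (X h z - X 0 z))) \<le> norm (C * (1 + exp (\<theta> * (y + (X h z - X 0 z)))))"
      using order_trans[OF U abs_ge_self] by (intro AE_I2) (simp only: real_norm_def)
  qed measurable
qed

text \<open>Continuity in the starting point is what turns statements for almost every point into
  statements for every point.\<close>

lemma transition_continuous:
  assumes lap: "laplace_exponent M X \<psi>" and "0 \<le> \<theta>" "0 \<le> h" and Ucont: "continuous_on UNIV U"
    and U: "\<And>y. \<bar>U y\<bar> \<le> C * (1 + exp (\<theta> * y))"
  shows "continuous_on UNIV (transition h U)"
  unfolding continuous_on_eq_continuous_at[OF open_UNIV]
proof (intro ballI)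
  fix y :: real
  have Um[measurable]: "U \<in> borel_measurable borel" using Ucont by (rule borel_measurable_continuous_onI)
  have [measurable]: "X h \<in> borel_measurable M" "X 0 \<in> borel_measurable M" using \<open>0 \<le> h\<close> by auto
  have C: "0 \<le> C" using U[of 0] by (simp add: abs_le_iff)
  show "isCont (transition h U) y"
    unfolding continuous_at_sequentially comp_def
  proof (intro allI impI)
    fix s :: "nat \<Rightarrow> real" assume s: "s \<longlonglongrightarrow> y"
    then obtain B where B: "\<And>n. s n \<le> B"
      by (metis Bseq_def abs_le_D1 convergentI convergent_imp_Bseq real_norm_def)
    show "(\<lambda>n. transition h U (s n)) \<longlonglongrightarrow> transition h U y" unfolding transition_def
    proof (rule integral_dominated_convergence[where w="\<lambda>z. C * (1 + exp (\<theta> * (B + (X h z - X 0 z))))"])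
      show "integrable M (\<lambda>z. C * (1 + exp (\<theta> * (B + (X h z - X 0 z)))))"
        by (rule transition_integrable(1)[OF lap \<open>0 \<le> \<theta>\<close> \<open>0 \<le> h\<close> Um U])
      show "AE z in M. (\<lambda>n. U (s n + (X h z - X 0 z))) \<longlonglongrightarrow> U (y + (X h z - X 0 z))"
        by (intro AE_I2 continuous_on_tendsto_compose[OF Ucont] tendsto_intros s) auto
      show "AE z in M. norm (U (s n + (X h z - X 0 z))) \<le> C * (1 + exp (\<theta> * (B + (X h z - X 0 z))))" for n
      proof (intro AE_I2)
        fix z
        have "C * (1 + exp (\<theta> * (s n + (X h z - X 0 z)))) \<le> C * (1 + exp (\<theta> * (B + (X h z - X 0 z))))"
          using B[of n] C \<open>0 \<le> \<theta>\<close> by (intro mult_left_mono) (auto intro!: mult_left_mono)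
        then show "norm (U (s n + (X h z - X 0 z))) \<le> C * (1 + exp (\<theta> * (B + (X h z - X 0 z))))"
          using U[of "s n + (X h z - X 0 z)"] by (simp only: real_norm_def)
      qed
    qed measurable
  qed
qed

end

section \<open>Dynkin's formula for convolutions\<close>

context levy_scale
begin

lemma laplace_conv:
  assumes g: "bounded_support \<alpha> \<beta> G g" and pos: "\<And>u. 0 \<le> g u" and "\<theta>0 < \<theta>"
  shows "(\<integral>\<^sup>+x. ennreal (exp (- \<theta> * x)) * ennreal (conv g x) \<partial>lborel) =
    (\<integral>\<^sup>+u. ennreal (exp (- \<theta> * u)) * ennreal (g u) \<partial>lborel) * ennreal (1 / \<psi> \<theta>)"
proof -
  note [measurable] = bounded_supportD(1)[OF g]
  have "(\<integral>\<^sup>+x. ennreal (exp (- \<theta> * x)) * ennreal (conv g x) \<partial>lborel)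
      = (\<integral>\<^sup>+x. (\<integral>\<^sup>+u. ennreal (exp (- \<theta> * x)) * ennreal (W (x - u) * g u) \<partial>lborel) \<partial>lborel)"
  proof (intro nn_integral_cong)
    fix x
    have "ennreal (conv g x) = (\<integral>\<^sup>+u. ennreal (W (x - u) * g u) \<partial>lborel)"
      unfolding conv_def using conv_bound(2)[OF g, of x] pos W_nonneg by (subst nn_integral_eq_integral) auto
    then show "ennreal (exp (- \<theta> * x)) * ennreal (conv g x) = (\<integral>\<^sup>+u. ennreal (exp (- \<theta> * x)) * ennreal (W (x - u) * g u) \<partial>lborel)"
      by (simp add: nn_integral_cmult)
  qed
  also have "\<dots> = (\<integral>\<^sup>+u. (\<integral>\<^sup>+x. ennreal (exp (- \<theta> * x)) * ennreal (W (x - u) * g u) \<partial>lborel) \<partial>lborel)"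
    by (rule lborel_pair.Fubini'[symmetric]) measurable
  also have "\<dots> = (\<integral>\<^sup>+u. (ennreal (exp (- \<theta> * u)) * ennreal (g u)) * ennreal (1 / \<psi> \<theta>) \<partial>lborel)"
  proof (intro nn_integral_cong)
    fix u
    have "(\<integral>\<^sup>+x. ennreal (exp (- \<theta> * x)) * ennreal (W (x - u) * g u) \<partial>lborel)
        = (\<integral>\<^sup>+x. ennreal (exp (- \<theta> * (u + 1 * x))) * ennreal (W ((u + 1 * x) - u) * g u) \<partial>lborel)"
      by (subst nn_integral_real_affine[where c=1 and t=u]) auto
    also have "\<dots> = (\<integral>\<^sup>+x. (ennreal (exp (- \<theta> * u)) * ennreal (g u)) * ennreal (exp (- \<theta> * x) * W x) \<partial>lborel)"
      by (intro nn_integral_cong) (simp add: ennreal_mult[symmetric] pos W_nonneg exp_add[symmetric] algebra_simps)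
    also have "\<dots> = (ennreal (exp (- \<theta> * u)) * ennreal (g u)) * ennreal (1 / \<psi> \<theta>)"
      unfolding W_laplace(1)[OF \<open>\<theta>0 < \<theta>\<close>, symmetric] by (rule nn_integral_cmult) measurable
    finally show "(\<integral>\<^sup>+x. ennreal (exp (- \<theta> * x)) * ennreal (W (x - u) * g u) \<partial>lborel)
        = (ennreal (exp (- \<theta> * u)) * ennreal (g u)) * ennreal (1 / \<psi> \<theta>)" .
  qed
  also have "\<dots> = (\<integral>\<^sup>+u. ennreal (exp (- \<theta> * u)) * ennreal (g u) \<partial>lborel) * ennreal (1 / \<psi> \<theta>)"
    by (rule nn_integral_multc) measurable
  finally show ?thesis .
qed

text \<open>The expected time integral of a nonnegative \<open>g\<close> along the process up to
  time \<open>h\<close>. The maximum serves joint measurability in time and sample point; the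
  indicator discards the negative times that it redirects to 0.\<close>

definition occupation :: "real \<Rightarrow> (real \<Rightarrow> real) \<Rightarrow> real \<Rightarrow> ennreal" where
  "occupation h g x = (\<integral>\<^sup>+s. (\<integral>\<^sup>+z. ennreal (g (x + (X (max 0 s) z - X 0 z))) \<partial>M) * indicator {0..h} s \<partial>lborel)"

(* Both sides have the same bilateral Laplace transform for all theta > theta0. *)
lemma transition_conv_AE:
  assumes g: "bounded_support \<alpha> \<beta> G g" and pos: "\<And>u. 0 \<le> g u" and "0 \<le> h"
  shows "AE x in lborel. (\<integral>\<^sup>+z. ennreal (conv g (x + (X h z - X 0 z))) \<partial>M) = ennreal (conv g x) + occupation h g x"
proof -
  note [measurable] = bounded_supportD(1)[OF g]
  have cm[measurable]: "conv g \<in> borel_measurable borel"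
    by (rule borel_measurable_continuous_onI[OF conv_continuous[OF g]])
  have [measurable]: "X h \<in> borel_measurable M" "X 0 \<in> borel_measurable M" using \<open>0 \<le> h\<close> by auto
  have Jm: "(\<lambda>p. g (fst (fst p) + (X (max 0 (snd (fst p))) (snd p) - X 0 (snd p)))) \<in> borel_measurable ((borel \<Otimes>\<^sub>M borel) \<Otimes>\<^sub>M M)"
  proof -
    have [measurable]: "(\<lambda>p. X (max 0 (snd (fst p))) (snd p)) \<in> borel_measurable (((borel :: real measure) \<Otimes>\<^sub>M borel) \<Otimes>\<^sub>M M)"
      by (rule X_joint_measurable) measurable
    show ?thesis by measurable
  qed
  have inner_m[measurable]: "(\<lambda>p. \<integral>\<^sup>+z. ennreal (g (fst p + (X (max 0 (snd p)) z - X 0 z))) \<partial>M) \<in> borel_measurable (borel \<Otimes>\<^sub>M borel)"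
    by (rule borel_measurable_nn_integral) (use Jm in \<open>simp add: case_prod_beta'\<close>)
  have inner_m'[measurable]: "(\<lambda>s. \<integral>\<^sup>+z. ennreal (g (x + (X (max 0 s) z - X 0 z))) \<partial>M) \<in> borel_measurable borel" for x
    using measurable_compose[OF measurable_Pair1' inner_m, of x] by simp
  have om[measurable]: "occupation h g \<in> borel_measurable borel"
    unfolding occupation_def[abs_def] by (rule lborel.borel_measurable_nn_integral) (simp add: case_prod_beta')
  define L where "L x = (\<integral>\<^sup>+z. ennreal (conv g (x + (X h z - X 0 z))) \<partial>M)" for x
  have Lm[measurable]: "L \<in> borel_measurable borel"
    unfolding L_def[abs_def] by (rule borel_measurable_nn_integral) measurable
  have "density lborel L = density lborel (\<lambda>x. ennreal (conv g x) + occupation h g x)"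
  proof (rule measure_eqI_Laplace[where ?\<theta>0.0=\<theta>0])
    fix \<theta> assume th: "\<theta>0 < \<theta>"
    then have th0: "0 \<le> \<theta>" by (simp add: \<theta>0_def)
    let ?g = "\<integral>\<^sup>+u. ennreal (exp (- \<theta> * u)) * ennreal (g u) \<partial>lborel"
    have p: "0 < \<psi> \<theta>" by (rule \<psi>_pos[OF th])
    have gfin: "?g < \<infinity>"
    proof -
      have "?g \<le> (\<integral>\<^sup>+u. ennreal (exp (\<theta> * \<bar>\<alpha>\<bar>) * G) * indicator {\<alpha>..\<beta>} u \<partial>lborel)"
      proof (intro nn_integral_mono)
        fix u show "ennreal (exp (- \<theta> * u)) * ennreal (g u) \<le> ennreal (exp (\<theta> * \<bar>\<alpha>\<bar>) * G) * indicator {\<alpha>..\<beta>} u"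
        proof (cases "u \<in> {\<alpha>..\<beta>}")
          case True
          have "- u \<le> \<bar>\<alpha>\<bar>" using True by auto
          then have "\<theta> * - u \<le> \<theta> * \<bar>\<alpha>\<bar>" using th0 by (intro mult_left_mono)
          then have "exp (- \<theta> * u) * g u \<le> exp (\<theta> * \<bar>\<alpha>\<bar>) * G"
            using bounded_supportD(2)[OF g, of u] pos[of u] by (intro mult_mono) auto
          then show ?thesis using True pos[of u] by (simp add: ennreal_mult[symmetric] ennreal_leI)
        qed (simp add: bounded_supportD(3)[OF g])
      qed
      also have "\<dots> < \<infinity>" by (subst nn_integral_cmult_indicator) (auto simp: emeasure_lborel_Icc_eq ennreal_mult_less_top)
      finally show ?thesis .
    qed
    have LL: "(\<integral>\<^sup>+y. ennreal (exp (- \<theta> * y)) \<partial>density lborel L) = ennreal (exp (h * \<psi> \<theta>)) * (?g * ennreal (1 / \<psi> \<theta>))"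
    proof -
      have "(\<integral>\<^sup>+y. ennreal (exp (- \<theta> * y)) \<partial>density lborel L) = (\<integral>\<^sup>+y. ennreal (exp (- \<theta> * y)) * L y \<partial>lborel)"
        by (subst nn_integral_density) (auto simp: mult.commute)
      also have "\<dots> = ennreal (exp (h * \<psi> \<theta>)) * (\<integral>\<^sup>+x. ennreal (exp (- \<theta> * x)) * ennreal (conv g x) \<partial>lborel)"
        unfolding L_def by (rule laplace_transition[OF lap th0 \<open>0 \<le> h\<close>]) measurable
      finally show ?thesis unfolding laplace_conv[OF g pos th] .
    qed
    have OO: "(\<integral>\<^sup>+x. ennreal (exp (- \<theta> * x)) * occupation h g x \<partial>lborel) = ennreal ((exp (h * \<psi> \<theta>) - 1) / \<psi> \<theta>) * ?g"
    proof -
      have "(\<integral>\<^sup>+x. ennreal (exp (- \<theta> * x)) * occupation h g x \<partial>lborel)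
        = (\<integral>\<^sup>+x. (\<integral>\<^sup>+s. ennreal (exp (- \<theta> * x)) * ((\<integral>\<^sup>+z. ennreal (g (x + (X (max 0 s) z - X 0 z))) \<partial>M) * indicator {0..h} s) \<partial>lborel) \<partial>lborel)"
        unfolding occupation_def by (intro nn_integral_cong nn_integral_cmult[symmetric]) measurable
      also have "\<dots> = (\<integral>\<^sup>+s. (\<integral>\<^sup>+x. ennreal (exp (- \<theta> * x)) * ((\<integral>\<^sup>+z. ennreal (g (x + (X (max 0 s) z - X 0 z))) \<partial>M) * indicator {0..h} s) \<partial>lborel) \<partial>lborel)"
        by (rule lborel_pair.Fubini'[symmetric]) (simp add: case_prod_beta')
      also have "\<dots> = (\<integral>\<^sup>+s. (ennreal (exp (s * \<psi> \<theta>)) * indicator {0..h} s) * ?g \<partial>lborel)"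
      proof (intro nn_integral_cong)
        fix s :: real
        show "(\<integral>\<^sup>+x. ennreal (exp (- \<theta> * x)) * ((\<integral>\<^sup>+z. ennreal (g (x + (X (max 0 s) z - X 0 z))) \<partial>M) * indicator {0..h} s) \<partial>lborel)
          = (ennreal (exp (s * \<psi> \<theta>)) * indicator {0..h} s) * ?g"
        proof (cases "s \<in> {0..h}")
          case True
          then show ?thesis using laplace_transition[OF lap th0, of s "\<lambda>x. ennreal (g x)"] by (simp add: max_def)
        qed simp
      qed
      also have "\<dots> = (\<integral>\<^sup>+s. ennreal (exp (s * \<psi> \<theta>)) * indicator {0..h} s \<partial>lborel) * ?g"
        by (rule nn_integral_multc) measurable
      also have "(\<integral>\<^sup>+s. ennreal (exp (s * \<psi> \<theta>)) * indicator {0..h} s \<partial>lborel) = ennreal (exp (h * \<psi> \<theta>) / \<psi> \<theta> - exp (0 * \<psi> \<theta>) / \<psi> \<theta>)"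
        using \<open>0 \<le> h\<close> p by (intro nn_integral_FTC_Icc) (auto intro!: derivative_eq_intros)
      finally show ?thesis by (simp add: diff_divide_distrib)
    qed
    have "(\<integral>\<^sup>+y. ennreal (exp (- \<theta> * y)) \<partial>density lborel (\<lambda>x. ennreal (conv g x) + occupation h g x))
       = (\<integral>\<^sup>+y. ennreal (exp (- \<theta> * y)) * ennreal (conv g y) + ennreal (exp (- \<theta> * y)) * occupation h g y \<partial>lborel)"
      by (subst nn_integral_density) (auto simp: mult.commute distrib_left)
    also have "\<dots> = (\<integral>\<^sup>+y. ennreal (exp (- \<theta> * y)) * ennreal (conv g y) \<partial>lborel) + (\<integral>\<^sup>+y. ennreal (exp (- \<theta> * y)) * occupation h g y \<partial>lborel)"
      by (rule nn_integral_add) measurable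
    also have "\<dots> = ?g * ennreal (1 / \<psi> \<theta>) + ennreal ((exp (h * \<psi> \<theta>) - 1) / \<psi> \<theta>) * ?g"
      unfolding laplace_conv[OF g pos th] OO ..
    also have "\<dots> = ?g * ennreal (1 / \<psi> \<theta> + (exp (h * \<psi> \<theta>) - 1) / \<psi> \<theta>)"
      using p \<open>0 \<le> h\<close> by (subst ennreal_plus) (auto simp: distrib_left mult.commute)
    \<comment> \<open>On the Laplace side Dynkin's formula is this elementary identity, the quotient
      being the integral of exp(s \<psi>) over [0, h].\<close>
    also have "1 / \<psi> \<theta> + (exp (h * \<psi> \<theta>) - 1) / \<psi> \<theta> = exp (h * \<psi> \<theta>) * (1 / \<psi> \<theta>)" using p by (simp add: field_simps)
    also have "ennreal (exp (h * \<psi> \<theta>) * (1 / \<psi> \<theta>)) = ennreal (exp (h * \<psi> \<theta>)) * ennreal (1 / \<psi> \<theta>)" using p by (intro ennreal_mult) auto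
    finally show "(\<integral>\<^sup>+y. ennreal (exp (- \<theta> * y)) \<partial>density lborel L) = (\<integral>\<^sup>+y. ennreal (exp (- \<theta> * y)) \<partial>density lborel (\<lambda>x. ennreal (conv g x) + occupation h g x))"
      unfolding LL by (simp add: ac_simps)
    show "(\<integral>\<^sup>+y. ennreal (exp (- \<theta> * y)) \<partial>density lborel L) < \<infinity>"
      unfolding LL using gfin by (simp add: ennreal_mult_less_top)
  qed auto
  then have "AE x in lborel. L x = ennreal (conv g x) + occupation h g x"
    by (subst (asm) sigma_finite_measure.density_unique_iff[OF sigma_finite_lborel]) auto
  then show ?thesis by (simp add: L_def)
qed

lemma conv_bound1:
  assumes "bounded_support \<alpha> \<beta> G g"
  obtains C where "\<And>y. \<bar>conv g y\<bar> \<le> C * (1 + exp ((\<theta>0 + 1) * y))"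
proof -
  obtain C where C: "0 \<le> C" "\<And>y. \<bar>conv g y\<bar> \<le> C * exp ((\<theta>0 + 1) * y)"
    using conv_exp_bound[OF assms, of "\<theta>0 + 1"] by auto
  have "\<bar>conv g y\<bar> \<le> C * (1 + exp ((\<theta>0 + 1) * y))" for y
    using C(2)[of y] C(1) by (simp add: distrib_left)
  then show ?thesis by (rule that)
qed

lemma \<theta>0_add1: "0 \<le> \<theta>0 + 1" "\<theta>0 < \<theta>0 + 1" by (simp_all add: \<theta>0_def)

lemma transition_conv_nn:
  assumes g: "bounded_support \<alpha> \<beta> G g" and pos: "\<And>u. 0 \<le> g u" and "0 \<le> h"
  shows "AE x in lborel. ennreal (transition h (conv g) x) = ennreal (conv g x) + occupation h g x"
proof -
  obtain C where C: "\<And>y. \<bar>conv g y\<bar> \<le> C * (1 + exp ((\<theta>0 + 1) * y))" using conv_bound1[OF g] by blast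
  have cm: "conv g \<in> borel_measurable borel"
    by (rule borel_measurable_continuous_onI[OF conv_continuous[OF g]])
  have c0: "0 \<le> conv g y" for y unfolding conv_def
    by (intro Bochner_Integration.integral_nonneg) (simp add: W_nonneg pos)
  have "(\<integral>\<^sup>+z. ennreal (conv g (x + (X h z - X 0 z))) \<partial>M) = ennreal (transition h (conv g) x)" for x
    unfolding transition_def
    by (rule nn_integral_eq_integral[OF transition_integrable(2)[OF lap \<theta>0_add1(1) \<open>0 \<le> h\<close> cm C]]) (simp add: c0)
  then show ?thesis using transition_conv_AE[OF g pos \<open>0 \<le> h\<close>] by simp
qed

text \<open>The occupation term is nonnegative, and a closed set of full Lebesgue measure is the
  whole line. The density may be discontinuous, as the bumps used later are.\<close>

lemma transition_conv_ge:
  assumes g: "bounded_support \<alpha> \<beta> G g" and pos: "\<And>u. 0 \<le> g u" and "0 \<le> h"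
  shows "conv g y \<le> transition h (conv g) y"
proof -
  obtain C where C: "\<And>y. \<bar>conv g y\<bar> \<le> C * (1 + exp ((\<theta>0 + 1) * y))" using conv_bound1[OF g] by blast
  have ct: "continuous_on UNIV (transition h (conv g))"
    by (rule transition_continuous[OF lap \<theta>0_add1(1) \<open>0 \<le> h\<close> conv_continuous[OF g] C])
  have t0: "0 \<le> transition h (conv g) y" for y unfolding transition_def conv_def
    by (intro Bochner_Integration.integral_nonneg) (simp add: W_nonneg pos)
  have "closed {y. conv g y \<le> transition h (conv g) y}"
    by (intro closed_Collect_le conv_continuous[OF g] ct)
  moreover have "AE x in lborel. x \<in> {y. conv g y \<le> transition h (conv g) y}"
    using transition_conv_nn[OF assms]
  proof eventually_elim
    case (elim x)
    then have "ennreal (conv g x) \<le> ennreal (transition h (conv g) x)" by simp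
    then show ?case using t0 by (simp add: ennreal_le_iff)
  qed
  then have "AE x in lebesgue. x \<in> {y. conv g y \<le> transition h (conv g) y}" by (rule AE_completion)
  ultimately have "y \<in> {y. conv g y \<le> transition h (conv g) y}" by (rule mem_closed_if_AE_lebesgue)
  then show ?thesis by simp
qed

text \<open>Over a short time the occupation of \<open>g\<close> is close to \<open>h * g y\<close>:
  the process rarely moves by \<open>d\<close> or more, which costs at most \<open>G\<close> times a
  small probability, and otherwise \<open>g\<close> hardly changes. The hypothesis \<open>uc\<close>
  compares with all points \<open>u\<close>, also those outside the interval, because the process
  may step out of it.\<close>

lemma transition_conv_generator_nonneg:
  assumes g: "bounded_support \<alpha> \<beta> G g" and pos: "\<And>u. 0 \<le> g u" and "l < c"
    and uc: "\<And>e. 0 < e \<Longrightarrow> \<exists>d>0. \<forall>y\<in>{l..c}. \<forall>u. \<bar>u - y\<bar> < d \<longrightarrow> \<bar>g u - g y\<bar> \<le> e"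
    and "0 < e"
  shows "\<forall>\<^sub>F h in at_right 0. \<forall>y\<in>{l..c}. \<bar>transition h (conv g) y - conv g y - h * g y\<bar> \<le> h * e"
proof -
  note [measurable] = bounded_supportD(1)[OF g]
  note G = bounded_supportD(2,5)[OF g]
  obtain d where d: "0 < d" "\<And>y u. y \<in> {l..c} \<Longrightarrow> \<bar>u - y\<bar> < d \<Longrightarrow> \<bar>g u - g y\<bar> \<le> e / 2"
    using uc[of "e / 2"] \<open>0 < e\<close> by auto
  define p where "p s = measure M {z \<in> space M. d \<le> \<bar>X s z - X 0 z\<bar>}" for s
  have "\<forall>\<^sub>F s in at_right 0. p s \<le> e / (2 * (G + 1))"
    unfolding p_def using \<open>0 < e\<close> G(2) by (intro increment_small d) auto
  then obtain b where b: "0 < b" "\<And>s. 0 < s \<Longrightarrow> s < b \<Longrightarrow> p s \<le> e / (2 * (G + 1))"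
    by (auto simp: eventually_at_right_field)
  have p0: "p 0 = 0" unfolding p_def using d(1) by simp
  have Gp: "G * p s \<le> e / 2" if "0 \<le> s" "s < b" for s
  proof (cases "s = 0")
    case True then show ?thesis using p0 \<open>0 < e\<close> by simp
  next
    case False
    then have "G * p s \<le> G * (e / (2 * (G + 1)))" using b(2)[of s] that G(2) by (intro mult_left_mono) auto
    also have "\<dots> \<le> e / 2" using G(2) \<open>0 < e\<close> by (simp add: field_simps)
    finally show ?thesis .
  qed
  have inner: "(\<integral>\<^sup>+z. ennreal (g (y + (X s z - X 0 z))) \<partial>M) \<le> ennreal (g y + e) \<and>
      ennreal (g y - e) \<le> (\<integral>\<^sup>+z. ennreal (g (y + (X s z - X 0 z))) \<partial>M)"
    if s: "0 \<le> s" "s < b" and y: "y \<in> {l..c}" for s y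
  proof -
    have [measurable]: "X s \<in> borel_measurable M" "X 0 \<in> borel_measurable M" using s by auto
    let ?g = "\<lambda>z. g (y + (X s z - X 0 z))"
    have i: "integrable M ?g" by (rule integrable_const_bound[of _ G]) (use G in auto)
    have "\<bar>expectation ?g - g y\<bar> = \<bar>expectation (\<lambda>z. ?g z - g y)\<bar>" using i by (simp add: prob_space)
    also have "\<dots> \<le> expectation (\<lambda>z. \<bar>?g z - g y\<bar>)" by (rule integral_abs_bound)
    also have "\<dots> \<le> expectation (\<lambda>z. e / 2 + G * indicator {z \<in> space M. d \<le> \<bar>X s z - X 0 z\<bar>} z)"
    proof (rule integral_mono)
      show "integrable M (\<lambda>z. e / 2 + G * indicator {z \<in> space M. d \<le> \<bar>X s z - X 0 z\<bar>} z)"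
        by (intro Bochner_Integration.integrable_add integrable_mult_right integrable_real_indicator) (auto simp: less_top[symmetric])
      fix z assume z: "z \<in> space M"
      show "\<bar>?g z - g y\<bar> \<le> e / 2 + G * indicator {z \<in> space M. d \<le> \<bar>X s z - X 0 z\<bar>} z"
      proof (cases "d \<le> \<bar>X s z - X 0 z\<bar>")
        case True
        have "\<bar>?g z - g y\<bar> \<le> G" using G(1)[of "y + (X s z - X 0 z)"] G(1)[of y] pos[of "y + (X s z - X 0 z)"] pos[of y] by linarith
        then show ?thesis using True z \<open>0 < e\<close> by simp
      next
        case False then show ?thesis using d(2)[OF y, of "y + (X s z - X 0 z)"] by simp
      qed
    qed (use i in simp)
    also have "\<dots> = e / 2 + G * p s"
      by (subst Bochner_Integration.integral_add) (auto simp: p_def prob_space less_top[symmetric] intro!: integrable_real_indicator)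
    also have "\<dots> \<le> e" using Gp[OF s] by simp
    finally have "g y - e \<le> expectation ?g" "expectation ?g \<le> g y + e" by linarith+
    moreover have "(\<integral>\<^sup>+z. ennreal (?g z) \<partial>M) = ennreal (expectation ?g)"
      by (rule nn_integral_eq_integral[OF i]) (simp add: pos)
    ultimately show ?thesis by (simp add: ennreal_leI)
  qed
  obtain C where C: "\<And>y. \<bar>conv g y\<bar> \<le> C * (1 + exp ((\<theta>0 + 1) * y))" using conv_bound1[OF g] by blast
  have gc: "continuous_on {l..c} g"
    unfolding continuous_on_iff
  proof (intro ballI allI impI)
    fix y e' :: real assume "y \<in> {l..c}" "0 < e'"
    then obtain d' where "0 < d'" "\<forall>y\<in>{l..c}. \<forall>u. \<bar>u - y\<bar> < d' \<longrightarrow> \<bar>g u - g y\<bar> \<le> e' / 2" using uc[of "e' / 2"] by auto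
    then show "\<exists>d>0. \<forall>x'\<in>{l..c}. dist x' y < d \<longrightarrow> dist (g x') (g y) < e'"
      using \<open>y \<in> {l..c}\<close> \<open>0 < e'\<close> by (intro exI[of _ d']) (fastforce simp: dist_real_def)
  qed
  have main: "\<forall>y\<in>{l..c}. \<bar>transition h (conv g) y - conv g y - h * g y\<bar> \<le> h * e" if h: "0 < h" "h < b" for h
  proof
    fix y assume y: "y \<in> {l..c}"
    let ?\<phi> = "\<lambda>y. transition h (conv g) y - conv g y - h * g y"
    define S where "S = {y \<in> {l..c}. \<bar>?\<phi> y\<bar> \<le> h * e}"
    have "continuous_on {l..c} (\<lambda>y. \<bar>?\<phi> y\<bar>)"
      by (intro continuous_intros gc continuous_on_subset[OF conv_continuous[OF g]]
          continuous_on_subset[OF transition_continuous[OF lap \<theta>0_add1(1) less_imp_le[OF h(1)] conv_continuous[OF g] C]]) auto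
    then have "closed ({l..c} \<inter> (\<lambda>y. \<bar>?\<phi> y\<bar>) -` {..h * e})"
      by (intro continuous_closed_preimage) auto
    moreover have "{l..c} \<inter> (\<lambda>y. \<bar>?\<phi> y\<bar>) -` {..h * e} = S" by (auto simp: S_def)
    ultimately have "closed S" by simp
    have AE1: "AE y in lborel. y \<in> {l<..<c} \<longrightarrow> y \<in> S"
      using transition_conv_nn[OF g pos less_imp_le[OF h(1)]]
    proof eventually_elim
      case (elim y)
      show ?case
      proof
        assume "y \<in> {l<..<c}"
        then have y: "y \<in> {l..c}" by auto
        have "occupation h g y \<le> (\<integral>\<^sup>+s. ennreal (g y + e) * indicator {0..h} s \<partial>lborel)"
          unfolding occupation_def using inner[OF _ _ y] h(2)
          by (intro nn_integral_mono) (auto simp: indicator_def max_def)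
        also have "\<dots> = ennreal (h * (g y + e))"
          using h pos[of y] \<open>0 < e\<close> by (subst nn_integral_cmult_indicator) (auto simp: ennreal_mult[symmetric] mult.commute simp del: ennreal_plus)
        finally have up: "occupation h g y \<le> ennreal (h * (g y + e))" .
        have "ennreal (h * (g y - e)) = (\<integral>\<^sup>+s. ennreal (g y - e) * indicator {0..h} s \<partial>lborel)"
          using h by (subst nn_integral_cmult_indicator) (auto simp: ennreal_mult' mult.commute)
        also have "\<dots> \<le> occupation h g y"
          unfolding occupation_def using inner[OF _ _ y] h(2)
          by (intro nn_integral_mono) (auto simp: indicator_def max_def)
        finally have low: "ennreal (h * (g y - e)) \<le> occupation h g y" .
        have c0: "0 \<le> conv g y" unfolding conv_def
          by (intro Bochner_Integration.integral_nonneg) (simp add: W_nonneg pos)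
        have he: "0 \<le> h * (g y + e)" using h pos[of y] \<open>0 < e\<close> by simp
        have "ennreal (transition h (conv g) y) \<le> ennreal (conv g y) + ennreal (h * (g y + e))" unfolding elim by (intro add_left_mono up)
        also have "\<dots> = ennreal (conv g y + h * (g y + e))" by (rule ennreal_plus[symmetric, OF c0 he])
        finally have 1: "transition h (conv g) y \<le> conv g y + h * (g y + e)"
          by (subst (asm) ennreal_le_iff[OF add_nonneg_nonneg[OF c0 he]])
        have 2: "conv g y + h * (g y - e) \<le> transition h (conv g) y"
        \<comment> \<open>A negative lower bound would be cut off at 0 by \<open>ennreal\<close>; in
          that case \<open>transition_conv_ge\<close> is already stronger.\<close>
        proof (cases "0 \<le> h * (g y - e)")
          case True
          have "ennreal (conv g y + h * (g y - e)) = ennreal (conv g y) + ennreal (h * (g y - e))" by (rule ennreal_plus[OF c0 True])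
          also have "\<dots> \<le> ennreal (transition h (conv g) y)" unfolding elim by (intro add_left_mono low)
          finally show ?thesis using transition_conv_ge[OF g pos less_imp_le[OF h(1)], of y] c0 by (simp add: ennreal_le_iff)
        next
          case False then show ?thesis using transition_conv_ge[OF g pos less_imp_le[OF h(1)], of y] by simp
        qed
        show "y \<in> S" using 1 2 y unfolding S_def by (auto simp: abs_le_iff algebra_simps)
      qed
    qed
    then have "AE y \<in> {l<..<c} in lebesgue. y \<in> S" by (rule AE_completion)
    then have "{l<..<c} \<subseteq> S"
      using mem_closed_if_AE_lebesgue_open[OF open_greaterThanLessThan \<open>closed S\<close>] by blast
    \<comment> \<open>The almost-everywhere argument reaches open sets only; the end points follow
      from closedness, since [l, c] is the closure of its interior.\<close>
    then have "closure {l<..<c} \<subseteq> S" using \<open>closed S\<close> by (rule closure_minimal)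
    then have "y \<in> S" using y \<open>l < c\<close> by (simp add: closure_greaterThanLessThan subset_iff)
    then show "\<bar>?\<phi> y\<bar> \<le> h * e" by (simp add: S_def)
  qed
  then show ?thesis using b(1) by (auto simp: eventually_at_right_field)
qed

lemma conv_diff:
  assumes "bounded_support \<alpha> \<beta> G g" "bounded_support \<alpha>' \<beta>' G' g'"
  shows "conv (\<lambda>u. g u - g' u) y = conv g y - conv g' y"
  unfolding conv_def using conv_bound(2)[OF assms(1), of y] conv_bound(2)[OF assms(2), of y]
  by (simp add: right_diff_distrib)

text \<open>Positive and negative part are 1-Lipschitz functions of \<open>g\<close>, so they
  inherit its uniform continuity, and all three terms are linear in the density.\<close>

lemma transition_conv_generator:
  assumes g: "bounded_support \<alpha> \<beta> G g" and "l < c"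
    and uc: "\<And>e. 0 < e \<Longrightarrow> \<exists>d>0. \<forall>y\<in>{l..c}. \<forall>u. \<bar>u - y\<bar> < d \<longrightarrow> \<bar>g u - g y\<bar> \<le> e"
    and "0 < e"
  shows "\<forall>\<^sub>F h in at_right 0. \<forall>y\<in>{l..c}. \<bar>transition h (conv g) y - conv g y - h * g y\<bar> \<le> h * e"
proof -
  note [measurable] = bounded_supportD(1)[OF g]
  define gp where "gp u = max 0 (g u)" for u
  define gn where "gn u = max 0 (- g u)" for u
  have bs: "bounded_support \<alpha> \<beta> G gp" "bounded_support \<alpha> \<beta> G gn"
    using bounded_supportD[OF g] unfolding bounded_support_def gp_def gn_def
    by (auto simp: max_def abs_le_iff)
  have uc': "\<exists>d>0. \<forall>y\<in>{l..c}. \<forall>u. \<bar>u - y\<bar> < d \<longrightarrow> \<bar>gp u - gp y\<bar> \<le> e"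
    "\<exists>d>0. \<forall>y\<in>{l..c}. \<forall>u. \<bar>u - y\<bar> < d \<longrightarrow> \<bar>gn u - gn y\<bar> \<le> e" if pe: "0 < e" for e
  proof -
    have *: "\<bar>gp u - gp y\<bar> \<le> \<bar>g u - g y\<bar>" "\<bar>gn u - gn y\<bar> \<le> \<bar>g u - g y\<bar>" for u y by (auto simp: gp_def gn_def)
    obtain d where "0 < d" "\<forall>y\<in>{l..c}. \<forall>u. \<bar>u - y\<bar> < d \<longrightarrow> \<bar>g u - g y\<bar> \<le> e" using uc[OF pe] by blast
    then show "\<exists>d>0. \<forall>y\<in>{l..c}. \<forall>u. \<bar>u - y\<bar> < d \<longrightarrow> \<bar>gp u - gp y\<bar> \<le> e"
      "\<exists>d>0. \<forall>y\<in>{l..c}. \<forall>u. \<bar>u - y\<bar> < d \<longrightarrow> \<bar>gn u - gn y\<bar> \<le> e"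
      using * by (meson order_trans)+
  qed
  have split: "g = (\<lambda>u. gp u - gn u)" by (auto simp: gp_def gn_def fun_eq_iff)
  have cs: "conv g y = conv gp y - conv gn y" for y
    using conv_diff[OF bs, of y] split by simp
  obtain Cp where Cp: "\<And>y. \<bar>conv gp y\<bar> \<le> Cp * (1 + exp ((\<theta>0 + 1) * y))" using conv_bound1[OF bs(1)] by blast
  obtain Cn where Cn: "\<And>y. \<bar>conv gn y\<bar> \<le> Cn * (1 + exp ((\<theta>0 + 1) * y))" using conv_bound1[OF bs(2)] by blast
  have ts: "transition h (conv g) y = transition h (conv gp) y - transition h (conv gn) y" if "0 \<le> h" for h y
    unfolding transition_def cs
    using transition_integrable(2)[OF lap \<theta>0_add1(1) that borel_measurable_continuous_onI[OF conv_continuous[OF bs(1)]] Cp, of y]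
      transition_integrable(2)[OF lap \<theta>0_add1(1) that borel_measurable_continuous_onI[OF conv_continuous[OF bs(2)]] Cn, of y]
    by simp
  have "\<forall>\<^sub>F h in at_right 0. \<forall>y\<in>{l..c}. \<bar>transition h (conv gp) y - conv gp y - h * gp y\<bar> \<le> h * (e / 2)"
    using \<open>0 < e\<close> by (intro transition_conv_generator_nonneg[OF bs(1) _ \<open>l < c\<close> uc'(1)]) (auto simp: gp_def)
  moreover have "\<forall>\<^sub>F h in at_right 0. \<forall>y\<in>{l..c}. \<bar>transition h (conv gn) y - conv gn y - h * gn y\<bar> \<le> h * (e / 2)"
    using \<open>0 < e\<close> by (intro transition_conv_generator_nonneg[OF bs(2) _ \<open>l < c\<close> uc'(2)]) (auto simp: gn_def)
  moreover have "\<forall>\<^sub>F h in at_right (0::real). 0 < h" by (simp add: eventually_at_filter)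
  ultimately show ?thesis
  proof eventually_elim
    case (elim h)
    show ?case
    proof
      fix y assume y: "y \<in> {l..c}"
      have "g y = gp y - gn y" using split by metis
      then have "transition h (conv g) y - conv g y - h * g y =
        (transition h (conv gp) y - conv gp y - h * gp y) - (transition h (conv gn) y - conv gn y - h * gn y)"
        using ts[of h y] cs[of y] elim(3) by (simp only: right_diff_distrib less_imp_le)
      then show "\<bar>transition h (conv g) y - conv g y - h * g y\<bar> \<le> h * e"
        using elim(1)[rule_format, OF y] elim(2)[rule_format, OF y] unfolding abs_le_iff by linarith
    qed
  qed
qed

end

section \<open>Exit from an interval\<close>

text \<open>The counterpart of \<open>exit_time\<close> without the cap at a horizon; the infimum is
  meaningful only for paths that do leave the interval.\<close>

definition exit_inf :: "real \<Rightarrow> real \<Rightarrow> (real \<Rightarrow> real) \<Rightarrow> real" where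
  "exit_inf l c f = Inf {s. 0 \<le> s \<and> f s \<notin> {l..c}}"

definition no_up_jump :: "(real \<Rightarrow> real) \<Rightarrow> bool" where
  "no_up_jump f \<longleftrightarrow> (\<forall>t>0. \<forall>L. (f \<longlongrightarrow> L) (at_left t) \<longrightarrow> f t \<le> L)"

lemma exit_inf_le: "0 \<le> s \<Longrightarrow> f s \<notin> {l..c} \<Longrightarrow> exit_inf l c f \<le> s"
  unfolding exit_inf_def by (intro cInf_lower bdd_belowI[of _ 0]) auto

lemma exit_inf_nonneg: "0 \<le> s \<Longrightarrow> f s \<notin> {l..c} \<Longrightarrow> 0 \<le> exit_inf l c f"
  unfolding exit_inf_def by (intro cInf_greatest) auto

lemma exit_inf_ge: "0 \<le> s0 \<Longrightarrow> f s0 \<notin> {l..c} \<Longrightarrow> (\<And>s. 0 \<le> s \<Longrightarrow> s < b \<Longrightarrow> f s \<in> {l..c}) \<Longrightarrow> b \<le> exit_inf l c f"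
  unfolding exit_inf_def by (intro cInf_greatest) (auto simp del: atLeastAtMost_iff simp: not_less[symmetric])

lemma before_exit_inf: "0 \<le> s \<Longrightarrow> s < exit_inf l c f \<Longrightarrow> f s \<in> {l..c}"
  using exit_inf_le[of s f l c] by (cases "f s \<in> {l..c}") auto

lemma exit_time_eq_exit_inf:
  assumes "0 \<le> s" "f s \<notin> {l..c}" "s \<le> t"
  shows "exit_time l c f t = exit_inf l c f"
proof (rule antisym)
  have t: "0 \<le> t" using assms by simp
  show "exit_time l c f t \<le> exit_inf l c f"
  proof (rule exit_inf_ge[where f=f, OF assms(1,2)])
    fix r assume "0 \<le> r" "r < exit_time l c f t"
    then show "f r \<in> {l..c}" using before_exit_time t by blast
  qed
  show "exit_inf l c f \<le> exit_time l c f t"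
    unfolding exit_time_def
  proof (rule cInf_greatest)
    fix r assume "r \<in> insert t {s. 0 \<le> s \<and> s \<le> t \<and> f s \<notin> {l..c}}"
    then show "exit_inf l c f \<le> r"
      using exit_inf_le[of r f l c] exit_inf_le[where f=f, OF assms(1,2)] assms(3) by auto
  qed auto
qed

lemma exit_time_eq_self: "0 \<le> t \<Longrightarrow> (\<And>s. 0 \<le> s \<Longrightarrow> f s \<in> {l..c}) \<Longrightarrow> exit_time l c f t = t"
proof -
  assume t: "0 \<le> t" and "\<And>s. 0 \<le> s \<Longrightarrow> f s \<in> {l..c}"
  then have e: "{s. 0 \<le> s \<and> s \<le> t \<and> f s \<notin> {l..c}} = {}" by blast
  show ?thesis unfolding exit_time_def e by simp
qed

text \<open>From a point of the open interval right continuity would keep the path inside for a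
  while longer. The end points cannot be excluded, since the infimum need not be attained.\<close>

lemma exit_inf_outside:
  assumes f: "cadlag_path f" and s0: "0 \<le> s0" "f s0 \<notin> {l..c}"
  shows "f (exit_inf l c f) \<le> l \<or> c \<le> f (exit_inf l c f)"
proof (rule ccontr)
  let ?T = "exit_inf l c f"
  assume "\<not> (f ?T \<le> l \<or> c \<le> f ?T)"
  then have "f ?T \<in> {l<..<c}" by auto
  have T0: "0 \<le> ?T" by (rule exit_inf_nonneg[where f=f, OF s0])
  have "\<forall>\<^sub>F s in at_right ?T. f s \<in> {l<..<c}"
    using topological_tendstoD[OF cadlag_path_right[OF f T0] _ \<open>f ?T \<in> {l<..<c}\<close>] by auto
  then obtain b where b: "?T < b" "\<And>s. ?T < s \<Longrightarrow> s < b \<Longrightarrow> f s \<in> {l<..<c}"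
    by (auto simp: eventually_at_right_field)
  have "b \<le> ?T"
  proof (rule exit_inf_ge[where f=f, OF s0])
    fix s assume "0 \<le> s" "s < b"
    then show "f s \<in> {l..c}"
      using b(2)[of s] \<open>f ?T \<in> {l<..<c}\<close> before_exit_inf[of s l c f] by (cases s ?T rule: linorder_cases) auto
  qed
  then show False using b(1) by simp
qed

text \<open>Before the exit the path is at most \<open>c\<close>, hence so is its left limit at the
  exit time, and the path cannot jump up from there.\<close>

lemma exit_time_pos_le:
  assumes f: "cadlag_path f" and "no_up_jump f" "f 0 \<le> c" "0 \<le> t"
  shows "f (exit_time l c f t) \<le> c"
proof (cases "exit_time l c f t = 0")
  case True then show ?thesis using assms by simp
next
  case False
  let ?T = "exit_time l c f t"
  have T: "0 < ?T" using False exit_time_nonneg[OF \<open>0 \<le> t\<close>, of l c f] by simp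
  then obtain L where L: "(f \<longlongrightarrow> L) (at_left ?T)" using f unfolding cadlag_path_def by blast
  have "L \<le> c"
  proof (rule tendsto_upperbound[OF L])
    show "\<forall>\<^sub>F s in at_left ?T. f s \<le> c"
      using T before_exit_time[of _ l c f t] \<open>0 \<le> t\<close> unfolding eventually_at_left_field
      by (intro exI[of _ 0]) auto
  qed simp
  moreover have "f ?T \<le> L" using assms(2) T L unfolding no_up_jump_def by blast
  ultimately show ?thesis by simp
qed

lemma exp_quadratic_upper:
  fixes u :: real
  assumes "\<bar>u\<bar> \<le> 1"
  shows "exp u \<le> 1 + u + u\<^sup>2"
proof (cases "0 \<le> u")
  case True then show ?thesis using exp_bound[of u] assms by auto
next
  case False
  have p: "0 < 1 - u" using False by simp
  have "1 - u \<le> exp (- u)" using exp_ge_add_one_self[of "- u"] by simp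
  then have "exp u \<le> 1 / (1 - u)" using p by (simp add: exp_minus field_simps)
  also have "\<dots> \<le> 1 + u + u\<^sup>2"
  proof -
    have "(1 + u + u\<^sup>2) * (1 - u) = 1 - u ^ 3" by (simp add: power2_eq_square power3_eq_cube algebra_simps)
    moreover have "u ^ 3 \<le> 0" using False by (simp add: power_le_zero_eq)
    ultimately show ?thesis using p by (simp add: divide_le_eq)
  qed
  finally show ?thesis .
qed

text \<open>Expanding the exponential, exp(-h k) (U + h g) equals U + h (g - k U) up to order h
  squared, and the bound \<open>b\<close> makes the remainder uniform over \<open>S\<close>. One
  half of the slack \<open>e - \<eta>\<close> pays for the error of the generator estimate, the
  other half for the remainder.\<close>

lemma discounted_generator_lower:
  fixes P :: "real \<Rightarrow> real \<Rightarrow> real"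
  assumes gen: "\<And>e. 0 < e \<Longrightarrow> \<forall>\<^sub>F h in at_right 0. \<forall>y\<in>S. U y + h * (g y - e) \<le> P h y"
    and bd: "\<And>y. y \<in> S \<Longrightarrow> \<bar>U y\<bar> \<le> b \<and> \<bar>g y\<bar> \<le> b \<and> \<bar>k y\<bar> \<le> b"
    and low: "\<And>y. y \<in> S \<Longrightarrow> - \<eta> \<le> g y - k y * U y" and "\<eta> < e"
  shows "\<forall>\<^sub>F h in at_right (0::real). \<forall>y\<in>S. U y - h * e \<le> exp (- h * k y) * P h y"
proof (cases "S = {}")
  case False
  then have b0: "0 \<le> b" using bd by fastforce
  define e' where "e' = min 1 ((e - \<eta>) / 2)"
  have e': "0 < e'" "e' \<le> 1" "e' \<le> (e - \<eta>) / 2" using \<open>\<eta> < e\<close> unfolding e'_def by (auto simp only: min_less_iff_conj intro: min.cobounded1 min.cobounded2) simp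
  \<comment> \<open>The two second-order terms, divided by h squared: the product of |u| \<le> h b
    and |h (g y - e')| \<le> h (b + 1), and the square of u times |V| \<le> 2 b + 1. The cap of
    \<open>e'\<close> at 1 keeps these bounds free of \<open>e\<close>.\<close>
  define R where "R = b * (b + 1) + b\<^sup>2 * (2 * b + 1)"
  have R0: "0 \<le> R" using b0 by (simp add: R_def)
  define h0 where "h0 = min 1 (min (1 / (b + 1)) ((e - \<eta>) / (2 * (R + 1))))"
  have h0: "0 < h0" using b0 R0 \<open>\<eta> < e\<close> by (auto simp: h0_def)
  have "\<forall>\<^sub>F h in at_right 0. h \<in> {0<..<h0}" using h0 by (auto simp: eventually_at_right_field)
  with gen[OF e'(1)] show ?thesis
  proof eventually_elim
    case (elim h)
    have h: "0 < h" "h \<le> 1" "h * (b + 1) \<le> 1" "h * R \<le> (e - \<eta>) / 2"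
    proof -
      show "0 < h" "h \<le> 1" using elim(2) by (auto simp: h0_def)
      have "h \<le> 1 / (b + 1)" using elim(2) by (auto simp: h0_def)
      then show "h * (b + 1) \<le> 1" using b0 by (simp add: field_simps)
      have "h \<le> (e - \<eta>) / (2 * (R + 1))" using elim(2) by (auto simp: h0_def)
      then have "h * (R + 1) \<le> (e - \<eta>) / 2" using R0 by (simp add: field_simps)
      then show "h * R \<le> (e - \<eta>) / 2" using \<open>0 < h\<close> by (simp add: distrib_left)
    qed
    show ?case
    proof
      fix y assume y: "y \<in> S"
      define u where "u = - h * k y"
      define V where "V = U y + h * (g y - e')"
      note B = bd[OF y]
      have "\<bar>u\<bar> \<le> h * b" using B h(1) by (simp add: u_def abs_mult)
      also have "\<dots> \<le> 1" using h(1,3) by (simp add: distrib_left)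
      finally have u1: "\<bar>u\<bar> \<le> 1" .
      have ub: "\<bar>u\<bar> \<le> h * b" by fact
      have gb: "\<bar>h * (g y - e')\<bar> \<le> h * (b + 1)"
        unfolding abs_mult using h B e' by (intro mult_mono) auto
      also have "\<dots> \<le> b + 1" using h b0 by simp
      finally have Vb: "\<bar>V\<bar> \<le> 2 * b + 1" using B unfolding V_def by linarith
      have u2: "u\<^sup>2 \<le> (h * b)\<^sup>2" using ub by (metis abs_ge_zero power2_abs power_mono)
      \<comment> \<open>The sign of \<open>V\<close> is unknown: the linear lower bound of the
        exponential serves \<open>V\<close> \<ge> 0, the quadratic upper bound serves
        \<open>V\<close> < 0.\<close>
      have "(1 + u) * V - u\<^sup>2 * \<bar>V\<bar> \<le> exp u * V"
      proof (cases "0 \<le> V")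
        case True
        have "(1 + u) * V \<le> exp u * V" using True by (intro mult_right_mono exp_ge_add_one_self)
        moreover have "0 \<le> u\<^sup>2 * \<bar>V\<bar>" by simp
        ultimately show ?thesis by linarith
      next
        case False
        have "exp u * - V \<le> (1 + u + u\<^sup>2) * - V" using False exp_quadratic_upper[OF u1] by (intro mult_right_mono) auto
        then show ?thesis using False by (simp add: algebra_simps)
      qed
      moreover have "u\<^sup>2 * \<bar>V\<bar> \<le> (h * b)\<^sup>2 * (2 * b + 1)" using u2 Vb b0 h by (intro mult_mono) auto
      moreover have "(1 + u) * V = U y + h * (g y - k y * U y) - h * e' + u * (h * (g y - e'))"
        by (simp add: u_def V_def algebra_simps)
      moreover have "\<bar>u * (h * (g y - e'))\<bar> \<le> (h * b) * (h * (b + 1))"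
        unfolding abs_mult[of u] using h b0 by (intro mult_mono ub gb) auto
      moreover have "h * - \<eta> \<le> h * (g y - k y * U y)" using low[OF y] h by (intro mult_left_mono) auto
      moreover have "h * e' \<le> h * ((e - \<eta>) / 2)" using e' h by (intro mult_left_mono) auto
      moreover have "h * (h * R) \<le> h * ((e - \<eta>) / 2)" using h by (intro mult_left_mono) auto
      moreover have "(h * b) * (h * (b + 1)) + (h * b)\<^sup>2 * (2 * b + 1) = h * (h * R)"
        by (simp add: R_def power2_eq_square algebra_simps)
      moreover have "exp u * V \<le> exp u * P h y" using elim(1) y unfolding V_def by (intro mult_left_mono) auto
      moreover have "h * ((e - \<eta>) / 2) + h * ((e - \<eta>) / 2) = h * e - h * \<eta>" by (simp add: field_simps)
      moreover have "h * - \<eta> = - (h * \<eta>)" by simp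
      ultimately show "U y - h * e \<le> exp (- h * k y) * P h y"
        unfolding u_def[symmetric] by linarith
    qed
  qed
qed simp

text \<open>The complement of the interval is open, so by right continuity an exit lasts long enough
  to meet a rational time. This makes the exit event measurable.\<close>

lemma exits_rational:
  assumes f: "cadlag_path f"
  shows "(\<exists>s\<ge>0. f s \<notin> {l..c}) \<longleftrightarrow> (\<exists>q\<in>{q\<in>\<rat>. 0 \<le> q}. f q \<notin> {l..c})"
proof
  assume "\<exists>s\<ge>0. f s \<notin> {l..c}"
  then obtain s where s: "0 \<le> s" "f s \<in> - {l..c}" by blast
  have "\<forall>\<^sub>F v in at_right s. f v \<in> - {l..c}"
    using topological_tendstoD[OF cadlag_path_right[OF f s(1)] _ s(2)] by auto
  then obtain b where b: "s < b" "\<And>v. s < v \<Longrightarrow> v < b \<Longrightarrow> f v \<in> - {l..c}"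
    by (auto simp: eventually_at_right_field)
  obtain q where "q \<in> \<rat>" "s < q" "q < b" using Rats_dense_in_real[OF b(1)] by blast
  then show "\<exists>q\<in>{q\<in>\<rat>. 0 \<le> q}. f q \<notin> {l..c}" using b(2)[of q] s(1) by (intro bexI[of _ q]) auto
qed auto

section \<open>Exit without a time horizon\<close>

context levy_process
begin

abbreviation path :: "real \<Rightarrow> 'a \<Rightarrow> real \<Rightarrow> real" where
  "path x z \<equiv> (\<lambda>s. x + (X s z - X 0 z))"

definition exits :: "real \<Rightarrow> real \<Rightarrow> real \<Rightarrow> 'a \<Rightarrow> bool" where
  "exits l c x z \<longleftrightarrow> (\<exists>s\<ge>0. path x z s \<notin> {l..c})"

(* On a path that never exits, the infimum of the exit times is a junk time; the default value 0
   keeps the functions measurable. *)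
definition exit_pos :: "real \<Rightarrow> real \<Rightarrow> real \<Rightarrow> 'a \<Rightarrow> real" where
  "exit_pos l c x z = (if exits l c x z then path x z (exit_inf l c (path x z)) else 0)"

definition exit_disc :: "(real \<Rightarrow> real) \<Rightarrow> real \<Rightarrow> real \<Rightarrow> real \<Rightarrow> 'a \<Rightarrow> real" where
  "exit_disc k l c x z = (if exits l c x z
     then exp (- (LINT s:{0..exit_inf l c (path x z)}|lborel. k (path x z s))) else 0)"

lemma exits_sets[measurable]: "{z \<in> space M. exits l c x z} \<in> sets M"
proof -
  have iff: "exits l c x z \<longleftrightarrow> (\<exists>q\<in>{q\<in>\<rat>. 0 \<le> q}. path x z q \<notin> {l..c})" if "z \<in> space M" for z
    unfolding exits_def by (rule exits_rational[OF cadlag_shift[OF that]])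
  have "{z \<in> space M. exits l c x z} = (\<Union>q\<in>{q\<in>\<rat>. 0 \<le> q}. {z \<in> space M. path x z q \<notin> {l..c}})"
    using iff by blast
  also have "\<dots> \<in> sets M"
    by (intro sets.countable_UN' countable_subset[OF _ countable_rat]) auto
  finally show ?thesis .
qed

text \<open>As soon as the horizon passes some time spent outside, capping has no effect.
  Measurability and limits of the uncapped quantities are thereby inherited from the capped
  ones.\<close>

lemma stopped_eventually:
  assumes "exits l c x z"
  shows "\<forall>\<^sub>F n in sequentially. stopped_pos l c x (real n) z = exit_pos l c x z"
    and "\<forall>\<^sub>F n in sequentially. discount k l c x (real n) z = exit_disc k l c x z"
proof -
  obtain s where s: "0 \<le> s" "path x z s \<notin> {l..c}" using assms unfolding exits_def by blast
  obtain N where N: "s \<le> real N" using real_arch_simple by blast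
  have e: "stopped_time l c x (real n) z = exit_inf l c (path x z)" if "n \<ge> N" for n
    unfolding stopped_time_def using N that by (intro exit_time_eq_exit_inf[where f="path x z", OF s]) simp
  show "\<forall>\<^sub>F n in sequentially. stopped_pos l c x (real n) z = exit_pos l c x z"
    using eventually_ge_at_top[of N] by eventually_elim (simp add: stopped_pos_def e exit_pos_def assms)
  show "\<forall>\<^sub>F n in sequentially. discount k l c x (real n) z = exit_disc k l c x z"
    using eventually_ge_at_top[of N] by eventually_elim (simp add: discount_def e exit_disc_def assms)
qed

lemma exit_measurable:
  assumes k: "continuous_on UNIV k"
  shows "exit_pos l c x \<in> borel_measurable M" and "exit_disc k l c x \<in> borel_measurable M"
proof -
  let ?I = "\<lambda>z. indicator {z \<in> space M. exits l c x z} z :: real"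
  have [measurable]: "stopped_pos l c x (real (Suc n)) \<in> borel_measurable M" "discount k l c x (real (Suc n)) \<in> borel_measurable M" for n
    using stopped_measurable[OF _ k] by auto
  have "(\<lambda>n. ?I z * stopped_pos l c x (real (Suc n)) z) \<longlonglongrightarrow> exit_pos l c x z" if "z \<in> space M" for z
  proof (cases "exits l c x z")
    case True
    have "\<forall>\<^sub>F n in sequentially. ?I z * stopped_pos l c x (real (Suc n)) z = exit_pos l c x z"
      using eventually_compose_filterlim[OF stopped_eventually(1)[OF True] filterlim_Suc]
      by eventually_elim (use True that in simp)
    then show ?thesis by (rule tendsto_eventually)
  qed (simp add: exit_pos_def)
  then show "exit_pos l c x \<in> borel_measurable M" by (rule borel_measurable_LIMSEQ_real) measurable
  have "(\<lambda>n. ?I z * discount k l c x (real (Suc n)) z) \<longlonglongrightarrow> exit_disc k l c x z" if "z \<in> space M" for z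
  proof (cases "exits l c x z")
    case True
    have "\<forall>\<^sub>F n in sequentially. ?I z * discount k l c x (real (Suc n)) z = exit_disc k l c x z"
      using eventually_compose_filterlim[OF stopped_eventually(2)[OF True, of k] filterlim_Suc]
      by eventually_elim (use True that in simp)
    then show ?thesis by (rule tendsto_eventually)
  qed (simp add: exit_disc_def)
  then show "exit_disc k l c x \<in> borel_measurable M" by (rule borel_measurable_LIMSEQ_real) measurable
qed

lemma discount_le_1: "(\<And>y. 0 \<le> k y) \<Longrightarrow> discount k l c x t z \<le> 1"
  unfolding discount_def set_lebesgue_integral_def
  by (simp add: Bochner_Integration.integral_nonneg)

lemma exit_disc_le_1: "(\<And>y. 0 \<le> k y) \<Longrightarrow> exit_disc k l c x z \<le> 1"
  unfolding exit_disc_def set_lebesgue_integral_def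
  by (simp add: Bochner_Integration.integral_nonneg)

lemma discount_pos: "0 < discount k l c x t z" and exit_disc_nonneg: "0 \<le> exit_disc k l c x z"
  by (auto simp: discount_def exit_disc_def)

lemma stopped_pos_le:
  assumes "z \<in> space M" "no_up_jump (path x z)" "x \<le> c" "0 \<le> t"
  shows "stopped_pos l c x t z \<le> c"
  using exit_time_pos_le[OF cadlag_shift[OF assms(1)] assms(2), of c t l] assms(3,4)
  unfolding stopped_pos_def stopped_time_def by simp

lemma exit_pos_le:
  assumes "z \<in> space M" "no_up_jump (path x z)" "x \<le> c" "exits l c x z"
  shows "exit_pos l c x z \<le> c"
proof -
  obtain n where "stopped_pos l c x (real n) z = exit_pos l c x z"
    using stopped_eventually(1)[OF assms(4)] by (auto simp: eventually_sequentially)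
  then show ?thesis using stopped_pos_le[OF assms(1-3), of "real n" l] by simp
qed

lemma exit_pos_cases:
  assumes "z \<in> space M" "exits l c x z"
  shows "exit_pos l c x z \<le> l \<or> c \<le> exit_pos l c x z"
  using assms(2) exit_inf_outside[OF cadlag_shift[OF assms(1)], of _ x l c] unfolding exit_pos_def exits_def by auto

end

context spectrally_negative_levy
begin

lemma AE_no_up_jump: "AE z in M. no_up_jump (path x z)"
  using no_positive_jumps
proof eventually_elim
  case (elim z)
  show ?case unfolding no_up_jump_def
  proof (intro allI impI)
    fix t L :: real assume t: "0 < t" and L: "(path x z \<longlongrightarrow> L) (at_left t)"
    have "((\<lambda>s. path x z s - x + X 0 z) \<longlongrightarrow> L - x + X 0 z) (at_left t)" using L by (intro tendsto_intros)
    then have "((\<lambda>s. X s z) \<longlongrightarrow> L - x + X 0 z) (at_left t)" by simp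
    then have "X t z \<le> L - x + X 0 z" using elim t by blast
    then show "path x z t \<le> L" by simp
  qed
qed

end

context levy_scale
begin

lemma conv_mono:
  assumes g: "bounded_support \<alpha> \<beta> G g" and pos: "\<And>u. 0 \<le> g u" and "y \<le> y'"
  shows "0 \<le> conv g y" "conv g y \<le> conv g y'"
proof -
  show "0 \<le> conv g y" unfolding conv_def
    by (intro Bochner_Integration.integral_nonneg) (simp add: W_nonneg pos)
  show "conv g y \<le> conv g y'" unfolding conv_def
    using \<open>y \<le> y'\<close> by (intro integral_mono conv_bound(2)[OF g] mult_right_mono W_mono_UNIV pos) auto
qed

lemma transition_add_const:
  assumes "0 \<le> h" and U: "continuous_on UNIV U" "\<And>y. \<bar>U y\<bar> \<le> C * (1 + exp ((\<theta>0 + 1) * y))"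
  shows "transition h (\<lambda>y. a + U y) y = a + transition h U y"
  unfolding transition_def
  using transition_integrable(2)[OF lap \<theta>0_add1(1) \<open>0 \<le> h\<close> borel_measurable_continuous_onI[OF U(1)] U(2), of y]
  by (simp add: prob_space)

(* The function B - W * 1 has generator -1 on [l, c], so that it stays superharmonic for the negative
   killing rate -1/B; this bounds an exponential moment of the exit time. *)
lemma AE_exits:
  assumes "l < c" "x \<in> {l..c}"
  shows "AE z in M. exits l c x z"
proof -
  \<comment> \<open>Constant 1 up to distance 1 around [l, c], so that the uniform continuity
    demanded by the generator estimate is trivial with distance 1.\<close>
  define g :: "real \<Rightarrow> real" where "g = indicator {l-1..c+1}"
  have g: "bounded_support (l - 1) (c + 1) 1 g" and gpos: "\<And>u. 0 \<le> g u"
    using \<open>l < c\<close> by (auto simp: bounded_support_def g_def indicator_def)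
  obtain C where C: "\<And>y. \<bar>conv g y\<bar> \<le> C * (1 + exp ((\<theta>0 + 1) * y))" using conv_bound1[OF g] by blast
  \<comment> \<open>Twice the largest value of the convolution up to \<open>c\<close> makes
    \<open>U\<close> \<le> -B / 2 there. With the rate -1 / B the quantity g - k U becomes
    \<open>conv g y / B\<close> on the interval, which is nonnegative.\<close>
  define B where "B = 2 * conv g c + 1"
  have B1: "1 \<le> B" using conv_mono(1)[OF g gpos order_refl] by (simp add: B_def)
  define U where "U y = - B + conv g y" for y
  have Uc: "continuous_on UNIV U" unfolding U_def by (intro continuous_intros conv_continuous[OF g])
  have Ub: "\<bar>U y\<bar> \<le> (C + B) * (1 + exp ((\<theta>0 + 1) * y))" for y
  proof -
    have "B \<le> B * (1 + exp ((\<theta>0 + 1) * y))" using B1 by simp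
    then show ?thesis using C[of y] B1 unfolding U_def by (simp only: distrib_right)
  qed
  have Uneg: "U y \<le> - B / 2" if "y \<le> c" for y
    using conv_mono(2)[OF g gpos that] by (simp add: U_def B_def)
  have gen: "\<forall>\<^sub>F h in at_right 0. \<forall>y\<in>{l..c}. U y - h * e \<le> exp (- h * (- 1 / B)) * transition h U y" if "0 < e" for e
  proof (rule discounted_generator_lower[where g=g and \<eta>=0 and b="B + 1" and k="\<lambda>_. - 1 / B"])
    show "\<forall>\<^sub>F h in at_right 0. \<forall>y\<in>{l..c}. U y + h * (g y - e) \<le> transition h U y" if "0 < e" for e
    proof -
      have "\<exists>d>0. \<forall>y\<in>{l..c}. \<forall>u. \<bar>u - y\<bar> < d \<longrightarrow> \<bar>g u - g y\<bar> \<le> e'" if "0 < e'" for e'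
        using that by (intro exI[of _ 1]) (auto simp: g_def indicator_def)
      from transition_conv_generator[OF g \<open>l < c\<close> this \<open>0 < e\<close>]
      have "\<forall>\<^sub>F h in at_right 0. \<forall>y\<in>{l..c}. \<bar>transition h (conv g) y - conv g y - h * g y\<bar> \<le> h * e" by blast
      moreover have "\<forall>\<^sub>F h in at_right (0::real). 0 < h" by (simp add: eventually_at_filter)
      ultimately show ?thesis
      proof eventually_elim
        case (elim h)
        have "transition h U y = - B + transition h (conv g) y" for y
          unfolding U_def[abs_def] using elim(2) by (intro transition_add_const[OF _ conv_continuous[OF g] C]) simp
        then show ?case using elim(1) by (auto simp: U_def abs_le_iff right_diff_distrib)
      qed
    qed
    fix y assume y: "y \<in> {l..c}"
    have cg: "0 \<le> conv g y" "conv g y \<le> conv g c" using conv_mono[OF g gpos, of y c] y by auto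
    have "1 / B \<le> B" using B1 mult_mono[of 1 B 1 B] by (simp add: divide_le_eq)
    then show "\<bar>U y\<bar> \<le> B + 1 \<and> \<bar>g y\<bar> \<le> B + 1 \<and> \<bar>- 1 / B\<bar> \<le> B + 1"
      using cg B1 y by (auto simp: U_def B_def g_def indicator_def abs_le_iff)
    show "- 0 \<le> g y - (- 1 / B) * U y" using cg B1 y by (simp add: U_def g_def indicator_def diff_divide_distrib add_divide_distrib)
  qed (use that in auto)
  let ?N = "{z \<in> space M. \<not> exits l c x z}"
  have N[measurable]: "?N \<in> sets M" by measurable
  \<comment> \<open>A path that never exits carries the weight \<open>exp (t / B)\<close> at time
    \<open>t\<close> and contributes at most \<open>- (exp (t / B) * (B / 2))\<close>, any other
    path at most 0. Since the expectation is at least -B, such paths have exponentially small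
    probability.\<close>
  have bound: "prob ?N \<le> 2 * exp (- t / B)" if t: "0 < t" for t
  proof -
    let ?k = "\<lambda>_::real. - 1 / B"
    note st = stopping_lower[OF lap \<theta>0_add1(1) Uc Ub, where k="?k" and \<kappa>="1 / B" and t=t and \<eta>=0 and l=l and c=c and x=x]
    have "- B \<le> U x" using conv_mono(1)[OF g gpos order_refl] by (simp add: U_def)
    also have "\<dots> \<le> expectation (\<lambda>z. discount ?k l c x t z * U (stopped_pos l c x t z))"
      using st(2) t B1 gen by simp
    also have "\<dots> \<le> expectation (\<lambda>z. - (exp (t / B) * (B / 2)) * indicator ?N z)"
    proof (rule integral_mono_AE)
      show "integrable M (\<lambda>z. discount ?k l c x t z * U (stopped_pos l c x t z))"
        using st(1) t B1 gen by simp
      show "integrable M (\<lambda>z. - (exp (t / B) * (B / 2)) * indicator ?N z)"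
        by (intro integrable_mult_right integrable_real_indicator) (auto simp: less_top[symmetric])
      show "AE z in M. discount ?k l c x t z * U (stopped_pos l c x t z) \<le> - (exp (t / B) * (B / 2)) * indicator ?N z"
        using AE_no_up_jump[of x] AE_space
      proof eventually_elim
        case (elim z)
        have u: "U (stopped_pos l c x t z) \<le> - B / 2"
          using elim t assms by (intro Uneg stopped_pos_le) auto
        show ?case
        proof (cases "exits l c x z")
          case True
          have "discount ?k l c x t z * U (stopped_pos l c x t z) \<le> 0"
            using u B1 discount_pos[of ?k l c x t z] by (intro mult_nonneg_nonpos) auto
          then show ?thesis using True by simp
        next
          case False
          then have "stopped_time l c x t z = t"
            unfolding stopped_time_def exits_def using t by (intro exit_time_eq_self) auto
          then have d: "discount ?k l c x t z = exp (t / B)"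
            unfolding discount_def using t by (simp add: set_lebesgue_integral_def)
          have "exp (t / B) * U (stopped_pos l c x t z) \<le> exp (t / B) * (- B / 2)" using u by (intro mult_left_mono) auto
          then show ?thesis using False elim d by simp
        qed
      qed
    qed
    also have "\<dots> = - (exp (t / B) * (B / 2)) * prob ?N" by simp
    finally have "exp (t / B) * (B / 2) * prob ?N \<le> B" by simp
    then have "exp (- t / B) * (exp (t / B) * (B / 2 * prob ?N)) \<le> exp (- t / B) * B" by (intro mult_left_mono) (auto simp: mult.assoc)
    moreover have "exp (- t / B) * (exp (t / B) * (B / 2 * prob ?N)) = B / 2 * prob ?N"
      by (simp only: mult.assoc[symmetric] exp_add[symmetric]) simp
    ultimately have "B / 2 * prob ?N \<le> exp (- t / B) * B" by (simp only:)
    then have "B * (prob ?N / 2) \<le> B * exp (- t / B)" by (simp add: mult.commute)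
    then show ?thesis using B1 by simp
  qed
  have "((\<lambda>t. 2 * exp (- t / B)) \<longlongrightarrow> 0) at_top"
    using B1 by real_asymp
  then have "prob ?N \<le> 0"
    by (rule tendsto_lowerbound) (use bound in \<open>auto simp: eventually_at_top_linorder intro!: exI[of _ 1]\<close>)
  then have "prob ?N = 0" using measure_nonneg[of M ?N] by linarith
  then show ?thesis by (subst (asm) prob_Collect_eq_0) auto
qed

end

section \<open>Exit identities for omega-scale functions\<close>

context levy_scale
begin

lemma stopped_value_AE_le:
  assumes "x \<le> c" "0 \<le> t" and k: "\<And>y. 0 \<le> k y" and H: "\<And>y. y \<le> c \<Longrightarrow> \<bar>H y\<bar> \<le> B"
  shows "AE z in M. norm (discount k l c x t z * H (stopped_pos l c x t z)) \<le> B"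
  using AE_no_up_jump[of x] AE_space
proof eventually_elim
  case (elim z)
  have B0: "0 \<le> B" using H[of c] by fastforce
  have "\<bar>discount k l c x t z\<bar> * \<bar>H (stopped_pos l c x t z)\<bar> \<le> 1 * B"
    using discount_pos[of k l c x t z] discount_le_1[of k l c x t z] k B0 elim assms
    by (intro mult_mono H stopped_pos_le) auto
  then show ?case by (simp add: abs_mult)
qed

lemma exit_limit:
  assumes "l < c" "x \<in> {l..c}" and k: "continuous_on UNIV k" "\<And>y. 0 \<le> k y"
    and [measurable]: "H \<in> borel_measurable borel" and H: "\<And>y. y \<le> c \<Longrightarrow> \<bar>H y\<bar> \<le> B"
  shows "(\<lambda>n. expectation (\<lambda>z. discount k l c x (real (Suc n)) z * H (stopped_pos l c x (real (Suc n)) z)))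
      \<longlonglongrightarrow> expectation (\<lambda>z. exit_disc k l c x z * H (exit_pos l c x z))"
proof (rule integral_dominated_convergence[where w="\<lambda>_. B"])
  have [measurable]: "stopped_pos l c x (real (Suc n)) \<in> borel_measurable M" "discount k l c x (real (Suc n)) \<in> borel_measurable M" for n
    using stopped_measurable[OF _ k(1)] by auto
  have [measurable]: "exit_pos l c x \<in> borel_measurable M" "exit_disc k l c x \<in> borel_measurable M"
    using exit_measurable[OF k(1)] by auto
  show "(\<lambda>z. discount k l c x (real (Suc n)) z * H (stopped_pos l c x (real (Suc n)) z)) \<in> borel_measurable M" for n
    by measurable
  show "(\<lambda>z. exit_disc k l c x z * H (exit_pos l c x z)) \<in> borel_measurable M" by measurable
  show "AE z in M. norm (discount k l c x (real (Suc n)) z * H (stopped_pos l c x (real (Suc n)) z)) \<le> B" for n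
    using assms by (intro stopped_value_AE_le) auto
  show "AE z in M. (\<lambda>n. discount k l c x (real (Suc n)) z * H (stopped_pos l c x (real (Suc n)) z)) \<longlonglongrightarrow> exit_disc k l c x z * H (exit_pos l c x z)"
    using AE_exits[OF assms(1,2)]
  proof eventually_elim
    case (elim z)
    show ?case
      by (rule tendsto_eventually)
        (use eventually_compose_filterlim[OF stopped_eventually(1)[OF elim] filterlim_Suc]
          eventually_compose_filterlim[OF stopped_eventually(2)[OF elim, of k] filterlim_Suc] in \<open>eventually_elim, simp\<close>)
  qed
qed simp

lemma exit_lower:
  assumes "l < c" "x \<in> {l..c}" and k: "continuous_on UNIV k" "\<And>y. 0 \<le> k y"
    and Ucont: "continuous_on UNIV U" and U: "\<And>y. \<bar>U y\<bar> \<le> C * (1 + exp ((\<theta>0 + 1) * y))"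
    and gen: "\<And>e. 0 < e \<Longrightarrow> \<forall>\<^sub>F h in at_right 0. \<forall>y\<in>{l..c}. U y - h * e \<le> exp (- h * k y) * transition h U y"
    and B: "\<And>y. y \<le> c \<Longrightarrow> \<bar>U y\<bar> \<le> B"
  shows "U x \<le> expectation (\<lambda>z. exit_disc k l c x z * U (exit_pos l c x z))"
proof (rule LIMSEQ_le_const[OF exit_limit[where H=U, OF assms(1,2) k borel_measurable_continuous_onI[OF Ucont] B]], simp)
  have "U x - 0 * real (Suc n) * exp (0 * real (Suc n)) \<le> expectation (\<lambda>z. discount k l c x (real (Suc n)) z * U (stopped_pos l c x (real (Suc n)) z))" for n
    using k gen by (intro stopping_lower(2)[OF lap \<theta>0_add1(1) Ucont U k(1)]) auto
  then show "\<exists>N. \<forall>n\<ge>N. U x \<le> expectation (\<lambda>z. discount k l c x (real (Suc n)) z * U (stopped_pos l c x (real (Suc n)) z))"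
    by simp
qed

lemma transition_uminus: "transition h (\<lambda>y. - U y) y = - transition h U y"
  by (simp add: transition_def)

text \<open>\<open>H\<close> need not be continuous, so it is reached through functions
  \<open>U m\<close> whose generator \<open>g m\<close> agrees with the rate times
  \<open>U m\<close> up to a vanishing error. Optional stopping for \<open>U m\<close> and for its
  negative gives both inequalities. The order of limits matters: the error at horizon
  \<open>t\<close> is \<open>e * t\<close>, so \<open>m\<close> tends to infinity at fixed
  \<open>t\<close>, and only afterwards the horizon does.\<close>

lemma exit_identity_limit:
  fixes U g :: "nat \<Rightarrow> real \<Rightarrow> real"
  assumes lc: "l < c" "x \<in> {l..c}" and k: "continuous_on UNIV k" "\<And>y. 0 \<le> k y"
    and Ucont: "\<And>m. continuous_on UNIV (U m)" and Uexp: "\<And>m. \<exists>C. \<forall>y. \<bar>U m y\<bar> \<le> C * (1 + exp ((\<theta>0 + 1) * y))"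
    and gen: "\<And>m e. 0 < e \<Longrightarrow> \<forall>\<^sub>F h in at_right 0. \<forall>y\<in>{l..c}. \<bar>transition h (U m) y - U m y - h * g m y\<bar> \<le> h * e"
    and gb: "\<And>m. \<exists>b. \<forall>y\<in>{l..c}. \<bar>g m y\<bar> \<le> b"
    and err: "\<And>e. 0 < e \<Longrightarrow> \<forall>\<^sub>F m in sequentially. \<forall>y\<in>{l..c}. \<bar>g m y - k y * U m y\<bar> \<le> e"
    and B: "\<And>m y. y \<le> c \<Longrightarrow> \<bar>U m y\<bar> \<le> B"
    and lim: "\<And>y. y \<le> c \<Longrightarrow> (\<lambda>m. U m y) \<longlonglongrightarrow> H y" and Hm[measurable]: "H \<in> borel_measurable borel"
  shows "H x = expectation (\<lambda>z. exit_disc k l c x z * H (exit_pos l c x z))"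
proof -
  have HB: "\<bar>H y\<bar> \<le> B" if "y \<le> c" for y
    by (rule LIMSEQ_le_const2[OF tendsto_rabs[OF lim[OF that]]]) (use B[OF that] in auto)
  have "bounded (k ` {l..c})"
    by (intro compact_imp_bounded compact_continuous_image continuous_on_subset[OF k(1)]) auto
  then obtain kb where "\<forall>v\<in>k ` {l..c}. norm v \<le> kb" unfolding bounded_iff by blast
  then have kb: "\<And>y. y \<in> {l..c} \<Longrightarrow> \<bar>k y\<bar> \<le> kb" by auto
  have fin: "H x = expectation (\<lambda>z. discount k l c x t z * H (stopped_pos l c x t z))" if t: "0 < t" for t
  proof -
    let ?E = "\<lambda>m. expectation (\<lambda>z. discount k l c x t z * U m (stopped_pos l c x t z))"
    have [measurable]: "stopped_pos l c x t \<in> borel_measurable M" "discount k l c x t \<in> borel_measurable M"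
      using stopped_measurable[OF t k(1)] by auto
    have [measurable]: "U m \<in> borel_measurable borel" for m by (rule borel_measurable_continuous_onI[OF Ucont])
    have close: "\<bar>?E m - U m x\<bar> \<le> e * t" if e: "0 < e" and m: "\<forall>y\<in>{l..c}. \<bar>g m y - k y * U m y\<bar> \<le> e" for e m
    proof -
      obtain b where b: "\<And>y. y \<in> {l..c} \<Longrightarrow> \<bar>g m y\<bar> \<le> b" using gb by blast
      obtain C where C: "\<And>y. \<bar>U m y\<bar> \<le> C * (1 + exp ((\<theta>0 + 1) * y))" using Uexp by blast
      let ?b = "max b (max B kb)"
      have bd: "\<bar>U m y\<bar> \<le> ?b \<and> \<bar>g m y\<bar> \<le> ?b \<and> \<bar>k y\<bar> \<le> ?b" if "y \<in> {l..c}" for y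
        using b[OF that] kb[OF that] B[of y m] that by auto
      have g1: "\<forall>\<^sub>F h in at_right 0. \<forall>y\<in>{l..c}. U m y - h * e' \<le> exp (- h * k y) * transition h (U m) y" if e': "e < e'" for e'
      proof (rule discounted_generator_lower[where g="g m" and b="?b" and \<eta>=e])
        show "\<forall>\<^sub>F h in at_right 0. \<forall>y\<in>{l..c}. U m y + h * (g m y - d) \<le> transition h (U m) y" if "0 < d" for d
          using gen[OF that, of m] by eventually_elim (auto simp: abs_le_iff right_diff_distrib)
        show "- e \<le> g m y - k y * U m y" if "y \<in> {l..c}" for y using m[rule_format, OF that] by linarith
      qed (use bd e' in auto)
      have g2: "\<forall>\<^sub>F h in at_right 0. \<forall>y\<in>{l..c}. - U m y - h * e' \<le> exp (- h * k y) * transition h (\<lambda>y. - U m y) y" if e': "e < e'" for e'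
      proof (rule discounted_generator_lower[where g="\<lambda>y. - g m y" and b="?b" and \<eta>=e])
        show "\<forall>\<^sub>F h in at_right 0. \<forall>y\<in>{l..c}. - U m y + h * (- g m y - d) \<le> transition h (\<lambda>y. - U m y) y" if "0 < d" for d
          using gen[OF that, of m] by eventually_elim (auto simp: abs_le_iff right_diff_distrib transition_uminus)
        show "- e \<le> - g m y - k y * - U m y" if "y \<in> {l..c}" for y using m[rule_format, OF that] by (simp add: abs_le_iff)
      qed (use bd e' in auto)
      have "U m x - e * t * exp (0 * t) \<le> ?E m"
        using k g1 t e by (intro stopping_lower(2)[OF lap \<theta>0_add1(1) Ucont C k(1)]) auto
      moreover have "- U m x - e * t * exp (0 * t) \<le> expectation (\<lambda>z. discount k l c x t z * - U m (stopped_pos l c x t z))"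
        using k g2 t e C by (intro stopping_lower(2)[OF lap \<theta>0_add1(1), where U="\<lambda>y. - U m y" and C=C] continuous_intros Ucont) auto
      ultimately show ?thesis by (simp add: abs_le_iff)
    qed
    have "?E \<longlonglongrightarrow> expectation (\<lambda>z. discount k l c x t z * H (stopped_pos l c x t z))"
    proof (rule integral_dominated_convergence[where w="\<lambda>_. B"])
      show "AE z in M. (\<lambda>m. discount k l c x t z * U m (stopped_pos l c x t z)) \<longlonglongrightarrow> discount k l c x t z * H (stopped_pos l c x t z)"
        using AE_no_up_jump[of x] AE_space
        by eventually_elim (use t lc in \<open>intro tendsto_intros lim stopped_pos_le, auto\<close>)
      show "AE z in M. norm (discount k l c x t z * U m (stopped_pos l c x t z)) \<le> B" for m
        using t lc k B by (intro stopped_value_AE_le) auto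
    qed auto
    moreover have "(\<lambda>m. ?E m - U m x) \<longlonglongrightarrow> 0"
    proof (rule tendstoI)
      fix d :: real assume d: "0 < d"
      have "0 < d / (2 * t)" using d t by simp
      from err[OF this] show "\<forall>\<^sub>F m in sequentially. dist (?E m - U m x) 0 < d"
      proof eventually_elim
        case (elim m)
        have "\<bar>?E m - U m x\<bar> \<le> d / (2 * t) * t" by (rule close[OF _ elim]) (use d t in simp)
        also have "\<dots> < d" using d t by simp
        finally show ?case by (simp add: dist_real_def)
      qed
    qed
    ultimately have "(\<lambda>m. ?E m - (?E m - U m x)) \<longlonglongrightarrow> expectation (\<lambda>z. discount k l c x t z * H (stopped_pos l c x t z)) - 0"
      by (rule tendsto_diff)
    then have "(\<lambda>m. U m x) \<longlonglongrightarrow> expectation (\<lambda>z. discount k l c x t z * H (stopped_pos l c x t z))" by simp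
    from LIMSEQ_unique[OF lim this] lc show ?thesis by simp
  qed
  have "(\<lambda>n. H x) \<longlonglongrightarrow> expectation (\<lambda>z. exit_disc k l c x z * H (exit_pos l c x z))"
    using exit_limit[OF lc k Hm HB] fin[of "real (Suc _)"] by simp
  then show ?thesis by (simp add: LIMSEQ_const_iff)
qed

text \<open>Total mass 1. The gap of width \<epsilon> to the left of 0 keeps the bump away from a
  neighbourhood of [0, c], where the density has to be uniformly continuous.\<close>

definition bump :: "real \<Rightarrow> real \<Rightarrow> real" where
  "bump \<epsilon> u = indicator {-2*\<epsilon>..-\<epsilon>} u / \<epsilon>"

lemma bump_support: "0 < \<epsilon> \<Longrightarrow> bounded_support (-2*\<epsilon>) (-\<epsilon>) (1/\<epsilon>) (bump \<epsilon>)"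
  unfolding bounded_support_def bump_def by (auto simp: indicator_def)

lemma bump_nonneg: "0 < \<epsilon> \<Longrightarrow> 0 \<le> bump \<epsilon> u"
  by (simp add: bump_def)

text \<open>The convolution is the mean of \<open>W\<close> over [y + \<epsilon>, y + 2 \<epsilon>],
  so monotonicity gives both bounds.\<close>

lemma conv_bump:
  assumes "0 < \<epsilon>"
  shows "W (y + \<epsilon>) \<le> conv (bump \<epsilon>) y" and "conv (bump \<epsilon>) y \<le> W (y + 2 * \<epsilon>)"
proof -
  have i: "integrable lborel (\<lambda>u. a * bump \<epsilon> u)" for a :: real
    unfolding bump_def by (intro integrable_mult_right integrable_divide integrable_real_indicator) (auto simp: emeasure_lborel_Icc_eq)
  have one: "(LINT u|lborel. a * bump \<epsilon> u) = a" for a :: real using assms by (simp add: bump_def)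
  have "W (y + \<epsilon>) = (LINT u|lborel. W (y + \<epsilon>) * bump \<epsilon> u)" by (simp only: one)
  also have "\<dots> \<le> conv (bump \<epsilon>) y" unfolding conv_def
    by (intro integral_mono i conv_bound(2)[OF bump_support[OF assms]])
       (auto simp: bump_def indicator_def intro!: divide_right_mono W_mono_UNIV less_imp_le[OF assms])
  finally show "W (y + \<epsilon>) \<le> conv (bump \<epsilon>) y" .
  have "conv (bump \<epsilon>) y \<le> (LINT u|lborel. W (y + 2 * \<epsilon>) * bump \<epsilon> u)" unfolding conv_def
    by (intro integral_mono i conv_bound(2)[OF bump_support[OF assms]])
       (auto simp: bump_def indicator_def intro!: divide_right_mono W_mono_UNIV less_imp_le[OF assms])
  then show "conv (bump \<epsilon>) y \<le> W (y + 2 * \<epsilon>)" by (simp only: one)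
qed

text \<open>Approximation from the right is essential: at 0 \<open>W\<close> may jump, and it is the
  right limit that equals \<open>W 0\<close>. This is why the bump sits to the left of 0.\<close>

lemma W_right_limit:
  assumes "d \<longlonglongrightarrow> (0::real)" "\<And>m. 0 \<le> d m"
  shows "(\<lambda>m. W (y + d m)) \<longlonglongrightarrow> W y"
proof -
  have s: "(\<lambda>m. y + d m) \<longlonglongrightarrow> y" using tendsto_add[OF tendsto_const assms(1), of y] by simp
  show ?thesis
  proof (cases "y < 0")
    case True
    then have "isCont W y" by (intro isCont_W) simp
    then show ?thesis by (rule isCont_tendsto_compose[OF _ s])
  next
    case False
    then show ?thesis using assms(2)
      by (intro continuous_on_tendsto_compose[OF W_cont s]) (auto intro!: always_eventually)
  qed
qed

(* The density omega H is extended a little beyond [0, c], so that it is uniformly continuous at all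
   points of [0, c]; the part a W of H comes from the bump below 0. *)
theorem omega_exit_identity:
  assumes c: "0 < c" and x: "x \<in> {0..c}" and om: "continuous_on UNIV \<omega>" "\<And>y. 0 \<le> \<omega> y" and "0 \<le> a"
    and Hm[measurable]: "H \<in> borel_measurable borel"
    and g0: "bounded_support 0 c G (\<lambda>u. \<omega> u * H u * indicator {0..c} u)"
    and H: "\<And>y. y \<le> c \<Longrightarrow> H y = \<kappa> + a * W y + conv (\<lambda>u. \<omega> u * H u * indicator {0..c} u) y"
  shows "H x = expectation (\<lambda>z. exit_disc \<omega> 0 c x z * H (exit_pos 0 c x z))"
proof -
  define g0' where "g0' u = \<omega> u * H u * indicator {0..c} u" for u
  note g0 = g0[folded g0'_def]
  have H: "H y = \<kappa> + a * W y + conv g0' y" if "y \<le> c" for y using H[OF that] by (simp add: g0'_def[abs_def])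
  have Hc: "continuous_on {0..c} H"
  proof -
    have "continuous_on {0..c} (\<lambda>y. \<kappa> + a * W y + conv g0' y)"
      by (intro continuous_intros continuous_on_subset[OF W_cont] continuous_on_subset[OF conv_continuous[OF g0]]) auto
    then show ?thesis by (rule continuous_on_cong[THEN iffD1, rotated -1]) (auto simp: H)
  qed
  \<comment> \<open>\<open>H\<close> is continuous on [0, c] but may jump at 0. Extending the
    density by its end values keeps it continuous on the line and bounded.\<close>
  define cl where "cl u = max 0 (min c u)" for u
  have cl: "cl u \<in> {0..c}" "u \<in> {0..c} \<Longrightarrow> cl u = u" for u using c by (auto simp: cl_def)
  have clc: "continuous_on UNIV cl" unfolding cl_def by (intro continuous_intros)
  define G0 where "G0 u = \<omega> (cl u) * H (cl u)" for u
  have G0c: "continuous_on UNIV G0" unfolding G0_def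
    by (intro continuous_intros continuous_on_compose2[OF om(1) clc] continuous_on_compose2[OF Hc clc]) (use cl in auto)
  have G0m[measurable]: "G0 \<in> borel_measurable borel" by (rule borel_measurable_continuous_onI[OF G0c])
  define S where "S = G"
  have S: "\<bar>G0 u\<bar> \<le> S" "0 \<le> S" for u
  proof -
    have "G0 u = g0' (cl u)" using cl(1)[of u] by (simp add: G0_def g0'_def)
    then show "\<bar>G0 u\<bar> \<le> S" using bounded_supportD(2)[OF g0] by (simp add: S_def)
    show "0 \<le> S" using bounded_supportD(5)[OF g0] by (simp add: S_def)
  qed
  define \<epsilon> where "\<epsilon> m = 1 / real (Suc m)" for m
  have \<epsilon>: "0 < \<epsilon> m" "\<epsilon> m \<le> 1" for m by (auto simp: \<epsilon>_def)
  have \<epsilon>lim: "\<epsilon> \<longlonglongrightarrow> 0" unfolding \<epsilon>_def by (rule LIMSEQ_Suc[OF lim_1_over_n])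
  \<comment> \<open>On the right an overhang of fixed length is harmless, because
    \<open>W (y - u)\<close> vanishes for u > y and the comparison with \<open>H\<close> concerns y
    \<le> c. On the left the overhang does contribute to \<open>U m\<close>, so it has to shrink
    with \<open>m\<close>.\<close>
  define r where "r m u = G0 u * indicator {-\<epsilon> m..c+1} u" for m u
  have r: "bounded_support (- \<epsilon> m) (c + 1) S (r m)" for m
    using S c \<epsilon>(1)[of m] unfolding bounded_support_def r_def by (auto simp: indicator_def)
  define g where "g m u = a * bump (\<epsilon> m) u + r m u" for m u
  have gs: "bounded_support (-2 * \<epsilon> m) (c + 1) (a / \<epsilon> m + S) (g m)" for m
    unfolding bounded_support_def
  proof (intro conjI allI impI)
    show "g m \<in> borel_measurable borel" unfolding g_def r_def bump_def by measurable
    show "-2 * \<epsilon> m \<le> c + 1" using c \<epsilon>(1)[of m] by linarith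
    fix u
    have "\<bar>a * bump (\<epsilon> m) u\<bar> \<le> a / \<epsilon> m" using \<open>0 \<le> a\<close> \<epsilon>(1)[of m] by (auto simp: bump_def indicator_def)
    moreover have "\<bar>r m u\<bar> \<le> S" by (rule bounded_supportD(2)[OF r])
    ultimately show "\<bar>g m u\<bar> \<le> a / \<epsilon> m + S" unfolding g_def by linarith
    assume "u \<notin> {-2 * \<epsilon> m..c + 1}"
    then show "g m u = 0" unfolding g_def r_def bump_def using c \<epsilon>(1)[of m] by (auto simp: indicator_def)
  qed
  have conv_g: "conv (g m) y = a * conv (bump (\<epsilon> m)) y + conv (r m) y" for m y
    unfolding conv_def g_def using conv_bound(2)[OF bump_support[OF \<epsilon>(1)[of m]], of y] conv_bound(2)[OF r[of m], of y]
    by (simp add: distrib_left mult.left_commute)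
  define U where "U m y = \<kappa> + conv (g m) y" for m y
  \<comment> \<open>The first term is the shift of \<open>W\<close> caused by the bump. The second
    is the left overhang, of length \<open>\<epsilon> m\<close> and with an integrand of at most
    \<open>S * W (c + 1)\<close>.\<close>
  have close: "\<bar>U m y - H y\<bar> \<le> a * (W (y + 2 * \<epsilon> m) - W y) + \<epsilon> m * (S * W (c + 1))" if y: "y \<le> c" for m y
  proof -
    have "\<bar>conv (r m) y - conv g0' y\<bar> = \<bar>LINT u|lborel. W (y - u) * r m u - W (y - u) * g0' u\<bar>"
      unfolding conv_def using conv_bound(2)[OF r[of m], of y] conv_bound(2)[OF g0, of y] by simp
    also have "\<dots> \<le> (LINT u|lborel. \<bar>W (y - u) * r m u - W (y - u) * g0' u\<bar>)" by (rule integral_abs_bound)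
    also have "\<dots> \<le> (LINT u|lborel. S * W (c + 1) * indicator {-\<epsilon> m..0} u)"
    proof (rule integral_mono)
      show "integrable lborel (\<lambda>u. \<bar>W (y - u) * r m u - W (y - u) * g0' u\<bar>)"
        using conv_bound(2)[OF r[of m], of y] conv_bound(2)[OF g0, of y] by simp
      show "integrable lborel (\<lambda>u. S * W (c + 1) * indicator {-\<epsilon> m..0} u)"
        by (intro integrable_mult_right integrable_real_indicator) (auto simp: emeasure_lborel_Icc_eq)
      fix u
      consider "c < u" | "u \<in> {0..c}" | "u \<in> {-\<epsilon> m..<0}" | "u < - \<epsilon> m" using \<epsilon>(1)[of m] by fastforce
      then show "\<bar>W (y - u) * r m u - W (y - u) * g0' u\<bar> \<le> S * W (c + 1) * indicator {-\<epsilon> m..0} u"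
      proof cases
        case 1 then show ?thesis using y W_neg[of "y - u"] S(2) W_nonneg by simp
      next
        case 2
        then have "r m u = g0' u" using cl(2)[OF 2] \<epsilon>(1)[of m] by (simp add: r_def g0'_def G0_def)
        then show ?thesis using S(2) W_nonneg by simp
      next
        case 3
        then have "g0' u = 0" by (simp add: g0'_def)
        have "W (y - u) * \<bar>r m u\<bar> \<le> W (c + 1) * S"
          using 3 y \<epsilon>(2)[of m] bounded_supportD(2)[OF r[of m], of u] W_nonneg by (intro mult_mono W_mono_UNIV) auto
        then show ?thesis using 3 \<open>g0' u = 0\<close> W_nonneg by (simp add: abs_mult mult.commute)
      next
        case 4 then show ?thesis using S(2) W_nonneg \<epsilon>(1)[of m] c by (simp add: r_def g0'_def)
      qed
    qed
    also have "\<dots> = \<epsilon> m * (S * W (c + 1))" using \<epsilon>(1)[of m] by simp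
    finally have 1: "\<bar>conv (r m) y - conv g0' y\<bar> \<le> \<epsilon> m * (S * W (c + 1))" .
    have "W y \<le> conv (bump (\<epsilon> m)) y" "conv (bump (\<epsilon> m)) y \<le> W (y + 2 * \<epsilon> m)"
      using conv_bump[OF \<epsilon>(1)[of m], of y] W_mono_UNIV[of y "y + \<epsilon> m"] \<epsilon>(1)[of m] by auto
    then have 2: "\<bar>a * (conv (bump (\<epsilon> m)) y - W y)\<bar> \<le> a * (W (y + 2 * \<epsilon> m) - W y)"
      using \<open>0 \<le> a\<close> by (auto simp: abs_mult intro!: mult_left_mono)
    have "U m y - H y = a * (conv (bump (\<epsilon> m)) y - W y) + (conv (r m) y - conv g0' y)"
      unfolding U_def conv_g H[OF y] by (simp add: algebra_simps)
    then show ?thesis using 1 2 by linarith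
  qed
  have W2: "(\<lambda>m. W (y + 2 * \<epsilon> m)) \<longlonglongrightarrow> W y" for y
  proof (rule W_right_limit)
    show "(\<lambda>m. 2 * \<epsilon> m) \<longlonglongrightarrow> 0" using tendsto_mult_right[OF \<epsilon>lim, of 2] by simp
  qed (use \<epsilon>(1) in \<open>simp add: less_imp_le\<close>)
  show ?thesis
  proof (rule exit_identity_limit[where U=U and g=g and B="\<bar>\<kappa>\<bar> + (a * W (c + 2) + S * W (c + 1) * (c + 2))"])
    show "continuous_on UNIV (U m)" for m unfolding U_def by (intro continuous_intros conv_continuous[OF gs])
    show "\<exists>C. \<forall>y. \<bar>U m y\<bar> \<le> C * (1 + exp ((\<theta>0 + 1) * y))" for m
    proof -
      obtain C where C: "\<And>y. \<bar>conv (g m) y\<bar> \<le> C * (1 + exp ((\<theta>0 + 1) * y))" using conv_bound1[OF gs] by blast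
      have "\<bar>U m y\<bar> \<le> (\<bar>\<kappa>\<bar> + C) * (1 + exp ((\<theta>0 + 1) * y))" for y
      proof -
        have "\<bar>\<kappa>\<bar> \<le> \<bar>\<kappa>\<bar> * (1 + exp ((\<theta>0 + 1) * y))" by (simp add: distrib_left)
        then show ?thesis using C[of y] unfolding U_def by (simp only: distrib_right)
      qed
      then show ?thesis by blast
    qed
    show "\<forall>\<^sub>F h in at_right 0. \<forall>y\<in>{0..c}. \<bar>transition h (U m) y - U m y - h * g m y\<bar> \<le> h * e" if "0 < e" for m e
    proof -
      obtain C where C: "\<And>y. \<bar>conv (g m) y\<bar> \<le> C * (1 + exp ((\<theta>0 + 1) * y))" using conv_bound1[OF gs] by blast
      have "\<exists>d>0. \<forall>y\<in>{0..c}. \<forall>u. \<bar>u - y\<bar> < d \<longrightarrow> \<bar>g m u - g m y\<bar> \<le> e'" if e': "0 < e'" for e'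
      proof -
        have "uniformly_continuous_on {-1..c+1} G0"
          by (intro compact_uniformly_continuous continuous_on_subset[OF G0c]) auto
        then obtain d where d: "0 < d" "\<And>u y. u \<in> {-1..c+1} \<Longrightarrow> y \<in> {-1..c+1} \<Longrightarrow> \<bar>u - y\<bar> < d \<Longrightarrow> \<bar>G0 u - G0 y\<bar> < e'"
          unfolding uniformly_continuous_on_def dist_real_def using e' by metis
        \<comment> \<open>Closer than \<open>\<epsilon> m\<close> to [0, c] neither the bump nor the
          cut-offs of \<open>r m\<close> are met, so \<open>g m\<close> is the continuous function
          \<open>G0\<close> there.\<close>
        have "\<bar>g m u - g m y\<bar> \<le> e'" if "y \<in> {0..c}" "\<bar>u - y\<bar> < min d (\<epsilon> m)" for u y
        proof -
          have u: "- \<epsilon> m < u" "u < c + 1" using that \<epsilon>[of m] by auto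
          have "g m u = G0 u" "g m y = G0 y"
            using u that(1) \<epsilon>(1)[of m] unfolding g_def bump_def r_def by (auto simp: indicator_def)
          then show ?thesis using d(2)[of u y] u that \<epsilon>(2)[of m] by auto
        qed
        then show ?thesis using d(1) \<epsilon>(1)[of m] by (intro exI[of _ "min d (\<epsilon> m)"]) auto
      qed
      from transition_conv_generator[OF gs c this \<open>0 < e\<close>]
      have "\<forall>\<^sub>F h in at_right 0. \<forall>y\<in>{0..c}. \<bar>transition h (conv (g m)) y - conv (g m) y - h * g m y\<bar> \<le> h * e" by blast
      moreover have "\<forall>\<^sub>F h in at_right (0::real). 0 < h" by (simp add: eventually_at_filter)
      ultimately show ?thesis
      proof eventually_elim
        case (elim h)
        have "transition h (U m) y = \<kappa> + transition h (conv (g m)) y" for y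
          unfolding U_def[abs_def] using elim(2) by (intro transition_add_const[OF _ conv_continuous[OF gs] C]) simp
        then show ?case using elim(1) by (simp add: U_def)
      qed
    qed
    show "\<exists>b. \<forall>y\<in>{0..c}. \<bar>g m y\<bar> \<le> b" for m using bounded_supportD(2)[OF gs] by blast
    show "\<forall>\<^sub>F m in sequentially. \<forall>y\<in>{0..c}. \<bar>g m y - \<omega> y * U m y\<bar> \<le> e" if e: "0 < e" for e
    proof -
      have "bounded (\<omega> ` {0..c})"
        by (intro compact_imp_bounded compact_continuous_image continuous_on_subset[OF om(1)]) auto
      then obtain \<Omega>0 where "\<forall>v\<in>\<omega> ` {0..c}. norm v \<le> \<Omega>0" unfolding bounded_iff by blast
      then have Om0: "\<bar>\<omega> y\<bar> \<le> \<Omega>0" if "y \<in> {0..c}" for y using that by auto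
      define \<Omega> where "\<Omega> = \<Omega>0 + 1"
      have Om: "\<bar>\<omega> y\<bar> \<le> \<Omega>" if "y \<in> {0..c}" for y using Om0[OF that] by (simp add: \<Omega>_def)
      have Omp: "0 < \<Omega>" using Om0[of 0] c unfolding \<Omega>_def by fastforce
      define e1 where "e1 = e / (2 * \<Omega>)"
      have e1: "0 < e1" using e Omp by (simp add: e1_def)
      \<comment> \<open>The error must vanish uniformly in \<open>y\<close>, so pointwise right
        continuity is not enough; [0, c + 2] contains \<open>y + 2 * \<epsilon> m\<close> because
        \<open>\<epsilon> m\<close> is at most 1. After multiplication by \<omega>, each of the two
        error terms costs at most half of \<open>e\<close>.\<close>
      have "uniformly_continuous_on {0..c+2} W"
        by (intro compact_uniformly_continuous continuous_on_subset[OF W_cont]) auto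
      moreover have "0 < e1 / (a + 1)" using e1 \<open>0 \<le> a\<close> by simp
      ultimately obtain d where d: "0 < d" "\<And>u y. u \<in> {0..c+2} \<Longrightarrow> y \<in> {0..c+2} \<Longrightarrow> \<bar>u - y\<bar> < d \<Longrightarrow> \<bar>W u - W y\<bar> < e1 / (a + 1)"
        unfolding uniformly_continuous_on_def dist_real_def by metis
      have "(\<lambda>m. \<epsilon> m * (S * W (c + 1))) \<longlonglongrightarrow> 0" using tendsto_mult_right_zero[OF \<epsilon>lim] by (simp add: tendsto_mult_left_zero[OF \<epsilon>lim])
      from order_tendstoD(2)[OF this e1] have "\<forall>\<^sub>F m in sequentially. \<epsilon> m * (S * W (c + 1)) < e1" .
      moreover have "\<forall>\<^sub>F m in sequentially. \<epsilon> m < d / 2" using order_tendstoD(2)[OF \<epsilon>lim, of "d / 2"] d(1) by simp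
      ultimately show ?thesis
      proof eventually_elim
        case (elim m)
        show ?case
        proof
          fix y assume y: "y \<in> {0..c}"
          have "\<bar>W (y + 2 * \<epsilon> m) - W y\<bar> < e1 / (a + 1)"
            using y elim(2) \<epsilon>[of m] by (intro d(2)) auto
          then have "a * (W (y + 2 * \<epsilon> m) - W y) \<le> a * (e1 / (a + 1))" using \<open>0 \<le> a\<close> by (intro mult_left_mono) auto
          also have "\<dots> \<le> e1" using \<open>0 \<le> a\<close> e1 by (simp add: field_simps)
          finally have "\<bar>U m y - H y\<bar> \<le> 2 * e1" using close[of y m] y elim(1) by simp
          then have "\<bar>\<omega> y\<bar> * \<bar>U m y - H y\<bar> \<le> \<Omega> * (2 * e1)" using Om[OF y] Omp by (intro mult_mono) auto
          moreover have "\<Omega> * (2 * e1) = e" using Omp by (simp add: e1_def)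
          moreover have "g m y = \<omega> y * H y"
            using y \<epsilon>(1)[of m] cl(2)[OF y] unfolding g_def bump_def r_def G0_def by (auto simp: indicator_def)
          moreover have "\<omega> y * H y - \<omega> y * U m y = - (\<omega> y * (U m y - H y))" by (simp add: algebra_simps)
          ultimately show "\<bar>g m y - \<omega> y * U m y\<bar> \<le> e" by (simp add: abs_mult)
        qed
      qed
    qed
    show "\<bar>U m y\<bar> \<le> \<bar>\<kappa>\<bar> + (a * W (c + 2) + S * W (c + 1) * (c + 2))" if y: "y \<le> c" for m y
    proof -
      have "0 \<le> conv (bump (\<epsilon> m)) y" "conv (bump (\<epsilon> m)) y \<le> W (c + 2)"
        using conv_bump[OF \<epsilon>(1)[of m], of y] W_nonneg[of "y + \<epsilon> m"] W_mono_UNIV[of "y + 2 * \<epsilon> m" "c + 2"] \<epsilon>[of m] y by auto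
      then have 1: "\<bar>a * conv (bump (\<epsilon> m)) y\<bar> \<le> a * W (c + 2)" using \<open>0 \<le> a\<close> by (auto simp: abs_mult intro!: mult_left_mono)
      have "\<bar>conv (r m) y\<bar> \<le> S * W (y - - \<epsilon> m) * (c + 1 - - \<epsilon> m)" by (rule conv_bound(3)[OF r])
      also have "\<dots> \<le> S * W (c + 1) * (c + 2)"
        using y \<epsilon>[of m] S(2) W_nonneg c by (intro mult_mono mult_left_mono W_mono_UNIV) auto
      finally show ?thesis using 1 unfolding U_def conv_g by linarith
    qed
    show "(\<lambda>m. U m y) \<longlonglongrightarrow> H y" if y: "y \<le> c" for y
    proof -
      have "(\<lambda>m. a * (W (y + 2 * \<epsilon> m) - W y) + \<epsilon> m * (S * W (c + 1))) \<longlonglongrightarrow> a * (W y - W y) + 0 * (S * W (c + 1))"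
        by (intro tendsto_intros W2 \<epsilon>lim)
      then have l: "(\<lambda>m. a * (W (y + 2 * \<epsilon> m) - W y) + \<epsilon> m * (S * W (c + 1))) \<longlonglongrightarrow> 0" by simp
      have "\<forall>m. norm (U m y - H y) \<le> a * (W (y + 2 * \<epsilon> m) - W y) + \<epsilon> m * (S * W (c + 1))"
        using close[OF y] by (simp only: real_norm_def) blast
      from Lim_null_comparison[OF always_eventually[OF this] l]
      have "(\<lambda>m. U m y - H y) \<longlonglongrightarrow> 0" .
      then show ?thesis by (simp add: LIM_zero_iff)
    qed
  qed (use c x om in auto)
qed

end

text \<open>After the exit time T of [0, c] the path stays below \<open>c\<close> during some [T,
  b), and it must take a negative value \<open>f s\<close> there. For \<delta> < -
  \<open>f s\<close> the larger interval is left no earlier than T and no later than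
  \<open>s\<close>, hence at a level below \<open>c\<close>. So a small enlargement of the interval
  does not turn a downward exit into an exit through \<open>c\<close>.\<close>

lemma down_exit_stable:
  assumes f: "cadlag_path f" and s0: "0 \<le> s0" "f s0 \<notin> {0..c}" and down: "f (exit_inf 0 c f) < c"
  shows "\<exists>d>0. \<forall>\<delta>. 0 < \<delta> \<and> \<delta> < d \<longrightarrow> f (exit_inf (- \<delta>) c f) < c"
proof -
  let ?T = "exit_inf 0 c f"
  have T0: "0 \<le> ?T" by (rule exit_inf_nonneg[where f=f, OF s0])
  have "\<forall>\<^sub>F s in at_right ?T. f s < c"
    by (rule order_tendstoD(2)[OF cadlag_path_right[OF f T0] down])
  then obtain b where b: "?T < b" "\<And>s. ?T < s \<Longrightarrow> s < b \<Longrightarrow> f s < c"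
    by (auto simp: eventually_at_right_field)
  have bel: "f s < c" if "?T \<le> s" "s < b" for s
    using that b(2)[of s] down by (cases "s = ?T") auto
  have "\<exists>s. ?T \<le> s \<and> s < b \<and> f s \<notin> {0..c}"
  proof (rule ccontr)
    assume n: "\<not> ?thesis"
    have "b \<le> ?T"
    proof (rule exit_inf_ge[where f=f, OF s0])
      fix s assume "0 \<le> s" "s < b"
      then show "f s \<in> {0..c}" using n before_exit_inf[of s 0 c f] by (cases "?T \<le> s") auto
    qed
    then show False using b(1) by simp
  qed
  then obtain s where s: "?T \<le> s" "s < b" "f s \<notin> {0..c}" by blast
  then have neg: "f s < 0" using bel[of s] by auto
  have "f (exit_inf (- \<delta>) c f) < c" if d: "0 < \<delta>" "\<delta> < - f s" for \<delta>
  proof (rule bel)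
    have s1: "0 \<le> s" "f s \<notin> {- \<delta>..c}" using s T0 d by auto
    show "exit_inf (- \<delta>) c f < b" using exit_inf_le[where f=f, OF s1] s(2) by simp
    show "?T \<le> exit_inf (- \<delta>) c f"
    proof (rule exit_inf_ge[where f=f, OF s1])
      fix r assume "0 \<le> r" "r < ?T"
      from before_exit_inf[OF this] show "f r \<in> {- \<delta>..c}" using d(1) by auto
    qed
  qed
  then show ?thesis using neg by (intro exI[of _ "- f s"]) auto
qed

section \<open>Two-sided exit through the upper end, and the omega-scale functions\<close>

context levy_scale
begin

definition up_exit :: "real \<Rightarrow> real \<Rightarrow> real \<Rightarrow> 'a set" where
  "up_exit l c x = {z \<in> space M. exits l c x z \<and> c \<le> exit_pos l c x z}"

lemma exit_pos_measurable[measurable]: "exit_pos l c x \<in> borel_measurable M"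
  by (rule exit_measurable(1)[where k="\<lambda>_. 0"]) simp

lemma up_exit_sets[measurable]: "up_exit l c x \<in> sets M"
  unfolding up_exit_def by measurable

lemma AE_exit:
  assumes "l < c" "x \<in> {l..c}"
  shows "AE z in M. z \<in> space M \<and> exits l c x z \<and> (z \<in> up_exit l c x \<and> exit_pos l c x z = c \<or> z \<notin> up_exit l c x \<and> exit_pos l c x z \<le> l)"
  using AE_exits[OF assms] AE_no_up_jump[of x] AE_space
proof eventually_elim
  case (elim z)
  then show ?case
    using exit_pos_le[of z x c l] exit_pos_cases[of z l c x] assms unfolding up_exit_def by auto
qed

text \<open>With 2 \<epsilon> < \<delta> the bump lies inside [-\<delta>, c], where it contributes a
  nonnegative drift, and the smoothed function vanishes at all positions up to -\<delta>. So only
  exits through \<open>c\<close> count, each with a value of at most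
  \<open>W (c + 2 * \<epsilon>)\<close>.\<close>

lemma W_le_up_exit:
  assumes x: "0 \<le> x" "x \<le> c" and "0 < \<delta>"
  shows "W x \<le> W c * prob (up_exit (- \<delta>) c x)"
proof -
  have main: "W x \<le> W (c + 2 * \<epsilon>) * prob (up_exit (- \<delta>) c x)" if e: "0 < \<epsilon>" "2 * \<epsilon> < \<delta>" for \<epsilon>
  proof -
    note b = bump_support[OF e(1)]
    have cm: "0 \<le> conv (bump \<epsilon>) y" "y \<le> y' \<Longrightarrow> conv (bump \<epsilon>) y \<le> conv (bump \<epsilon>) y'" for y y'
      using conv_mono[OF b bump_nonneg[OF e(1)]] by blast+
    obtain C where C: "\<And>y. \<bar>conv (bump \<epsilon>) y\<bar> \<le> C * (1 + exp ((\<theta>0 + 1) * y))" using conv_bound1[OF b] by blast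
    have lc: "- \<delta> < c" "x \<in> {- \<delta>..c}" using x \<open>0 < \<delta>\<close> by auto
    have "W x \<le> conv (bump \<epsilon>) x" using conv_bump(1)[OF e(1), of x] W_mono_UNIV[of x "x + \<epsilon>"] e(1) by simp
    also have "\<dots> \<le> expectation (\<lambda>z. exit_disc (\<lambda>_. 0) (- \<delta>) c x z * conv (bump \<epsilon>) (exit_pos (- \<delta>) c x z))"
    proof (rule exit_lower[where B="conv (bump \<epsilon>) c", OF lc _ _ conv_continuous[OF b] C])
      fix e' :: real assume "0 < e'"
      have "\<forall>\<^sub>F h in at_right (0::real). 0 < h" by (simp add: eventually_at_filter)
      then show "\<forall>\<^sub>F h in at_right 0. \<forall>y\<in>{- \<delta>..c}. conv (bump \<epsilon>) y - h * e' \<le> exp (- h * 0) * transition h (conv (bump \<epsilon>)) y"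
      proof eventually_elim
        case (elim h)
        have "conv (bump \<epsilon>) y - h * e' \<le> transition h (conv (bump \<epsilon>)) y" for y
          using transition_conv_ge[OF b bump_nonneg[OF e(1)] less_imp_le[OF elim], of y] elim \<open>0 < e'\<close>
          by (smt (verit) mult_pos_pos)
        then show ?case by simp
      qed
    next
      show "\<bar>conv (bump \<epsilon>) y\<bar> \<le> conv (bump \<epsilon>) c" if "y \<le> c" for y using cm that by simp
    qed auto
    also have "\<dots> \<le> expectation (\<lambda>z. W (c + 2 * \<epsilon>) * indicator (up_exit (- \<delta>) c x) z)"
    proof (rule integral_mono_AE)
      have AEb: "AE z in M. exit_disc (\<lambda>_. 0) (- \<delta>) c x z * conv (bump \<epsilon>) (exit_pos (- \<delta>) c x z)
          \<le> W (c + 2 * \<epsilon>) * indicator (up_exit (- \<delta>) c x) z"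
        using AE_exit[OF lc]
      proof eventually_elim
        case (elim z)
        have "exit_disc (\<lambda>_. 0) (- \<delta>) c x z = 1" using elim by (simp add: exit_disc_def set_lebesgue_integral_def)
        moreover have "conv (bump \<epsilon>) y = 0" if "y \<le> - \<delta>" for y
          using that e by (intro conv_zero[OF b]) simp
        ultimately show ?case using elim conv_bump(2)[OF e(1), of c] by auto
      qed
      show "AE z in M. exit_disc (\<lambda>_. 0) (- \<delta>) c x z * conv (bump \<epsilon>) (exit_pos (- \<delta>) c x z)
          \<le> W (c + 2 * \<epsilon>) * indicator (up_exit (- \<delta>) c x) z" by (rule AEb)
      show "integrable M (\<lambda>z. W (c + 2 * \<epsilon>) * indicator (up_exit (- \<delta>) c x) z)"
        by (intro integrable_mult_right integrable_real_indicator) (auto simp: less_top[symmetric])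
      have [measurable]: "exit_disc (\<lambda>_. 0) (- \<delta>) c x \<in> borel_measurable M" by (rule exit_measurable(2)) simp
      have [measurable]: "conv (bump \<epsilon>) \<in> borel_measurable borel" by (rule borel_measurable_continuous_onI[OF conv_continuous[OF b]])
      show "integrable M (\<lambda>z. exit_disc (\<lambda>_. 0) (- \<delta>) c x z * conv (bump \<epsilon>) (exit_pos (- \<delta>) c x z))"
      proof (rule integrable_const_bound[of _ "W (c + 2 * \<epsilon>)"])
        show "AE z in M. norm (exit_disc (\<lambda>_. 0) (- \<delta>) c x z * conv (bump \<epsilon>) (exit_pos (- \<delta>) c x z)) \<le> W (c + 2 * \<epsilon>)"
          using AEb
        proof eventually_elim
          case (elim z)
          have "0 \<le> exit_disc (\<lambda>_. 0) (- \<delta>) c x z * conv (bump \<epsilon>) (exit_pos (- \<delta>) c x z)"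
            by (intro mult_nonneg_nonneg exit_disc_nonneg cm)
          moreover have "W (c + 2 * \<epsilon>) * indicator (up_exit (- \<delta>) c x) z \<le> W (c + 2 * \<epsilon>)"
            using W_nonneg by (simp add: indicator_def)
          ultimately show ?case using elim by simp
        qed
      qed measurable
    qed
    also have "\<dots> = W (c + 2 * \<epsilon>) * prob (up_exit (- \<delta>) c x)" by simp
    finally show ?thesis .
  qed
  define \<epsilon> where "\<epsilon> m = 1 / real (Suc m)" for m
  have \<epsilon>lim: "\<epsilon> \<longlonglongrightarrow> 0" unfolding \<epsilon>_def by (rule LIMSEQ_Suc[OF lim_1_over_n])
  have "(\<lambda>m. W (c + 2 * \<epsilon> m) * prob (up_exit (- \<delta>) c x)) \<longlonglongrightarrow> W c * prob (up_exit (- \<delta>) c x)"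
    using tendsto_mult_right[OF \<epsilon>lim, of 2] by (intro tendsto_intros W_right_limit) (auto simp: \<epsilon>_def)
  moreover have "\<forall>\<^sub>F m in sequentially. W x \<le> W (c + 2 * \<epsilon> m) * prob (up_exit (- \<delta>) c x)"
  proof -
    have "\<forall>\<^sub>F m in sequentially. \<epsilon> m < \<delta> / 2" using order_tendstoD(2)[OF \<epsilon>lim, of "\<delta> / 2"] \<open>0 < \<delta>\<close> by simp
    then show ?thesis
    proof eventually_elim
      case (elim m)
      then show ?case by (intro main) (simp_all add: \<epsilon>_def)
    qed
  qed
  ultimately show ?thesis by (rule tendsto_lowerbound) simp
qed

(* The second claim says that Y does not creep to 0 when W(0) > 0. *)
lemma W_two_sided_exit:
  assumes x: "0 < x" "x \<le> c"
  shows "W x = W c * prob (up_exit 0 c x)" and "AE z in M. z \<notin> up_exit 0 c x \<longrightarrow> W (exit_pos 0 c x z) = 0"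
proof -
  have lc: "0 < c" "x \<in> {0..c}" using x by auto
  let ?A = "up_exit 0 c x" and ?An = "\<lambda>n. up_exit (- (1 / real (Suc n))) c x"
  \<comment> \<open>The union with \<open>?A\<close> makes the indicators constant on
    \<open>?A\<close>, so convergence is to be checked for downward exits only, where
    \<open>down_exit_stable\<close> applies.\<close>
  have "(\<lambda>n. expectation (indicator (?An n \<union> ?A) :: 'a \<Rightarrow> real)) \<longlonglongrightarrow> expectation (indicator ?A)"
  proof (rule integral_dominated_convergence[where w="\<lambda>_. 1"])
    show "AE z in M. (\<lambda>n. indicator (?An n \<union> ?A) z :: real) \<longlonglongrightarrow> indicator ?A z"
      using AE_exit[OF lc]
    proof eventually_elim
      case (elim z)
      show ?case
      proof (cases "z \<in> ?A")
        case False
        then have e: "exits 0 c x z" "exit_pos 0 c x z < c" using elim unfolding up_exit_def by auto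
        then obtain s where "0 \<le> s" "path x z s \<notin> {0..c}" unfolding exits_def by blast
        moreover have "path x z (exit_inf 0 c (path x z)) < c" using e unfolding exit_pos_def by simp
        ultimately obtain d where d: "0 < d" "\<And>\<delta>. 0 < \<delta> \<Longrightarrow> \<delta> < d \<Longrightarrow> path x z (exit_inf (- \<delta>) c (path x z)) < c"
          using down_exit_stable[OF cadlag_shift, of z s x c] elim by blast
        have "(\<lambda>n. 1 / real (Suc n)) \<longlonglongrightarrow> 0" by (rule LIMSEQ_Suc[OF lim_1_over_n])
        from order_tendstoD(2)[OF this d(1)]
        have "\<forall>\<^sub>F n in sequentially. indicator (?An n \<union> ?A) z = (0::real)"
        proof eventually_elim
          case (elim n)
          have "z \<notin> ?An n" using d(2)[of "1 / real (Suc n)"] elim unfolding up_exit_def exit_pos_def by auto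
          then show ?case using False by simp
        qed
        then show ?thesis using False by (simp add: tendsto_eventually)
      qed simp
    qed
  qed (auto simp: indicator_def)
  then have lim: "(\<lambda>n. prob (?An n \<union> ?A)) \<longlonglongrightarrow> prob ?A" by simp
  have "W x \<le> W c * prob (?An n \<union> ?A)" for n
  proof -
    have "W x \<le> W c * prob (?An n)" using x by (intro W_le_up_exit) auto
    also have "\<dots> \<le> W c * prob (?An n \<union> ?A)" by (intro mult_left_mono finite_measure_mono W_nonneg) auto
    finally show ?thesis .
  qed
  then have ge: "W x \<le> W c * prob ?A"
    by (intro LIMSEQ_le_const[OF tendsto_mult_left[OF lim]]) auto
  have Z: "(\<lambda>u::real. 0 * W u * indicator {0..c} u) = (\<lambda>_. 0)" by simp
  have [measurable]: "exit_disc (\<lambda>_. 0) 0 c x \<in> borel_measurable M" by (rule exit_measurable(2)) simp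
  have "W x = expectation (\<lambda>z. exit_disc (\<lambda>_. 0) 0 c x z * W (exit_pos 0 c x z))"
  proof (rule omega_exit_identity[where a=1 and \<kappa>=0 and G=0])
    show "bounded_support 0 c 0 (\<lambda>u. 0 * W u * indicator {0..c} u)" unfolding Z bounded_support_def using lc by auto
    show "W y = 0 + 1 * W y + conv (\<lambda>u. 0 * W u * indicator {0..c} u) y" for y unfolding Z by (simp add: conv_def)
  qed (use lc in auto)
  also have "\<dots> = expectation (\<lambda>z. W c * indicator ?A z + W 0 * indicator {z \<in> space M. z \<notin> ?A \<and> exit_pos 0 c x z = 0} z)"
  proof (rule integral_cong_AE)
    show "AE z in M. exit_disc (\<lambda>_. 0) 0 c x z * W (exit_pos 0 c x z) =
        W c * indicator ?A z + W 0 * indicator {z \<in> space M. z \<notin> ?A \<and> exit_pos 0 c x z = 0} z"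
      using AE_exit[OF lc]
    proof eventually_elim
      case (elim z)
      have "exit_disc (\<lambda>_. 0) 0 c x z = 1" using elim by (simp add: exit_disc_def set_lebesgue_integral_def)
      then show ?case using elim W_neg[of "exit_pos 0 c x z"] by (auto simp: indicator_def)
    qed
  qed measurable
  also have "\<dots> = W c * prob ?A + W 0 * prob {z \<in> space M. z \<notin> ?A \<and> exit_pos 0 c x z = 0}"
    by (subst Bochner_Integration.integral_add) (auto intro!: integrable_mult_right integrable_real_indicator simp: less_top[symmetric])
  finally have eq: "W x = W c * prob ?A + W 0 * prob {z \<in> space M. z \<notin> ?A \<and> exit_pos 0 c x z = 0}" .
  moreover have "0 \<le> W 0 * prob {z \<in> space M. z \<notin> ?A \<and> exit_pos 0 c x z = 0}" by (simp add: W_nonneg)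
  \<comment> \<open>The identity consists of the contribution from \<open>c\<close> and a
    nonnegative term for creeping to 0, while \<open>ge\<close> bounds \<open>W x\<close> by the
    contribution from \<open>c\<close> alone.\<close>
  ultimately have zero: "W 0 * prob {z \<in> space M. z \<notin> ?A \<and> exit_pos 0 c x z = 0} = 0" using ge by linarith
  show "W x = W c * prob ?A" using eq zero by simp
  show "AE z in M. z \<notin> ?A \<longrightarrow> W (exit_pos 0 c x z) = 0"
  proof (cases "W 0 = 0")
    case True
    show ?thesis using AE_exit[OF lc] by eventually_elim (use W_neg True in \<open>fastforce simp: less_eq_real_def\<close>)
  next
    case False
    then have "prob {z \<in> space M. z \<notin> ?A \<and> exit_pos 0 c x z = 0} = 0" using zero by simp
    then have "AE z in M. \<not> (z \<notin> ?A \<and> exit_pos 0 c x z = 0)" by (subst (asm) prob_Collect_eq_0) auto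
    then show ?thesis using AE_exit[OF lc] by eventually_elim (use W_neg in \<open>fastforce simp: less_eq_real_def\<close>)
  qed
qed

(* If W(x) = 0 then Y would leave [0, c] only through 0, and the martingale exp(theta Y_t - psi(theta) t)
   would give exp(theta x) <= 1. *)
lemma W_pos:
  assumes "0 < x"
  shows "0 < W x"
proof (rule ccontr)
  assume "\<not> 0 < W x"
  then have Wx: "W x = 0" using W_nonneg[of x] by simp
  obtain v where v: "0 < W v" using W_not_zero by blast
  define c where "c = max v (x + 1)"
  have c: "x < c" "0 < W c" using v W_mono_UNIV[of v c] by (auto simp: c_def)
  have lc: "0 < c" "x \<in> {0..c}" using c assms by auto
  have "prob (up_exit 0 c x) = 0" using W_two_sided_exit(1)[of x c] Wx c assms by simp
  then have "AE z in M. z \<notin> up_exit 0 c x" by (simp add: prob_eq_0)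
  then have low: "AE z in M. exit_pos 0 c x z \<le> 0" using AE_exit[OF lc] by eventually_elim auto
  define \<theta> where "\<theta> = \<theta>0 + 1"
  have th: "0 < \<theta>" "\<theta>0 < \<theta>" by (auto simp: \<theta>_def \<theta>0_def)
  let ?k = "\<lambda>_::real. \<psi> \<theta>"
  have pp: "0 < \<psi> \<theta>" by (rule \<psi>_pos[OF th(2)])
  have tr: "transition h (\<lambda>y. exp (\<theta> * y)) y = exp (h * \<psi> \<theta>) * exp (\<theta> * y)" if "0 \<le> h" for h y
  proof -
    have [measurable]: "X h \<in> borel_measurable M" "X 0 \<in> borel_measurable M" using that by auto
    have "expectation (\<lambda>z. exp (\<theta> * (X h z - X 0 z))) = exp (h * \<psi> \<theta>)"
      using increment_exp_moment[OF lap less_imp_le[OF th(1)] that] by (subst integral_eq_nn_integral) auto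
    moreover have "transition h (\<lambda>y. exp (\<theta> * y)) y = expectation (\<lambda>z. exp (\<theta> * y) * exp (\<theta> * (X h z - X 0 z)))"
      unfolding transition_def by (simp add: exp_add[symmetric] distrib_left)
    ultimately show ?thesis by simp
  qed
  have [measurable]: "exit_disc ?k 0 c x \<in> borel_measurable M" by (rule exit_measurable(2)) simp
  have d1: "exit_disc ?k 0 c x z \<le> 1" for z using pp by (intro exit_disc_le_1) simp
  have "exp (\<theta> * x) \<le> expectation (\<lambda>z. exit_disc ?k 0 c x z * exp (\<theta> * exit_pos 0 c x z))"
  proof (rule exit_lower[OF lc, where C=1 and B="exp (\<theta> * c)" and U="\<lambda>y. exp (\<theta> * y)"])
    fix e :: real assume "0 < e"
    have "\<forall>\<^sub>F h in at_right (0::real). 0 < h" by (simp add: eventually_at_filter)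
    then show "\<forall>\<^sub>F h in at_right 0. \<forall>y\<in>{0..c}. exp (\<theta> * y) - h * e \<le> exp (- h * \<psi> \<theta>) * transition h (\<lambda>y. exp (\<theta> * y)) y"
    proof eventually_elim
      case (elim h)
      have "exp (- h * \<psi> \<theta>) * transition h (\<lambda>y. exp (\<theta> * y)) y = exp (\<theta> * y)" for y
        using tr[of h y] elim by (simp add: mult.assoc[symmetric] exp_add[symmetric])
      then show ?case using elim \<open>0 < e\<close> by simp
    qed
  next
    show "\<bar>exp (\<theta> * y)\<bar> \<le> 1 * (1 + exp ((\<theta>0 + 1) * y))" for y by (simp add: \<theta>_def)
    show "\<bar>exp (\<theta> * y)\<bar> \<le> exp (\<theta> * c)" if "y \<le> c" for y using that th(1) by simp
  qed (use pp in \<open>auto intro!: continuous_intros\<close>)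
  also have "\<dots> \<le> expectation (\<lambda>z. 1)"
  proof (rule integral_mono_AE)
    show "AE z in M. exit_disc ?k 0 c x z * exp (\<theta> * exit_pos 0 c x z) \<le> 1"
      using low
    proof eventually_elim
      case (elim z)
      have "exit_disc ?k 0 c x z * exp (\<theta> * exit_pos 0 c x z) \<le> 1 * 1"
        using elim th(1) d1 exit_disc_nonneg by (intro mult_mono) (auto simp: mult_le_0_iff)
      then show ?case by simp
    qed
    show "integrable M (\<lambda>z. exit_disc ?k 0 c x z * exp (\<theta> * exit_pos 0 c x z))"
    proof (rule integrable_const_bound[of _ 1])
      show "AE z in M. norm (exit_disc ?k 0 c x z * exp (\<theta> * exit_pos 0 c x z)) \<le> 1"
        using low
      proof eventually_elim
        case (elim z)
        have "exit_disc ?k 0 c x z * exp (\<theta> * exit_pos 0 c x z) \<le> 1 * 1"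
          using elim th(1) d1 exit_disc_nonneg by (intro mult_mono) (auto simp: mult_le_0_iff)
        then show ?case using exit_disc_nonneg by (simp add: abs_mult)
      qed
    qed measurable
  qed simp
  finally have "exp (\<theta> * x) \<le> 1" by (simp add: prob_space)
  then show False using th(1) assms by (simp add: mult_le_0_iff)
qed

text \<open>The cut-off at \<open>c\<close> turns the Volterra term into a convolution with a
  density of compact support; for y \<le> c nothing is lost, as \<open>W\<close> vanishes on
  negative arguments.\<close>

lemma scale_equation_conv:
  assumes om: "continuous_on UNIV \<omega>" and H[measurable]: "H \<in> borel_measurable borel" and lb: "locally_bounded H" and c: "0 \<le> c"
  obtains G where "bounded_support 0 c G (\<lambda>u. \<omega> u * H u * indicator {0..c} u)"
    and "\<And>y. y \<le> c \<Longrightarrow> (LINT u:{0..y}|lborel. W (y - u) * \<omega> u * H u) = conv (\<lambda>u. \<omega> u * H u * indicator {0..c} u) y"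
proof -
  have [measurable]: "\<omega> \<in> borel_measurable borel" using om by (rule borel_measurable_continuous_onI)
  have "bounded (\<omega> ` {0..c})"
    by (intro compact_imp_bounded compact_continuous_image continuous_on_subset[OF om]) auto
  then obtain b1 where b1: "\<forall>v\<in>\<omega> ` {0..c}. norm v \<le> b1" unfolding bounded_iff by blast
  have "bounded (H ` {0..c})" using lb unfolding locally_bounded_def by blast
  then obtain b2 where b2: "\<forall>v\<in>H ` {0..c}. norm v \<le> b2" unfolding bounded_iff by blast
  have b12: "0 \<le> b1" "0 \<le> b2" using b1 b2 c by fastforce+
  have bs: "bounded_support 0 c (b1 * b2) (\<lambda>u. \<omega> u * H u * indicator {0..c} u)"
    unfolding bounded_support_def
  proof (intro conjI allI impI)
    fix u
    show "\<bar>\<omega> u * H u * indicator {0..c} u\<bar> \<le> b1 * b2"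
    proof (cases "u \<in> {0..c}")
      case True
      then have "\<bar>\<omega> u\<bar> * \<bar>H u\<bar> \<le> b1 * b2" using b1 b2 b12 by (intro mult_mono) auto
      then show ?thesis using True by (simp add: abs_mult)
    qed (use b12 in simp)
  qed (use c in auto)
  have "(LINT u:{0..y}|lborel. W (y - u) * \<omega> u * H u) = conv (\<lambda>u. \<omega> u * H u * indicator {0..c} u) y" if "y \<le> c" for y
    unfolding set_lebesgue_integral_def conv_def
    by (intro Bochner_Integration.integral_cong refl) (use that W_neg in \<open>auto simp: indicator_def\<close>)
  with bs show ?thesis by (rule that)
qed

text \<open>At a downward exit the first function vanishes almost surely and the second equals 1, so
  both formulas can be read off from \<open>omega_exit_identity\<close>. If the first function
  vanished at \<open>c\<close>, it would vanish on all of (0, c], and its integral equation at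
  \<open>c\<close> would give \<open>W c = 0\<close>, contrary to \<open>W_pos\<close>.\<close>

theorem omega_exit_identities:
  assumes x: "0 < x" "x < c" and om: "continuous_on UNIV \<omega>" "\<And>y. 0 \<le> \<omega> y"
    and WO: "omega_scale_W W \<omega> W\<omega>" and ZO: "omega_scale_Z W \<omega> Z\<omega>"
  shows "W\<omega> c \<noteq> 0"
    and "W\<omega> x = W\<omega> c * expectation (\<lambda>z. exit_disc \<omega> 0 c x z * indicator (up_exit 0 c x) z)"
    and "Z\<omega> x = Z\<omega> c * expectation (\<lambda>z. exit_disc \<omega> 0 c x z * indicator (up_exit 0 c x) z)
           + expectation (\<lambda>z. exit_disc \<omega> 0 c x z * indicator (space M - up_exit 0 c x) z)"
proof -
  have c: "0 < c" using x by simp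
  have Wm[measurable]: "W\<omega> \<in> borel_measurable borel" and Wlb: "locally_bounded W\<omega>"
    and We: "\<And>x. W\<omega> x = W x + (LINT y:{0..x}|lborel. W (x - y) * \<omega> y * W\<omega> y)"
    using WO unfolding omega_scale_W_def by blast+
  have Zm[measurable]: "Z\<omega> \<in> borel_measurable borel" and Zlb: "locally_bounded Z\<omega>"
    and Ze: "\<And>x. Z\<omega> x = 1 + (LINT y:{0..x}|lborel. W (x - y) * \<omega> y * Z\<omega> y)"
    using ZO unfolding omega_scale_Z_def by blast+
  have [measurable]: "\<omega> \<in> borel_measurable borel" using om(1) by (rule borel_measurable_continuous_onI)
  have Wneg: "W\<omega> y = 0" if "y < 0" for y using We[of y] W_neg[OF that] that by (simp add: set_lebesgue_integral_def)
  have W0: "W\<omega> 0 = W 0"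
  proof -
    have "(LINT y:{0..0::real}|lborel. W (0 - y) * \<omega> y * W\<omega> y) = integral\<^sup>L (lborel :: real measure) (\<lambda>_. 0)"
      unfolding set_lebesgue_integral_def
      by (rule integral_cong_AE) (use AE_lborel_singleton[of "0::real"] in \<open>auto elim: eventually_mono\<close>)
    then show ?thesis using We[of 0] by simp
  qed
  have Zneg: "Z\<omega> y = 1" if "y \<le> 0" for y
  proof -
    have "(LINT u:{0..y}|lborel. W (y - u) * \<omega> u * Z\<omega> u) = integral\<^sup>L (lborel :: real measure) (\<lambda>_. 0)"
      unfolding set_lebesgue_integral_def
      by (rule integral_cong_AE) (use AE_lborel_singleton[of "0::real"] that in \<open>auto elim!: eventually_mono simp: indicator_def\<close>)
    then show ?thesis using Ze[of y] by simp
  qed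
  obtain GW where GW: "bounded_support 0 c GW (\<lambda>u. \<omega> u * W\<omega> u * indicator {0..c} u)"
    and cW: "\<And>y. y \<le> c \<Longrightarrow> (LINT u:{0..y}|lborel. W (y - u) * \<omega> u * W\<omega> u) = conv (\<lambda>u. \<omega> u * W\<omega> u * indicator {0..c} u) y"
    using scale_equation_conv[OF om(1) Wm Wlb less_imp_le[OF c]] by blast
  obtain GZ where GZ: "bounded_support 0 c GZ (\<lambda>u. \<omega> u * Z\<omega> u * indicator {0..c} u)"
    and cZ: "\<And>y. y \<le> c \<Longrightarrow> (LINT u:{0..y}|lborel. W (y - u) * \<omega> u * Z\<omega> u) = conv (\<lambda>u. \<omega> u * Z\<omega> u * indicator {0..c} u) y"
    using scale_equation_conv[OF om(1) Zm Zlb less_imp_le[OF c]] by blast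
  have WH: "W\<omega> y = 0 + 1 * W y + conv (\<lambda>u. \<omega> u * W\<omega> u * indicator {0..c} u) y" if "y \<le> c" for y
    by (subst We) (simp add: cW[OF that])
  have ZH: "Z\<omega> y = 1 + 0 * W y + conv (\<lambda>u. \<omega> u * Z\<omega> u * indicator {0..c} u) y" if "y \<le> c" for y
    by (subst Ze) (simp add: cZ[OF that])
  let ?A = "\<lambda>x. up_exit 0 c x"
  have dm[measurable]: "exit_disc \<omega> 0 c x \<in> borel_measurable M" for x by (rule exit_measurable(2)[OF om(1)])
  \<comment> \<open>All starting points up to \<open>c\<close> are included, since the proof that
    \<open>W\<omega> c\<close> is nonzero uses the identity throughout (0, c].\<close>
  have WI: "W\<omega> x = W\<omega> c * expectation (\<lambda>z. exit_disc \<omega> 0 c x z * indicator (?A x) z)" if x: "0 < x" "x \<le> c" for x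
  proof -
    have lc: "0 < c" "x \<in> {0..c}" using x by auto
    have "W\<omega> x = expectation (\<lambda>z. exit_disc \<omega> 0 c x z * W\<omega> (exit_pos 0 c x z))"
      by (rule omega_exit_identity[where a=1 and \<kappa>=0, OF lc om _ Wm GW WH]) simp_all
    also have "\<dots> = expectation (\<lambda>z. W\<omega> c * (exit_disc \<omega> 0 c x z * indicator (?A x) z))"
    proof (rule integral_cong_AE)
      show "AE z in M. exit_disc \<omega> 0 c x z * W\<omega> (exit_pos 0 c x z) = W\<omega> c * (exit_disc \<omega> 0 c x z * indicator (?A x) z)"
        using AE_exit[OF lc] W_two_sided_exit(2)[OF x]
      proof eventually_elim
        case (elim z)
        show ?case
        proof (cases "z \<in> ?A x")
          case True
          then have "exit_pos 0 c x z = c" using elim by blast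
          moreover have "indicator (?A x) z = (1::real)" using True by (rule indicator_simps)
          ultimately show ?thesis by (simp add: mult.commute)
        next
          case False
          then have "exit_pos 0 c x z \<le> 0" "W (exit_pos 0 c x z) = 0" using elim by auto
          \<comment> \<open>At 0 the two scale functions agree, so the exclusion of creeping for
            \<open>W\<close> also serves \<open>W\<omega>\<close>.\<close>
          then have "W\<omega> (exit_pos 0 c x z) = 0" using Wneg W0 by (cases "exit_pos 0 c x z = 0") auto
          then show ?thesis using False by simp
        qed
      qed
    qed measurable
    finally show ?thesis by simp
  qed
  show "W\<omega> x = W\<omega> c * expectation (\<lambda>z. exit_disc \<omega> 0 c x z * indicator (?A x) z)"
    using x by (intro WI) auto
  show "W\<omega> c \<noteq> 0"
  proof
    assume z: "W\<omega> c = 0"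
    have "conv (\<lambda>u. \<omega> u * W\<omega> u * indicator {0..c} u) c = integral\<^sup>L (lborel :: real measure) (\<lambda>_. 0)"
      unfolding conv_def
    proof (rule integral_cong_AE)
      show "AE u in lborel. W (c - u) * (\<omega> u * W\<omega> u * indicator {0..c} u) = 0"
        using AE_lborel_singleton[of "0::real"]
      proof eventually_elim
        case (elim u)
        show ?case
        proof (cases "u \<in> {0..c}")
          case True
          then have "W\<omega> u = 0" using WI[of u] z elim by auto
          then show ?thesis by simp
        qed simp
      qed
      show "(\<lambda>u. W (c - u) * (\<omega> u * W\<omega> u * indicator {0..c} u)) \<in> borel_measurable lborel"
        using conv_bound(2)[OF GW, of c] by (rule borel_measurable_integrable)
    qed simp
    then have "W\<omega> c = W c" using WH[of c] by simp
    then show False using z W_pos[OF c] by simp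
  qed
  have lc: "0 < c" "x \<in> {0..c}" using x by auto
  have Zx: "Z\<omega> x = expectation (\<lambda>z. exit_disc \<omega> 0 c x z * Z\<omega> (exit_pos 0 c x z))"
    by (rule omega_exit_identity[where a=0 and \<kappa>=1, OF lc om _ Zm GZ ZH]) simp_all
  also have "\<dots> = expectation (\<lambda>z. Z\<omega> c * (exit_disc \<omega> 0 c x z * indicator (?A x) z) + exit_disc \<omega> 0 c x z * indicator (space M - ?A x) z)"
  proof (rule integral_cong_AE)
    show "AE z in M. exit_disc \<omega> 0 c x z * Z\<omega> (exit_pos 0 c x z) =
        Z\<omega> c * (exit_disc \<omega> 0 c x z * indicator (?A x) z) + exit_disc \<omega> 0 c x z * indicator (space M - ?A x) z"
      using AE_exit[OF lc] by eventually_elim (use Zneg in auto)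
  qed measurable
  also have "\<dots> = Z\<omega> c * expectation (\<lambda>z. exit_disc \<omega> 0 c x z * indicator (?A x) z) + expectation (\<lambda>z. exit_disc \<omega> 0 c x z * indicator (space M - ?A x) z)"
  proof -
    have "integrable M (\<lambda>z. exit_disc \<omega> 0 c x z * indicator B z)" if [measurable]: "B \<in> sets M" for B
      by (rule integrable_const_bound[of _ 1])
        (use exit_disc_le_1[where k=\<omega>, OF om(2)] exit_disc_nonneg in \<open>auto simp: indicator_def\<close>)
    from this[of "?A x"] this[of "space M - ?A x"] show ?thesis by simp
  qed
  finally show "Z\<omega> x = Z\<omega> c * expectation (\<lambda>z. exit_disc \<omega> 0 c x z * indicator (?A x) z)
           + expectation (\<lambda>z. exit_disc \<omega> 0 c x z * indicator (space M - ?A x) z)" .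
qed

end

section \<open>The Lamperti time change\<close>

text \<open>The additive functional inverted by \<open>lamperti_time\<close>, as a functional of a
  single path.\<close>

definition clock :: "real \<Rightarrow> (real \<Rightarrow> real) \<Rightarrow> real \<Rightarrow> real" where
  "clock \<xi> f s = (LINT w:{0..s}|lborel. exp (- \<xi> * f w))"

lemma clock_integrable:
  assumes "cadlag_path f" "0 \<le> a"
  shows "set_integrable lborel {a..t} (\<lambda>w. exp (- \<xi> * f w))"
  by (rule cadlag_path_set_integrable[where k="\<lambda>y. exp (- \<xi> * y)", OF assms(1) _ assms(2)])
     (intro continuous_intros)

lemma clock_diff:
  assumes f: "cadlag_path f" and "0 \<le> s" "s \<le> t"
  shows "clock \<xi> f t - clock \<xi> f s = (LINT w:{s..t}|lborel. exp (- \<xi> * f w))"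
proof -
  let ?g = "\<lambda>w. exp (- \<xi> * f w)"
  have i1: "set_integrable lborel {0..s} ?g" "set_integrable lborel {s..t} ?g"
    using clock_integrable[OF f] assms by auto
  have i2: "set_integrable lborel {s<..t} ?g"
    by (rule set_integrable_subset[OF i1(2)]) auto
  have un: "{0..t} = {0..s} \<union> {s<..t}" and dj: "{0..s} \<inter> {s<..t} = {}" using assms by auto
  have "clock \<xi> f t = clock \<xi> f s + (LINT w:{s<..t}|lborel. ?g w)"
    unfolding clock_def un by (rule set_integral_Un[OF dj i1(1) i2])
  moreover have "(LINT w:{s<..t}|lborel. ?g w) = (LINT w:{s..t}|lborel. ?g w)"
    unfolding set_lebesgue_integral_def
  proof (rule integral_cong_AE)
    show "(\<lambda>w. indicat_real {s<..t} w *\<^sub>R ?g w) \<in> borel_measurable lborel"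
      using i2 unfolding set_integrable_def by (rule borel_measurable_integrable)
    show "(\<lambda>w. indicat_real {s..t} w *\<^sub>R ?g w) \<in> borel_measurable lborel"
      using i1(2) unfolding set_integrable_def by (rule borel_measurable_integrable)
    show "AE w in lborel. indicat_real {s<..t} w *\<^sub>R ?g w = indicat_real {s..t} w *\<^sub>R ?g w"
      using AE_lborel_singleton[of s] by eventually_elim (auto simp: indicator_def)
  qed
  ultimately show ?thesis by simp
qed

text \<open>The path is bounded on [0, t], so the integrand is bounded above and away from 0 there.
  The two constants are the source of the continuity and the strict monotonicity of the
  clock.\<close>

lemma clock_increment_bounds:
  assumes f: "cadlag_path f"
  obtains m K where "0 < m" "\<And>s u. 0 \<le> s \<Longrightarrow> s \<le> u \<Longrightarrow> u \<le> t \<Longrightarrow> m * (u - s) \<le> clock \<xi> f u - clock \<xi> f s"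
    "\<And>s u. 0 \<le> s \<Longrightarrow> s \<le> u \<Longrightarrow> u \<le> t \<Longrightarrow> clock \<xi> f u - clock \<xi> f s \<le> K * (u - s)"
proof -
  obtain B where B: "\<And>s. s \<in> {0..t} \<Longrightarrow> \<bar>f s\<bar> \<le> B" using cadlag_path_bounded[OF f] by metis
  let ?m = "exp (- \<bar>\<xi>\<bar> * B)" and ?K = "exp (\<bar>\<xi>\<bar> * B)"
  have bd: "?m \<le> exp (- \<xi> * f w)" "exp (- \<xi> * f w) \<le> ?K" if "w \<in> {0..t}" for w
  proof -
    have "\<bar>\<xi> * f w\<bar> \<le> \<bar>\<xi>\<bar> * B" unfolding abs_mult using B[OF that] by (intro mult_left_mono) auto
    then show "?m \<le> exp (- \<xi> * f w)" "exp (- \<xi> * f w) \<le> ?K" by (auto simp: abs_le_iff)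
  qed
  have ci: "set_integrable lborel {s..u} (\<lambda>w. k)" for s u k :: real
    unfolding set_integrable_def by (auto intro!: integrable_mult_left integrable_real_indicator simp: emeasure_lborel_Icc_eq)
  show ?thesis
  proof (rule that[of ?m ?K])
    fix s u assume su: "0 \<le> s" "s \<le> u" "u \<le> t"
    have "?m * (u - s) = (LINT w:{s..u}|lborel. ?m)" using su by (simp add: set_lebesgue_integral_def)
    also have "\<dots> \<le> (LINT w:{s..u}|lborel. exp (- \<xi> * f w))"
      using su by (intro set_integral_mono ci clock_integrable[OF f] bd) auto
    finally show "?m * (u - s) \<le> clock \<xi> f u - clock \<xi> f s" by (simp add: clock_diff[OF f su(1,2)])
    have "(LINT w:{s..u}|lborel. exp (- \<xi> * f w)) \<le> (LINT w:{s..u}|lborel. ?K)"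
      using su by (intro set_integral_mono ci clock_integrable[OF f] bd) auto
    also have "\<dots> = ?K * (u - s)" using su by (simp add: set_lebesgue_integral_def)
    finally show "clock \<xi> f u - clock \<xi> f s \<le> ?K * (u - s)" by (simp add: clock_diff[OF f su(1,2)])
  qed simp
qed

lemma clock_strict_mono:
  assumes f: "cadlag_path f" and "0 \<le> s" "s < t"
  shows "clock \<xi> f s < clock \<xi> f t"
proof -
  obtain m where m: "0 < m" "\<And>s u. 0 \<le> s \<Longrightarrow> s \<le> u \<Longrightarrow> u \<le> t \<Longrightarrow> m * (u - s) \<le> clock \<xi> f u - clock \<xi> f s"
    using clock_increment_bounds[OF f, where t=t and \<xi>=\<xi>] by metis
  have "0 < m * (t - s)" using m(1) assms by simp
  then show ?thesis using m(2)[of s t] assms by simp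
qed

lemma clock_mono: "cadlag_path f \<Longrightarrow> 0 \<le> s \<Longrightarrow> s \<le> t \<Longrightarrow> clock \<xi> f s \<le> clock \<xi> f t"
  using clock_strict_mono[of f s t \<xi>] by (cases "s = t") auto

lemma clock_0: "clock \<xi> f 0 = 0"
proof -
  have "clock \<xi> f 0 = (LINT w|lborel. indicator {0::real} w *\<^sub>R exp (- \<xi> * f 0))"
    unfolding clock_def set_lebesgue_integral_def by (intro Bochner_Integration.integral_cong) (auto simp: indicator_def)
  then show ?thesis by simp
qed

lemma clock_nonneg: "0 \<le> clock \<xi> f s"
  unfolding clock_def set_lebesgue_integral_def by (intro Bochner_Integration.integral_nonneg) auto

lemma clock_continuous:
  assumes f: "cadlag_path f"
  shows "continuous_on {0..t} (clock \<xi> f)"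
proof -
  obtain m K where m: "0 < m" "\<And>s u. 0 \<le> s \<Longrightarrow> s \<le> u \<Longrightarrow> u \<le> t \<Longrightarrow> m * (u - s) \<le> clock \<xi> f u - clock \<xi> f s"
    and K: "\<And>s u. 0 \<le> s \<Longrightarrow> s \<le> u \<Longrightarrow> u \<le> t \<Longrightarrow> clock \<xi> f u - clock \<xi> f s \<le> K * (u - s)"
    using clock_increment_bounds[OF f, where t=t and \<xi>=\<xi>] by metis
  have L: "\<bar>clock \<xi> f u - clock \<xi> f s\<bar> \<le> \<bar>K\<bar> * \<bar>u - s\<bar>" if "0 \<le> s" "s \<le> u" "u \<le> t" for s u
  proof -
    have "K * (u - s) \<le> \<bar>K\<bar> * \<bar>u - s\<bar>" by (metis abs_ge_self abs_mult)
    then show ?thesis using K[OF that] clock_mono[OF f that(1,2), of \<xi>] by simp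
  qed
  have L': "dist (clock \<xi> f u) (clock \<xi> f s) \<le> \<bar>K\<bar> * dist u s" if "u \<in> {0..t}" "s \<in> {0..t}" for u s
    using L[of s u] L[of u s] that by (cases "s \<le> u") (auto simp: dist_real_def abs_minus_commute)
  have "\<bar>K\<bar>-lipschitz_on {0..t} (clock \<xi> f)"
    by (rule lipschitz_onI) (use L' in auto)
  then show ?thesis by (rule lipschitz_on_continuous_on)
qed

lemma clock_nn_integral:
  assumes f: "cadlag_path f"
  shows "ennreal (clock \<xi> f s) = (\<integral>\<^sup>+w\<in>{0..s}. ennreal (exp (- \<xi> * f w)) \<partial>lborel)"
proof -
  have "(\<integral>\<^sup>+w. ennreal (indicator {0..s} w *\<^sub>R exp (- \<xi> * f w)) \<partial>lborel) = ennreal (clock \<xi> f s)"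
    unfolding clock_def set_lebesgue_integral_def
    using clock_integrable[OF f order_refl, of s \<xi>] unfolding set_integrable_def
    by (intro nn_integral_eq_integral) auto
  moreover have "(\<integral>\<^sup>+w. ennreal (indicator {0..s} w *\<^sub>R exp (- \<xi> * f w)) \<partial>lborel) = (\<integral>\<^sup>+w\<in>{0..s}. ennreal (exp (- \<xi> * f w)) \<partial>lborel)"
    by (intro nn_integral_cong) (auto simp: indicator_def)
  ultimately show ?thesis by simp
qed

lemma clock_less_lifetime:
  assumes f: "cadlag_path (\<lambda>t. X t z)" and "0 \<le> s"
  shows "ennreal (clock \<xi> (\<lambda>t. X t z) s) < lamperti_lifetime \<xi> X z"
proof -
  have "ennreal (clock \<xi> (\<lambda>t. X t z) s) < ennreal (clock \<xi> (\<lambda>t. X t z) (s + 1))"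
    using clock_strict_mono[OF f \<open>0 \<le> s\<close>, of "s + 1" \<xi>] clock_nonneg by (simp add: ennreal_less_iff)
  also have "\<dots> \<le> lamperti_lifetime \<xi> X z"
    unfolding clock_nn_integral[OF f] lamperti_lifetime_def by (intro nn_integral_mono) (auto simp: indicator_def)
  finally show ?thesis .
qed

text \<open>By monotone convergence the lifetime is the supremum of the clock over integer
  times.\<close>

lemma clock_exhausts_lifetime:
  assumes f: "cadlag_path (\<lambda>t. X t z)" and t: "ennreal t < lamperti_lifetime \<xi> X z"
  obtains n :: nat where "t < clock \<xi> (\<lambda>t. X t z) (real n)"
proof -
  let ?f = "\<lambda>t. X t z"
  let ?F = "\<lambda>n w. ennreal (exp (- \<xi> * ?f w)) * indicator {0..real n} w"
  have m: "(\<lambda>w. ennreal (exp (- \<xi> * ?f w)) * indicator {0..real n} w) \<in> borel_measurable lborel" for n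
  proof -
    have [measurable]: "(\<lambda>s. X (max 0 s) z) \<in> borel_measurable borel" by (rule cadlag_path_borel_measurable[OF f])
    have "(\<lambda>w. ennreal (exp (- \<xi> * ?f (max 0 w))) * indicator {0..real n} w) \<in> borel_measurable lborel" by measurable
    moreover have "(\<lambda>w. ennreal (exp (- \<xi> * ?f (max 0 w))) * indicator {0..real n} w) = ?F n"
      by (auto simp: fun_eq_iff indicator_def max_def)
    ultimately show ?thesis by (simp only:)
  qed
  have sup: "(SUP n. ?F n w) = ennreal (exp (- \<xi> * ?f w)) * indicator {0..} w" for w
  proof (cases "0 \<le> w")
    case True
    obtain N where N: "w \<le> real N" using real_arch_simple by blast
    have "(SUP n. ?F n w) \<le> ennreal (exp (- \<xi> * ?f w))" by (rule SUP_least) (auto simp: indicator_def)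
    moreover have "ennreal (exp (- \<xi> * ?f w)) \<le> (SUP n. ?F n w)" using N True by (intro SUP_upper2[of N]) auto
    ultimately show ?thesis using True by (simp add: antisym)
  qed (simp add: indicator_def)
  have inc: "incseq ?F" by (auto simp: incseq_def le_fun_def indicator_def)
  have "lamperti_lifetime \<xi> X z = (\<integral>\<^sup>+w. (SUP n. ?F n w) \<partial>lborel)" unfolding lamperti_lifetime_def sup ..
  also have "\<dots> = (SUP n. \<integral>\<^sup>+w. ?F n w \<partial>lborel)" by (rule nn_integral_monotone_convergence_SUP[OF inc m])
  also have "\<dots> = (SUP n. ennreal (clock \<xi> ?f (real n)))" by (simp add: clock_nn_integral[OF f])
  finally have "ennreal t < (SUP n. ennreal (clock \<xi> ?f (real n)))" using t by simp
  then obtain n :: nat where "ennreal t < ennreal (clock \<xi> ?f (real n))" by (auto simp: less_SUP_iff)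
  then have "t < clock \<xi> ?f (real n)" using clock_nonneg[of \<xi> ?f "real n"] by (metis ennreal_less_iff ennreal_neg less_le not_le order_less_le_trans)
  then show ?thesis by (rule that)
qed

lemma lamperti_time_clock:
  assumes f: "cadlag_path (\<lambda>t. X t z)" and "0 \<le> s"
  shows "lamperti_time \<xi> X (clock \<xi> (\<lambda>t. X t z) s) z = s"
proof -
  have "{r. 0 \<le> r \<and> clock \<xi> (\<lambda>t. X t z) s \<le> clock \<xi> (\<lambda>t. X t z) r} = {s..}"
    using clock_mono[OF f, of s] clock_strict_mono[OF f, of _ s] \<open>0 \<le> s\<close> by (auto simp: not_less[symmetric])
  then show ?thesis unfolding lamperti_time_def clock_def[symmetric] by (simp add: clock_def)
qed

text \<open>The clock is an increasing bijection of the positive times onto the times strictly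
  between 0 and the lifetime, and \<open>lamperti_time\<close> is its inverse; surjectivity is the
  intermediate value theorem. So passage times of the transformed process are clock values of
  passage times of \<open>X\<close>.\<close>

lemma lamperti_passage_times:
  assumes f: "cadlag_path (\<lambda>t. X t z)"
  shows "{ennreal t |t. 0 < t \<and> ennreal t < lamperti_lifetime \<xi> X z \<and> P (lamperti_pssmp \<xi> X t z)}
    = {ennreal (clock \<xi> (\<lambda>t. X t z) s) |s. 0 < s \<and> P (exp (- X s z))}"
proof (intro equalityI subsetI)
  fix v assume "v \<in> {ennreal t |t. 0 < t \<and> ennreal t < lamperti_lifetime \<xi> X z \<and> P (lamperti_pssmp \<xi> X t z)}"
  then obtain t where t: "v = ennreal t" "0 < t" "ennreal t < lamperti_lifetime \<xi> X z" "P (lamperti_pssmp \<xi> X t z)" by blast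
  obtain n :: nat where n: "t < clock \<xi> (\<lambda>t. X t z) (real n)" using clock_exhausts_lifetime[where X=X, OF f t(3)] by blast
  have "\<exists>s. 0 \<le> s \<and> s \<le> real n \<and> clock \<xi> (\<lambda>t. X t z) s = t"
    using n t(2) by (intro IVT' clock_continuous[OF f]) (auto simp: clock_0)
  then obtain s where s: "0 \<le> s" "clock \<xi> (\<lambda>t. X t z) s = t" by blast
  then have "0 < s" using t(2) clock_0[of \<xi> "\<lambda>t. X t z"] by (cases "s = 0") auto
  moreover have "lamperti_time \<xi> X t z = s" using lamperti_time_clock[where X=X, OF f s(1), of \<xi>] s(2) by simp
  ultimately show "v \<in> {ennreal (clock \<xi> (\<lambda>t. X t z) s) |s. 0 < s \<and> P (exp (- X s z))}"
    using t(1,4) s(2) unfolding lamperti_pssmp_def by (intro CollectI exI[of _ s]) simp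
next
  fix v assume "v \<in> {ennreal (clock \<xi> (\<lambda>t. X t z) s) |s. 0 < s \<and> P (exp (- X s z))}"
  then obtain s where s: "v = ennreal (clock \<xi> (\<lambda>t. X t z) s)" "0 < s" "P (exp (- X s z))" by blast
  have "0 < clock \<xi> (\<lambda>t. X t z) s" using clock_strict_mono[OF f order_refl s(2), of \<xi>] by (simp add: clock_0)
  moreover have "lamperti_pssmp \<xi> X (clock \<xi> (\<lambda>t. X t z) s) z = exp (- X s z)"
    unfolding lamperti_pssmp_def using lamperti_time_clock[where X=X, OF f less_imp_le[OF s(2)], of \<xi>] by simp
  ultimately show "v \<in> {ennreal t |t. 0 < t \<and> ennreal t < lamperti_lifetime \<xi> X z \<and> P (lamperti_pssmp \<xi> X t z)}"
    using s clock_less_lifetime[where X=X, OF f less_imp_le[OF s(2)], of \<xi>] by auto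
qed

section \<open>Passage times expressed through the clock\<close>

definition clock_hit :: "real \<Rightarrow> (real \<Rightarrow> real) \<Rightarrow> real set \<Rightarrow> ennreal" where
  "clock_hit \<xi> f S = Inf {ennreal (clock \<xi> f s) |s. 0 < s \<and> f s \<in> S}"

lemma passage_above_clock_hit:
  assumes "cadlag_path (\<lambda>t. X t z)"
  shows "passage_above \<xi> X (exp (- b)) z = clock_hit \<xi> (\<lambda>t. X t z) {..<b}"
  unfolding passage_above_def clock_hit_def lamperti_passage_times[where X=X and P="\<lambda>v. v > exp (- b)", OF assms]
  by (simp add: lessThan_def)

lemma passage_below_clock_hit:
  assumes "cadlag_path (\<lambda>t. X t z)"
  shows "passage_below \<xi> X (exp (- c)) z = clock_hit \<xi> (\<lambda>t. X t z) {c<..}"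
  unfolding passage_below_def clock_hit_def lamperti_passage_times[where X=X and P="\<lambda>v. v < exp (- c)", OF assms]
  by (simp add: greaterThan_def)

lemma clock_right_approx:
  assumes f: "cadlag_path f" and "0 \<le> s" "0 < e"
  obtains d where "0 < d" "\<And>u. s \<le> u \<Longrightarrow> u < s + d \<Longrightarrow> clock \<xi> f u < clock \<xi> f s + e"
proof -
  have "isCont (\<lambda>u. clock \<xi> f (max 0 (min (s + 1) u))) s"
  proof -
    have "continuous_on UNIV (\<lambda>u. clock \<xi> f (max 0 (min (s + 1) u)))"
      by (rule continuous_on_compose2[OF clock_continuous[OF f, of "s + 1"]])
        (use \<open>0 \<le> s\<close> in \<open>auto intro!: continuous_intros\<close>)
    then show ?thesis by (simp add: continuous_on_eq_continuous_at)
  qed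
  from this[unfolded isCont_def, THEN order_tendstoD(2), of "clock \<xi> f s + e"]
  have "\<forall>\<^sub>F u in at s. clock \<xi> f (max 0 (min (s + 1) u)) < clock \<xi> f s + e" using \<open>0 \<le> s\<close> \<open>0 < e\<close> by simp
  then obtain d where d: "0 < d" "\<And>u. u \<noteq> s \<Longrightarrow> dist u s < d \<Longrightarrow> clock \<xi> f (max 0 (min (s + 1) u)) < clock \<xi> f s + e"
    unfolding eventually_at by auto
  show ?thesis
  proof (rule that[of "min d 1"])
    fix u assume u: "s \<le> u" "u < s + min d 1"
    show "clock \<xi> f u < clock \<xi> f s + e"
    proof (cases "u = s")
      case False
      have "max 0 (min (s + 1) u) = u" using u \<open>0 \<le> s\<close> by auto
      then show ?thesis using d(2)[OF False] u by (auto simp: dist_real_def)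
    qed (use \<open>0 < e\<close> in simp)
  qed (use d(1) in simp)
qed

text \<open>The path need not be in \<open>S\<close> at time \<open>T\<close>: visits arbitrarily
  soon afterwards suffice, because the clock is right-continuous.\<close>

lemma clock_hit_eq:
  assumes f: "cadlag_path f" and "0 < T" and low: "\<And>s. 0 < s \<Longrightarrow> f s \<in> S \<Longrightarrow> T \<le> s"
    and app: "\<And>e. 0 < e \<Longrightarrow> \<exists>s\<ge>T. s < T + e \<and> f s \<in> S"
  shows "clock_hit \<xi> f S = ennreal (clock \<xi> f T)"
proof (rule antisym)
  show "ennreal (clock \<xi> f T) \<le> clock_hit \<xi> f S"
    unfolding clock_hit_def using low \<open>0 < T\<close>
    by (intro Inf_greatest) (auto intro!: ennreal_leI clock_mono[OF f])
  show "clock_hit \<xi> f S \<le> ennreal (clock \<xi> f T)"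
  proof (rule ennreal_le_epsilon)
    fix e :: real assume "0 < e"
    obtain d where d: "0 < d" "\<And>u. T \<le> u \<Longrightarrow> u < T + d \<Longrightarrow> clock \<xi> f u < clock \<xi> f T + e"
      using clock_right_approx[OF f less_imp_le[OF \<open>0 < T\<close>] \<open>0 < e\<close>] by blast
    obtain s where s: "T \<le> s" "s < T + d" "f s \<in> S" using app[OF d(1)] by blast
    have "clock_hit \<xi> f S \<le> ennreal (clock \<xi> f s)"
      unfolding clock_hit_def using s \<open>0 < T\<close> by (intro Inf_lower) auto
    also have "\<dots> \<le> ennreal (clock \<xi> f T + e)" using d(2)[OF s(1,2)] by (intro ennreal_leI) simp
    also have "\<dots> = ennreal (clock \<xi> f T) + ennreal e" using clock_nonneg \<open>0 < e\<close> by simp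
    finally show "clock_hit \<xi> f S \<le> ennreal (clock \<xi> f T) + ennreal e" .
  qed
qed

lemma clock_hit_greater:
  assumes f: "cadlag_path f" and "0 < T" "0 < d" and low: "\<And>s. 0 < s \<Longrightarrow> f s \<in> S \<Longrightarrow> T + d \<le> s"
  shows "ennreal (clock \<xi> f T) < clock_hit \<xi> f S"
proof -
  have "ennreal (clock \<xi> f T) < ennreal (clock \<xi> f (T + d))"
    using clock_strict_mono[OF f, of T "T + d" \<xi>] assms(2,3) clock_nonneg by (simp add: ennreal_less_iff)
  also have "\<dots> \<le> clock_hit \<xi> f S"
    unfolding clock_hit_def using low assms(2,3)
    by (intro Inf_greatest) (auto intro!: ennreal_leI clock_mono[OF f])
  finally show ?thesis .
qed

text \<open>By definition of the exit time there are times outside [b, c] at or arbitrarily soon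
  after \<open>T\<close>. Right continuity keeps the path off the far barrier for a while, so these
  times lie beyond the near barrier, and the far one is passed strictly later. The position at
  \<open>T\<close> may equal \<open>b\<close> or \<open>c\<close>, while the hitting sets are open
  half-lines; hence the approximation from the right.\<close>

lemma clock_hit_order:
  assumes f: "cadlag_path f" and bc: "b < f 0" "f 0 < c" and s0: "0 \<le> s0" "f s0 \<notin> {b..c}"
  defines "T \<equiv> exit_inf b c f"
  shows "c \<le> f T \<Longrightarrow> clock_hit \<xi> f {c<..} = ennreal (clock \<xi> f T) \<and> ennreal (clock \<xi> f T) < clock_hit \<xi> f {..<b}"
    and "f T \<le> b \<Longrightarrow> clock_hit \<xi> f {..<b} = ennreal (clock \<xi> f T) \<and> ennreal (clock \<xi> f T) < clock_hit \<xi> f {c<..}"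
proof -
  have T0: "0 \<le> T" unfolding T_def by (rule exit_inf_nonneg[where f=f, OF s0])
  have out: "T \<le> s" if "0 < s" "f s \<notin> {b..c}" for s unfolding T_def using that by (intro exit_inf_le) auto
  have app: "\<exists>s\<ge>T. s < T + e \<and> f s \<notin> {b..c}" if "0 < e" for e
  proof (rule ccontr)
    assume n: "\<not> ?thesis"
    have "T + e \<le> T" unfolding T_def
    proof (rule exit_inf_ge[where f=f, OF s0])
      fix s assume "0 \<le> s" "s < exit_inf b c f + e"
      then show "f s \<in> {b..c}" using n before_exit_inf[of s b c f] unfolding T_def by (cases "exit_inf b c f \<le> s") auto
    qed
    then show False using that by simp
  qed
  have near: "\<exists>d>0. \<forall>s. T \<le> s \<longrightarrow> s < T + d \<longrightarrow> f s \<in> V" if V: "open V" "f T \<in> V" for V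
  proof -
    have "\<forall>\<^sub>F s in at_right T. f s \<in> V" by (rule topological_tendstoD[OF cadlag_path_right[OF f T0] V])
    then obtain q where q: "T < q" "\<And>s. T < s \<Longrightarrow> s < q \<Longrightarrow> f s \<in> V" by (auto simp: eventually_at_right_field)
    have "f s \<in> V" if "T \<le> s" "s < T + (q - T)" for s using q(2)[of s] V(2) that by (cases "s = T") auto
    then show ?thesis using q(1) by (intro exI[of _ "q - T"]) auto
  qed
  show "clock_hit \<xi> f {c<..} = ennreal (clock \<xi> f T) \<and> ennreal (clock \<xi> f T) < clock_hit \<xi> f {..<b}" if up: "c \<le> f T"
  proof -
    have Tp: "0 < T" using T0 up bc by (cases "T = 0") auto
    obtain d where d: "0 < d" "\<And>s. T \<le> s \<Longrightarrow> s < T + d \<Longrightarrow> f s \<in> {b<..}"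
      using near[of "{b<..}"] up bc by auto
    have "clock_hit \<xi> f {c<..} = ennreal (clock \<xi> f T)"
    proof (rule clock_hit_eq[OF f Tp])
      show "T \<le> s" if "0 < s" "f s \<in> {c<..}" for s using out[of s] that by auto
      show "\<exists>s\<ge>T. s < T + e \<and> f s \<in> {c<..}" if e: "0 < e" for e
      proof -
        have "0 < min e d" using e d(1) by simp
        from app[OF this] obtain s where s: "T \<le> s" "s < T + min e d" "f s \<notin> {b..c}" by blast
        then have "s < T + d" by linarith
        then show ?thesis using s d(2)[of s] by (intro exI[of _ s]) auto
      qed
    qed
    moreover have "ennreal (clock \<xi> f T) < clock_hit \<xi> f {..<b}"
    proof (rule clock_hit_greater[OF f Tp d(1)])
      fix s assume s: "0 < s" "f s \<in> {..<b}"
      show "T + d \<le> s" using d(2)[of s] out[of s] s by fastforce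
    qed
    ultimately show ?thesis ..
  qed
  show "clock_hit \<xi> f {..<b} = ennreal (clock \<xi> f T) \<and> ennreal (clock \<xi> f T) < clock_hit \<xi> f {c<..}" if down: "f T \<le> b"
  proof -
    have Tp: "0 < T" using T0 down bc by (cases "T = 0") auto
    obtain d where d: "0 < d" "\<And>s. T \<le> s \<Longrightarrow> s < T + d \<Longrightarrow> f s \<in> {..<c}"
      using near[of "{..<c}"] down bc by auto
    have "clock_hit \<xi> f {..<b} = ennreal (clock \<xi> f T)"
    proof (rule clock_hit_eq[OF f Tp])
      show "T \<le> s" if "0 < s" "f s \<in> {..<b}" for s using out[of s] that by auto
      show "\<exists>s\<ge>T. s < T + e \<and> f s \<in> {..<b}" if e: "0 < e" for e
      proof -
        have "0 < min e d" using e d(1) by simp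
        from app[OF this] obtain s where s: "T \<le> s" "s < T + min e d" "f s \<notin> {b..c}" by blast
        then have "s < T + d" by linarith
        then show ?thesis using s d(2)[of s] by (intro exI[of _ s]) auto
      qed
    qed
    moreover have "ennreal (clock \<xi> f T) < clock_hit \<xi> f {c<..}"
    proof (rule clock_hit_greater[OF f Tp d(1)])
      fix s assume s: "0 < s" "f s \<in> {c<..}"
      show "T + d \<le> s" using d(2)[of s] out[of s] s by fastforce
    qed
    ultimately show ?thesis ..
  qed
qed

text \<open>A visit to an open set lasts long enough to meet a rational time, and the clock has
  hardly advanced by then. A countable infimum makes the passage time measurable in the sample
  point.\<close>

lemma clock_hit_rational:
  assumes f: "cadlag_path f" and "open S"
  shows "clock_hit \<xi> f S = (INF q\<in>{q\<in>\<rat>. 0 < q}. if f q \<in> S then ennreal (clock \<xi> f q) else \<infinity>)" (is "_ = ?R")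
proof (rule antisym)
  show "clock_hit \<xi> f S \<le> ?R"
  proof (rule INF_greatest)
    fix q :: real assume "q \<in> {q\<in>\<rat>. 0 < q}"
    then show "clock_hit \<xi> f S \<le> (if f q \<in> S then ennreal (clock \<xi> f q) else \<infinity>)"
      unfolding clock_hit_def by (auto intro: Inf_lower)
  qed
  show "?R \<le> clock_hit \<xi> f S"
    unfolding clock_hit_def
  proof (rule Inf_greatest)
    fix v assume "v \<in> {ennreal (clock \<xi> f s) |s. 0 < s \<and> f s \<in> S}"
    then obtain s where s: "v = ennreal (clock \<xi> f s)" "0 < s" "f s \<in> S" by blast
    show "?R \<le> v" unfolding s(1)
    proof (rule ennreal_le_epsilon)
      fix e :: real assume "0 < e"
      obtain d where d: "0 < d" "\<And>u. s \<le> u \<Longrightarrow> u < s + d \<Longrightarrow> clock \<xi> f u < clock \<xi> f s + e"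
        using clock_right_approx[OF f less_imp_le[OF s(2)] \<open>0 < e\<close>] by blast
      have "\<forall>\<^sub>F r in at_right s. f r \<in> S"
        by (rule topological_tendstoD[OF cadlag_path_right[OF f less_imp_le[OF s(2)]] \<open>open S\<close> s(3)])
      then obtain b where b: "s < b" "\<And>r. s < r \<Longrightarrow> r < b \<Longrightarrow> f r \<in> S" by (auto simp: eventually_at_right_field)
      have "s < min b (s + d)" using b(1) d(1) by simp
      then obtain q where q: "q \<in> \<rat>" "s < q" "q < min b (s + d)" using Rats_dense_in_real by blast
      have "?R \<le> ennreal (clock \<xi> f q)" using q b(2)[of q] s(2) by (intro INF_lower2[of q]) auto
      also have "\<dots> \<le> ennreal (clock \<xi> f s + e)" using d(2)[of q] q by (intro ennreal_leI) simp
      also have "\<dots> = ennreal (clock \<xi> f s) + ennreal e" using clock_nonneg \<open>0 < e\<close> by simp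
      finally show "?R \<le> ennreal (clock \<xi> f s) + ennreal e" .
    qed
  qed
qed

lemma (in levy_process) clock_hit_measurable:
  assumes S: "open S"
  shows "(\<lambda>z. clock_hit \<xi> (\<lambda>t. X t z) S) \<in> borel_measurable M"
proof -
  have [measurable]: "S \<in> sets borel" using S by simp
  have cm: "(\<lambda>z. clock \<xi> (\<lambda>t. X t z) q) \<in> borel_measurable M" for q
  proof -
    have [measurable]: "(\<lambda>p. X (max 0 (snd p)) (fst p)) \<in> borel_measurable (M \<Otimes>\<^sub>M borel)"
      by (rule X_joint_measurable) measurable
    have "(\<lambda>z. LINT w|lborel. indicator {0..q} w *\<^sub>R exp (- \<xi> * X (max 0 w) z)) \<in> borel_measurable M"
      by (rule lborel.borel_measurable_lebesgue_integral) (simp add: case_prod_beta')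
    moreover have "(LINT w|lborel. indicator {0..q} w *\<^sub>R exp (- \<xi> * X (max 0 w) z)) = clock \<xi> (\<lambda>t. X t z) q" for z
      unfolding clock_def set_lebesgue_integral_def
      by (intro Bochner_Integration.integral_cong) (auto simp: indicator_def max_def)
    ultimately show ?thesis by (simp only:)
  qed
  have "(\<lambda>z. INF q\<in>{q\<in>\<rat>. 0 < q}. if X q z \<in> S then ennreal (clock \<xi> (\<lambda>t. X t z) q) else \<infinity>) \<in> borel_measurable M"
  proof (rule borel_measurable_INF)
    show "countable {q\<in>\<rat>. (0::real) < q}" by (rule countable_subset[OF _ countable_rat]) auto
    fix q :: real assume "q \<in> {q\<in>\<rat>. 0 < q}"
    then have [measurable]: "X q \<in> borel_measurable M" by simp
    note cm[measurable]
    show "(\<lambda>z. if X q z \<in> S then ennreal (clock \<xi> (\<lambda>t. X t z) q) else \<infinity>) \<in> borel_measurable M"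
      by measurable
  qed
  then show ?thesis
    by (rule measurable_cong[THEN iffD1, rotated]) (simp add: clock_hit_rational[OF cadlag S])
qed

theorem mainTheorem7:
  fixes M :: "'a measure" and X :: "real \<Rightarrow> 'a \<Rightarrow> real"
    and \<psi> W \<omega> W\<omega> Z\<omega> :: "real \<Rightarrow> real"
    and \<xi> b c \<rho>0 \<rho> :: real
    and \<sigma>b \<sigma>c :: "'a \<Rightarrow> ennreal"
  assumes "spectrally_negative_levy M X"
    and "laplace_exponent M X \<psi>"
    and "scale_function \<psi> 0 W"
    and "\<xi> > 0" and "b < 0" and "0 < c" and "\<rho>0 \<ge> 0"
    and "\<sigma>b = passage_above \<xi> X (exp (- b))"
    and "\<sigma>c = passage_below \<xi> X (exp (- c))"
    and "\<rho> = \<rho>0 * exp (- \<xi> * b)"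
    and "\<omega> = (\<lambda>x. \<rho> * exp (- \<xi> * x))"
    and "omega_scale_W W \<omega> W\<omega>"
    and "omega_scale_Z W \<omega> Z\<omega>"
  shows "(LINT z:{z \<in> space M. \<sigma>c z < \<sigma>b z}|M. exp (- \<rho>0 * enn2real (\<sigma>c z)))
           = W\<omega> (- b) / W\<omega> (c - b) \<and>
         (LINT z:{z \<in> space M. \<sigma>b z < \<sigma>c z}|M. exp (- \<rho>0 * enn2real (\<sigma>b z)))
           = Z\<omega> (- b) - W\<omega> (- b) / W\<omega> (c - b) * Z\<omega> (c - b)"
proof -
  interpret spectrally_negative_levy M X by fact
  interpret levy_scale M X \<psi> W by unfold_locales fact+
  \<comment> \<open>Everything is shifted by -b: the path of \<open>X\<close> from 0 in [b, c]
    becomes one from -b in [0, c - b].\<close>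
  let ?f = "\<lambda>z t. X t z" and ?A = "up_exit 0 (c - b) (- b)" and ?D = "exit_disc \<omega> 0 (c - b) (- b)"
  have om: "continuous_on UNIV \<omega>" "\<And>y. 0 \<le> \<omega> y"
    using assms(7,10,11) by (auto intro!: continuous_intros)
  have \<sigma>: "\<sigma>b z = clock_hit \<xi> (?f z) {..<b}" "\<sigma>c z = clock_hit \<xi> (?f z) {c<..}" if "z \<in> space M" for z
    using passage_above_clock_hit[where X=X, OF cadlag[OF that]] passage_below_clock_hit[where X=X, OF cadlag[OF that]] assms(8,9) by auto
  have \<sigma>bm[measurable]: "\<sigma>b \<in> borel_measurable M"
    by (rule measurable_cong[THEN iffD2, OF \<sigma>(1) clock_hit_measurable]) simp_all
  have \<sigma>cm[measurable]: "\<sigma>c \<in> borel_measurable M"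
    by (rule measurable_cong[THEN iffD2, OF \<sigma>(2) clock_hit_measurable]) simp_all
  have [measurable]: "?D \<in> borel_measurable M" by (rule exit_measurable(2)[OF om(1)])
  \<comment> \<open>The transformation exp(-x) reverses directions: an exit of \<open>X\<close>
    through \<open>c\<close> is a passage of the transformed process below \<open>exp (- c)\<close>,
    an exit at or below \<open>b\<close> a passage above \<open>exp (- b)\<close>.\<close>
  have key: "AE z in M. z \<in> space M \<and> (if z \<in> ?A then \<sigma>c z < \<sigma>b z \<and> exp (- \<rho>0 * enn2real (\<sigma>c z)) = ?D z
      else \<sigma>b z < \<sigma>c z \<and> exp (- \<rho>0 * enn2real (\<sigma>b z)) = ?D z)"
  proof -
    have "0 < c - b" "- b \<in> {0..c - b}" using assms(5,6) by auto
    from AE_exit[OF this] AE_X0 show ?thesis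
    proof eventually_elim
      case (elim z)
      then have z: "z \<in> space M" and X0: "X 0 z = 0" and ex: "exits 0 (c - b) (- b) z" by auto
      note f = cadlag[OF z]
      define T where "T = exit_inf b c (?f z)"
      have pe: "path (- b) z s \<notin> {0..c - b} \<longleftrightarrow> X s z \<notin> {b..c}" for s using X0 by auto
      have Te: "exit_inf 0 (c - b) (path (- b) z) = T" unfolding T_def exit_inf_def pe ..
      obtain s0 where s0: "0 \<le> s0" "X s0 z \<notin> {b..c}" using ex unfolding exits_def pe by blast
      have pos: "exit_pos 0 (c - b) (- b) z = X T z - b" unfolding exit_pos_def Te using ex X0 by simp
      \<comment> \<open>The factor \<open>exp (- \<xi> * b)\<close> in \<open>\<rho>\<close> cancels
        the shift of the path by -b, so the rate collected along the shifted path is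
        \<open>\<rho>0\<close> times the clock of \<open>X\<close>.\<close>
      have D: "?D z = exp (- \<rho>0 * clock \<xi> (?f z) T)"
      proof -
        have "\<omega> (path (- b) z s) = \<rho>0 * exp (- \<xi> * X s z)" for s
        proof -
          have "\<omega> (path (- b) z s) = \<rho>0 * (exp (- \<xi> * b) * exp (- \<xi> * (X s z - b)))"
            using X0 by (simp add: assms(10,11) mult.assoc)
          also have "exp (- \<xi> * b) * exp (- \<xi> * (X s z - b)) = exp (- \<xi> * X s z)"
            by (simp add: exp_add[symmetric] right_diff_distrib)
          finally show ?thesis .
        qed
        then show ?thesis using ex unfolding exit_disc_def Te clock_def by simp
      qed
      have b0: "b < ?f z 0" "?f z 0 < c" using X0 assms(5,6) by auto
      note order = clock_hit_order[OF f b0 s0, of \<xi>, folded T_def]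
      show ?case
      proof (cases "z \<in> ?A")
        case True
        then have "c \<le> X T z" using elim pos by auto
        then show ?thesis using order(1) \<sigma>[OF z] True z D by (simp add: clock_nonneg)
      next
        case False
        then have "X T z \<le> b" using elim pos by auto
        then show ?thesis using order(2) \<sigma>[OF z] False z D by (simp add: clock_nonneg)
      qed
    qed
  qed
  have "(LINT z:{z \<in> space M. \<sigma>c z < \<sigma>b z}|M. exp (- \<rho>0 * enn2real (\<sigma>c z))) = expectation (\<lambda>z. ?D z * indicator ?A z)"
    unfolding set_lebesgue_integral_def
  proof (rule integral_cong_AE)
    show "AE z in M. indicator {z \<in> space M. \<sigma>c z < \<sigma>b z} z *\<^sub>R exp (- \<rho>0 * enn2real (\<sigma>c z)) = ?D z * indicator ?A z"
      using key by eventually_elim (auto split: if_splits simp: indicator_def)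
  qed measurable
  moreover have "(LINT z:{z \<in> space M. \<sigma>b z < \<sigma>c z}|M. exp (- \<rho>0 * enn2real (\<sigma>b z))) = expectation (\<lambda>z. ?D z * indicator (space M - ?A) z)"
    unfolding set_lebesgue_integral_def
  proof (rule integral_cong_AE)
    show "AE z in M. indicator {z \<in> space M. \<sigma>b z < \<sigma>c z} z *\<^sub>R exp (- \<rho>0 * enn2real (\<sigma>b z)) = ?D z * indicator (space M - ?A) z"
      using key by eventually_elim (auto split: if_splits simp: indicator_def)
  qed measurable
  moreover have "0 < - b" "- b < c - b" using assms(5,6) by auto
  note id = omega_exit_identities[OF this om assms(12,13)]
  have "expectation (\<lambda>z. ?D z * indicator ?A z) = W\<omega> (- b) / W\<omega> (c - b)"
    using id(1,2) by (simp add: field_simps)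
  moreover from this id(3) have "expectation (\<lambda>z. ?D z * indicator (space M - ?A) z) = Z\<omega> (- b) - W\<omega> (- b) / W\<omega> (c - b) * Z\<omega> (c - b)"
    by (simp add: mult.commute)
  ultimately show ?thesis by simp
qed

end
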